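(* Let $\Gamma$ be a finite weighted directed graph which satisfies the obvious conditions for the dynamic portrait of a NET map. Then $\Gamma$ is isomorphic to the dynamic portrait of a NET map if and only if $\Gamma$ satisfies the exceptional condition.
   Context: A Thurston map is an orientation-preserving branched covering $f\colon S^2\to S^2$ of degree at least $2$ whose postcritical set $P_f=\bigcup_{k\ge 1}f^{k}(C_f)$ is finite, where $C_f$ is the set of critical points. A nearly Euclidean Thurston (NET) map is a Thurston map each of whose critical points is simple (local degree $2$) and whose postcritical set has exactly four points. Dynamic portraits. The dynamic portrait of a Thurston map $f$ is the weighted directed graph with vertex set $C_f\cup P_f$ and, for each vertex $x$, one edge from $x$ to $f(x)$ with weight the local degree $\deg(f,x)$. Obvious conditions. Let $\Gamma$ be a finite directed graph with edges weighted by positive integers and exactly one edge emanating from every vertex. A vertex is critical if its outgoing edge has weight greater than $1$; a critical value is the terminal vertex of the edge leaving a critical vertex; a postcritical vertex is one reached from a critical vertex by a directed path of length at least $1$. The incoming degree of a vertex is the sum of the weights of the edges ending at it. $\Gamma$ satisfies the obvious conditions for the dynamic portrait of a Thurston map if exactly one edge emanates from every vertex, every vertex is critical or postcritical, and there is an integer $d\ge2$ (the degree of $\Gamma$) such that $\sum_{v}(w(v)-1)=2d-2$ (sum over critical vertices $v$, $w(v)$ being the weight of the edge leaving $v$) and every incoming degree is at most $d$. It satisfies the obvious conditions for the dynamic portrait of a NET map if in addition every edge weight is $1$ or $2$ and there are exactly four postcritical vertices. Exceptional condition. For $\Gamma$ satisfying the obvious conditions for the dynamic portrait of a NET map with degree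 $d$, let $k$ be the number of critical values $x$ of $\Gamma$ whose incoming degree is $d$ and such that no edge of $\Gamma$ ending at $x$ has weight $1$. Then $k\in\{0,2,3\}$, and the mod $2$ elementary divisors of $\Gamma$ are defined to be $(1,1)$, $(0,1)$ or $(0,0)$ according to whether $k=0$, $2$ or $3$. $\Gamma$ satisfies the exceptional condition if the following holds: if the mod $2$ elementary divisors of $\Gamma$ are both $0$, then $4$ divides $d$. *)

theory Defs
  imports "HOL-Homology.Homology" "Graph_Theory.Graph_Theory"
begin

section \<open>Thurston maps on the 2-sphere\<close>

text \<open>
  The 2-sphere is the library topology \<^term>\<open>nsphere 2\<close>, whose points are functions
  \<^typ>\<open>nat \<Rightarrow> real\<close>; a self-map of the sphere is a function on that type of which only the
  values on \<^term>\<open>topspace (nsphere 2)\<close> matter.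
\<close>

abbreviation S2 :: "(nat \<Rightarrow> real) set" where
  "S2 \<equiv> topspace (nsphere 2)"

text \<open>
  A disc chart of the sphere is a homeomorphism of an open set onto the open unit disc, centred
  at a point.  Near x the map has local degree d if it is \<open>z \<mapsto> z ^ d\<close> in suitable centred charts
  at x and at its image.  The charts may reverse orientation; orientation is taken
  care of globally below.
\<close>

definition centred_chart ::
  "(nat \<Rightarrow> real) set \<Rightarrow> (nat \<Rightarrow> real) \<Rightarrow> ((nat \<Rightarrow> real) \<Rightarrow> complex) \<Rightarrow> bool" where
  "centred_chart U x \<phi> \<longleftrightarrow>
     openin (nsphere 2) U \<and> x \<in> U \<and> \<phi> x = 0 \<and>
     homeomorphic_map (subtopology (nsphere 2) U) (top_of_set (ball (0::complex) 1)) \<phi>"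

definition has_local_degree ::
  "((nat \<Rightarrow> real) \<Rightarrow> (nat \<Rightarrow> real)) \<Rightarrow> (nat \<Rightarrow> real) \<Rightarrow> nat \<Rightarrow> bool" where
  "has_local_degree f x d \<longleftrightarrow>
     1 \<le> d \<and>
     (\<exists>U V \<phi> \<psi>. centred_chart U x \<phi> \<and> centred_chart V (f x) \<psi> \<and> f ` U \<subseteq> V \<and>
        (\<forall>u\<in>U. \<psi> (f u) = \<phi> u ^ d))"

text \<open>
  As the sphere is compact, this local form of the definition of a branched covering
  automatically yields finitely many sheets and finitely many critical points.
\<close>

definition branched_covering :: "((nat \<Rightarrow> real) \<Rightarrow> (nat \<Rightarrow> real)) \<Rightarrow> bool" where
  "branched_covering f \<longleftrightarrow>
     continuous_map (nsphere 2) (nsphere 2) f \<and> (\<forall>x\<in>S2. \<exists>d. has_local_degree f x d)"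

definition local_degree :: "((nat \<Rightarrow> real) \<Rightarrow> (nat \<Rightarrow> real)) \<Rightarrow> (nat \<Rightarrow> real) \<Rightarrow> nat" where
  "local_degree f x = (THE d. has_local_degree f x d)"

text \<open>
  The Brouwer degree of a branched covering is plus or minus the number of sheets, the sign being
  the common sign with which the map acts on local orientations away from its critical points.
\<close>

definition orientation_preserving :: "((nat \<Rightarrow> real) \<Rightarrow> (nat \<Rightarrow> real)) \<Rightarrow> bool" where
  "orientation_preserving f \<longleftrightarrow> 0 < Brouwer_degree2 2 f"

definition critical_points :: "((nat \<Rightarrow> real) \<Rightarrow> (nat \<Rightarrow> real)) \<Rightarrow> (nat \<Rightarrow> real) set" where
  "critical_points f = {x \<in> S2. 1 < local_degree f x}"

definition postcritical_set :: "((nat \<Rightarrow> real) \<Rightarrow> (nat \<Rightarrow> real)) \<Rightarrow> (nat \<Rightarrow> real) set" where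
  "postcritical_set f = (\<Union>k\<in>{1..}. (f ^^ k) ` critical_points f)"

definition Thurston_map :: "((nat \<Rightarrow> real) \<Rightarrow> (nat \<Rightarrow> real)) \<Rightarrow> bool" where
  "Thurston_map f \<longleftrightarrow>
     branched_covering f \<and> orientation_preserving f \<and> 2 \<le> Brouwer_degree2 2 f \<and>
     finite (postcritical_set f)"

definition NET_map :: "((nat \<Rightarrow> real) \<Rightarrow> (nat \<Rightarrow> real)) \<Rightarrow> bool" where
  "NET_map f \<longleftrightarrow>
     Thurston_map f \<and> (\<forall>x\<in>critical_points f. local_degree f x = 2) \<and>
     card (postcritical_set f) = 4"


section \<open>Weighted digraphs and dynamic portraits\<close>

text \<open>
  A weighted directed graph is a digraph G together with a weight function w on its edges
  (only the weights of the edges in \<^term>\<open>arcs G\<close> matter).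
\<close>

definition finite_weighted_digraph :: "('a, 'b) pre_digraph \<Rightarrow> ('b \<Rightarrow> nat) \<Rightarrow> bool" where
  "finite_weighted_digraph G w \<longleftrightarrow> fin_digraph G \<and> (\<forall>e\<in>arcs G. 0 < w e)"

definition weighted_digraph_iso ::
  "('a, 'b) pre_digraph \<Rightarrow> ('b \<Rightarrow> nat) \<Rightarrow> ('c, 'd) pre_digraph \<Rightarrow> ('d \<Rightarrow> nat) \<Rightarrow> bool" where
  "weighted_digraph_iso G w H w' \<longleftrightarrow>
     (\<exists>h. pre_digraph.digraph_isomorphism G h \<and> H = app_iso h G \<and>
          (\<forall>e\<in>arcs G. w' (iso_arcs h e) = w e))"

text \<open>
  In the dynamic portrait the edge leaving a vertex x is x itself; its weight function
  is \<^term>\<open>local_degree f\<close>.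
\<close>

definition dynamic_portrait ::
  "((nat \<Rightarrow> real) \<Rightarrow> (nat \<Rightarrow> real)) \<Rightarrow> (nat \<Rightarrow> real, nat \<Rightarrow> real) pre_digraph" where
  "dynamic_portrait f =
     \<lparr> verts = critical_points f \<union> postcritical_set f,
       arcs = critical_points f \<union> postcritical_set f,
       tail = (\<lambda>x. x), head = f \<rparr>"


section \<open>The obvious conditions and the exceptional condition\<close>

text \<open>
  The following notions refer to the edge leaving a vertex, and are meaningful only for graphs
  in which exactly one edge emanates from every vertex.
\<close>

definition out_edge :: "('a, 'b) pre_digraph \<Rightarrow> 'a \<Rightarrow> 'b" where
  "out_edge G v = (THE e. e \<in> out_arcs G v)"

definition critical_vertices :: "('a, 'b) pre_digraph \<Rightarrow> ('b \<Rightarrow> nat) \<Rightarrow> 'a set" where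
  "critical_vertices G w = {v \<in> verts G. 1 < w (out_edge G v)}"

definition critical_values :: "('a, 'b) pre_digraph \<Rightarrow> ('b \<Rightarrow> nat) \<Rightarrow> 'a set" where
  "critical_values G w = (\<lambda>v. head G (out_edge G v)) ` critical_vertices G w"

definition postcritical_vertices :: "('a, 'b) pre_digraph \<Rightarrow> ('b \<Rightarrow> nat) \<Rightarrow> 'a set" where
  "postcritical_vertices G w = {v \<in> verts G. \<exists>u\<in>critical_vertices G w. reachable1 G u v}"

definition incoming_degree :: "('a, 'b) pre_digraph \<Rightarrow> ('b \<Rightarrow> nat) \<Rightarrow> 'a \<Rightarrow> nat" where
  "incoming_degree G w v = (\<Sum>e\<in>in_arcs G v. w e)"

definition has_portrait_degree :: "('a, 'b) pre_digraph \<Rightarrow> ('b \<Rightarrow> nat) \<Rightarrow> nat \<Rightarrow> bool" where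
  "has_portrait_degree G w d \<longleftrightarrow>
     2 \<le> d \<and>
     (\<Sum>v\<in>critical_vertices G w. w (out_edge G v) - 1) = 2 * d - 2 \<and>
     (\<forall>v\<in>verts G. incoming_degree G w v \<le> d)"

definition portrait_degree :: "('a, 'b) pre_digraph \<Rightarrow> ('b \<Rightarrow> nat) \<Rightarrow> nat" where
  "portrait_degree G w = (THE d. has_portrait_degree G w d)"

definition Thurston_obvious_conditions :: "('a, 'b) pre_digraph \<Rightarrow> ('b \<Rightarrow> nat) \<Rightarrow> bool" where
  "Thurston_obvious_conditions G w \<longleftrightarrow>
     (\<forall>v\<in>verts G. \<exists>!e. e \<in> out_arcs G v) \<and>
     verts G = critical_vertices G w \<union> postcritical_vertices G w \<and>
     (\<exists>d. has_portrait_degree G w d)"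

definition NET_obvious_conditions :: "('a, 'b) pre_digraph \<Rightarrow> ('b \<Rightarrow> nat) \<Rightarrow> bool" where
  "NET_obvious_conditions G w \<longleftrightarrow>
     Thurston_obvious_conditions G w \<and>
     (\<forall>e\<in>arcs G. w e = 1 \<or> w e = 2) \<and>
     card (postcritical_vertices G w) = 4"

definition full_critical_values :: "('a, 'b) pre_digraph \<Rightarrow> ('b \<Rightarrow> nat) \<Rightarrow> 'a set" where
  "full_critical_values G w =
     {x \<in> critical_values G w.
        incoming_degree G w x = portrait_degree G w \<and> (\<forall>e\<in>in_arcs G x. w e \<noteq> 1)}"

text \<open>
  Under the NET obvious conditions k is always 0, 2 or 3.  Indeed the 2d - 2 edges of
  weight 2 end at the four postcritical vertices, at most d/2 of them at each; so k is 0
  if d is odd, and 2 or 3 if d is even.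
\<close>

definition mod2_elementary_divisors :: "('a, 'b) pre_digraph \<Rightarrow> ('b \<Rightarrow> nat) \<Rightarrow> nat \<times> nat" where
  "mod2_elementary_divisors G w =
     (let k = card (full_critical_values G w) in
      if k = 0 then (1, 1) else if k = 2 then (0, 1) else if k = 3 then (0, 0) else undefined)"

definition exceptional_condition :: "('a, 'b) pre_digraph \<Rightarrow> ('b \<Rightarrow> nat) \<Rightarrow> bool" where
  "exceptional_condition G w \<longleftrightarrow>
     (mod2_elementary_divisors G w = (0, 0) \<longrightarrow> 4 dvd portrait_degree G w)"

end

theory Submission
  imports Defs "HOL-Complex_Analysis.Conformal_Mappings"
begin

text \<open>
  Let P be the quotient of the plane by the group generated by the half-turns about the Gaussian
  integers, a sphere (the pillowcase) with four corners.  If f is a NET map, choose P so that its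
  corners are the postcritical points.  As f has local degree at most 2, and degree 2 only
  over corners, P lifts through f to a map Q from the plane with \<open>f \<circ> Q = P\<close>.  The symmetries of Q are the
  translations by 2L for a lattice L of Gaussian integers, together with half-turns about a set I.  The
  non-critical points over a corner correspond to the classes modulo 2L of the points of I lying over that corner.
  If three critical values are full, then I lies over a single corner; hence L consists of
  doubles of Gaussian integers, so that 4 divides the index of L, which is the degree.

  Conversely, the diagonal linear maps (d, 1) and (d/2, 2) descend to the pillowcase and realize the possible
  distributions of critical points over the corners.  Precomposing with a homeomorphism
  that takes the corners to prescribed points realizes every portrait with that distribution.  The Brouwer degree
  is computed after deforming the pillowcase so that the map becomes \<open>\<zeta> \<mapsto> \<zeta>\<^sup>m / \<bar>\<zeta>\<bar>\<^sup>m\<^sup>-\<^sup>1\<close> in one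
  complex coordinate, a map that is invariant under a cyclic group of rotations.
\<close>

section \<open>Brouwer degree of maps with a cyclic symmetry\<close>

text \<open>For a postcritical vertex q, the degree minus twice the number of critical edges into q
  is a nonnegative number with the parity of the degree, and the four such numbers add up to 4.
  Hence they are 1,1,1,1 or 0,0,2,2 or 0,0,0,4, and only the last pattern can be obstructed. The
  diagonal maps produce these patterns because modulo 2 they are the identity, the projection that
  kills the real part, or zero. For necessity, the index of L is compared with the portrait degree
  by counting points over the corners; the non-critical ones number at most 4 because L/2L has at
  most 4 elements. A recurring obstacle is that two lifts may agree at a Gaussian integer without
  being equal, so uniqueness is always applied at a nearby generic point. For the Brouwer degree,
  translation by a fraction of a period does not in general carry half-turns about Gaussian integers
  to such half-turns, so a diagonal map has no evident rotational symmetry; the deformed pillowcase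
  supplies one.\<close>

lemma homologous_rel_mono:
  assumes "homologous_rel p X S a b" "S \<subseteq> T"
  shows "homologous_rel p X T a b"
proof -
  obtain d e where de: "singular_chain (Suc p) X d" "singular_chain p (subtopology X S) e"
    "chain_boundary (Suc p) d + e = a - b"
    using assms(1) unfolding homologous_rel_def singular_relboundary by blast
  then have "singular_chain p (subtopology X T) e"
    using assms(2) singular_chain_mono by blast
  then show ?thesis
    using de unfolding homologous_rel_def singular_relboundary by blast
qed

lemma homologous_rel_chain_map:
  assumes "homologous_rel p X S a b" "continuous_map X Y f" "f \<in> S \<rightarrow> T"
  shows "homologous_rel p Y T (chain_map p f a) (chain_map p f b)"
proof -
  obtain d e where de: "singular_chain (Suc p) X d" "singular_chain p (subtopology X S) e"
    "chain_boundary (Suc p) d + e = a - b"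
    using assms(1) unfolding homologous_rel_def singular_relboundary by blast
  have "singular_chain (Suc p) Y (chain_map (Suc p) f d)"
    using de assms(2) singular_chain_chain_map by blast
  moreover have "singular_chain p (subtopology Y T) (chain_map p f e)"
    using de(2) assms(2,3)
    by (intro singular_chain_chain_map)
      (auto simp: continuous_map_in_subtopology continuous_map_from_subtopology image_subset_iff_funcset)
  moreover have "chain_boundary (Suc p) (chain_map (Suc p) f d) + chain_map p f e = chain_map p f a - chain_map p f b"
    using chain_boundary_chain_map[OF de(1), of f] arg_cong[OF de(3), of "chain_map p f"]
    by (simp add: chain_map_add chain_map_diff)
  ultimately show ?thesis
    unfolding homologous_rel_def singular_relboundary by blast
qed

lemma homologous_rel_sum_zero_outside:
  assumes "singular_chain p (subtopology X S) e"
  shows "homologous_rel p X S (a + e) a"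
  using singular_chain_imp_relboundary[OF assms] by (simp add: homologous_rel_def)

text \<open>Subdivision makes every simplex lie in some \<open>U k\<close> or miss all the points.
  The simplices inside \<open>U k\<close> are collected into the k-th piece; whatever is left over
  dies relative to the complement of the points.\<close>

lemma cycle_split_at_points:
  assumes c: "singular_relcycle p X {} c" and K: "finite K"
    and U: "\<And>k. k \<in> K \<Longrightarrow> openin X (U k)" "disjoint_family_on U K"
    and x: "\<And>k. k \<in> K \<Longrightarrow> x k \<in> U k"
    and F: "openin X (topspace X - x ` K)"
  obtains c' where "\<And>k. k \<in> K \<Longrightarrow> singular_relcycle p (subtopology X (U k)) (U k - {x k}) (c' k)"
    "homologous_rel p X (topspace X - x ` K) c (\<Sum>k\<in>K. c' k)"
proof -
  let ?W = "topspace X - x ` K"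
  have cover: "topspace X \<subseteq> \<Union>(insert ?W (U ` K))"
    using x by auto
  have op: "\<And>V. V \<in> insert ?W (U ` K) \<Longrightarrow> openin X V"
    using U F by auto
  obtain d where d: "singular_relcycle p X {} d" "homologous_rel p X {} c d"
    and small: "\<And>f. f \<in> Poly_Mapping.keys d \<Longrightarrow> \<exists>V\<in>insert ?W (U ` K). f \<in> standard_simplex p \<rightarrow> V"
    using small_homologous_rel_relcycle_exists[OF op cover c, of thesis] by blast
  define A where "A k f \<longleftrightarrow> f ` standard_simplex p \<subseteq> U k" for k f
  define r where "r k = frag_extend (\<lambda>f. if A k f then frag_of f else 0) d" for k
  \<comment> \<open>What remains of \<open>d\<close> without the pieces: its simplices lie in no
    \<open>U k\<close>, hence in \<open>?W\<close>.\<close>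
  define e where "e = d - (\<Sum>k\<in>K. r k)"
  have ne: "standard_simplex p \<noteq> {}" by (rule nonempty_standard_simplex)
  have uniq: "k = l" if "k \<in> K" "l \<in> K" "A k f" "A l f" for k l f
  proof (rule ccontr)
    assume "k \<noteq> l"
    then have "U k \<inter> U l = {}" using U(2) that by (auto simp: disjoint_family_on_def)
    then show False using that ne unfolding A_def by blast
  qed
  have dch: "singular_chain p X d" using d(1) by (simp add: singular_relcycle)
  have keysr: "f \<in> Poly_Mapping.keys d \<and> A k f" if "f \<in> Poly_Mapping.keys (r k)" for f k
  proof -
    have "f \<in> (\<Union>x\<in>Poly_Mapping.keys d. Poly_Mapping.keys (if A k x then frag_of x else 0))"
      using that unfolding r_def by (rule subsetD[OF keys_frag_extend, rotated])
    then show ?thesis by (auto split: if_splits)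
  qed
  have rch: "singular_chain p (subtopology X (U k)) (r k)" for k
    unfolding singular_chain_subtopology using dch keysr[of _ k]
    unfolding singular_chain_def A_def by blast
  have 1: "(\<Sum>k\<in>K. r k) = frag_extend (\<lambda>f. \<Sum>k\<in>K. if A k f then frag_of f else 0) d"
    unfolding r_def frag_extend_def
    by (subst sum.swap) (simp add: frag_cmul_sum)
  have 2: "d = frag_extend frag_of d"
    by (rule frag_expansion)
  have e_eq: "e = frag_extend (\<lambda>f. if \<exists>k\<in>K. A k f then 0 else frag_of f) d"
  proof -
    have if_sum: "(\<Sum>k\<in>K. if A k f then frag_of f else 0) = (if \<exists>k\<in>K. A k f then frag_of f else 0)" for f
    proof (cases "\<exists>k\<in>K. A k f")
      case True
      then obtain k where k: "k \<in> K" "A k f" by auto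
      have "(\<Sum>j\<in>K. if A j f then frag_of f else 0) = (\<Sum>j\<in>K. if j = k then frag_of f else 0)"
        by (intro sum.cong refl) (metis k uniq)
      then show ?thesis using k K by auto
    next
      case False
      then show ?thesis by simp
    qed
    have 3: "(\<Sum>k\<in>K. r k) = frag_extend (\<lambda>f. if \<exists>k\<in>K. A k f then frag_of f else 0) d"
      using 1 unfolding if_sum .
    have "e = frag_extend frag_of d - (\<Sum>k\<in>K. r k)"
      unfolding e_def using arg_cong[OF 2, of "\<lambda>x. x - (\<Sum>k\<in>K. r k)"] .
    also have "\<dots> = frag_extend (\<lambda>f. if \<exists>k\<in>K. A k f then 0 else frag_of f) d"
      unfolding 3 frag_extend_def sum_subtractf[symmetric]
      by (rule sum.cong) auto
    finally show ?thesis .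
  qed
  have ech: "singular_chain p (subtopology X ?W) e"
  proof -
    have keyse: "f \<in> Poly_Mapping.keys d \<and> \<not> (\<exists>k\<in>K. A k f)" if "f \<in> Poly_Mapping.keys e" for f
    proof -
      have "f \<in> (\<Union>x\<in>Poly_Mapping.keys d. Poly_Mapping.keys (if \<exists>k\<in>K. A k x then 0 else frag_of x))"
        using that unfolding e_eq by (rule subsetD[OF keys_frag_extend, rotated])
      then show ?thesis by (auto split: if_splits)
    qed
    have "f ` standard_simplex p \<subseteq> ?W" if "f \<in> Poly_Mapping.keys e" for f
      using keyse[OF that] small[of f] unfolding A_def by (auto simp: image_subset_iff Pi_iff)
    then show ?thesis
      unfolding singular_chain_subtopology using dch keyse
      unfolding singular_chain_def by blast
  qed
  have d_eq: "d = (\<Sum>k\<in>K. r k) + e" unfolding e_def by simp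
  have bd: "chain_boundary p d = 0"
    using d(1) by (simp add: singular_cycle)
  show ?thesis
  proof
    show "homologous_rel p X ?W c (\<Sum>k\<in>K. r k)"
    proof (rule homologous_rel_trans)
      show "homologous_rel p X ?W c d" using homologous_rel_mono[OF d(2), of ?W] by blast
      show "homologous_rel p X ?W d (\<Sum>k\<in>K. r k)"
        using homologous_rel_sum_zero_outside[OF ech, of "\<Sum>k\<in>K. r k"] d_eq by simp
    qed
    fix k assume k: "k \<in> K"
    \<comment> \<open>As \<open>d\<close> is a cycle, the boundary of \<open>r k\<close> is minus
      that of the other pieces and of \<open>e\<close>, all of which avoid
      \<open>x k\<close>.\<close>
    have "chain_boundary p (r k) = - ((\<Sum>j\<in>K - {k}. chain_boundary p (r j)) + chain_boundary p e)"
    proof -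
      have "0 = chain_boundary p (r k + (\<Sum>j\<in>K - {k}. r j) + e)"
        using bd arg_cong[OF d_eq, of "chain_boundary p"] sum.remove[OF K k, of r] by simp
      also have "\<dots> = chain_boundary p (r k) + (\<Sum>j\<in>K - {k}. chain_boundary p (r j)) + chain_boundary p e"
        by (simp add: chain_boundary_add chain_boundary_sum o_def)
      finally show ?thesis by (metis (no_types, lifting) add.assoc eq_neg_iff_add_eq_0)
    qed
    moreover have "singular_chain (p - Suc 0) (subtopology X (topspace X - {x k})) (chain_boundary p (r j))"
      if "j \<in> K - {k}" for j
    proof -
      have "U j \<subseteq> topspace X - {x k}"
      proof -
        have "U j \<subseteq> topspace X" using U(1)[of j] that by (simp add: openin_subset)
        moreover have "U j \<inter> U k = {}" using U(2) that k unfolding disjoint_family_on_def by blast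
        ultimately show ?thesis using x[OF k] by blast
      qed
      then have "singular_chain p (subtopology X (topspace X - {x k})) (r j)"
        using rch singular_chain_mono by blast
      then show ?thesis by (rule singular_chain_boundary)
    qed
    moreover have "singular_chain (p - Suc 0) (subtopology X (topspace X - {x k})) (chain_boundary p e)"
      by (rule singular_chain_boundary, rule singular_chain_mono[OF ech]) (use k in auto)
    ultimately have "singular_chain (p - Suc 0) (subtopology X (topspace X - {x k})) (chain_boundary p (r k))"
      by (simp only: singular_chain_minus) (intro singular_chain_add singular_chain_sum; blast)
    moreover have "singular_chain (p - Suc 0) (subtopology X (U k)) (chain_boundary p (r k))"
      using rch by (rule singular_chain_boundary)
    ultimately show "singular_relcycle p (subtopology X (U k)) (U k - {x k}) (r k)"
      unfolding singular_relcycle singular_chain_subtopology One_nat_def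
      using rch[of k, unfolded singular_chain_subtopology] by blast
  qed
qed

text \<open>Excision of the complement of U, which is closed and contained in the complement of x;
  the latter is open because points are closed.\<close>

lemma iso_excision_open:
  assumes "t1_space X" "openin X U" "x \<in> U"
  shows "hom_induced p (subtopology X U) (U - {x}) X (topspace X - {x}) id
    \<in> iso (relative_homology_group p (subtopology X U) (U - {x}))
          (relative_homology_group p X (topspace X - {x}))"
proof -
  have sub: "U \<subseteq> topspace X" using assms openin_subset by blast
  have "openin X (topspace X - {x})"
    by (meson assms closedin_t1_singleton openin_diff openin_topspace subsetD sub)
  then have 1: "X closure_of (topspace X - U) \<subseteq> X interior_of (topspace X - {x})"
    using assms by (simp add: closure_of_closedin interior_of_openin closedin_diff) auto
  have "topspace X - (topspace X - U) = U" "topspace X - {x} - (topspace X - U) = U - {x}"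
    using sub by auto
  then show ?thesis
    using homology_excision_axiom[OF 1, of "topspace X" p] by simp
qed

text \<open>Homology groups are written multiplicatively, so m equal local cycles turn into an m-th
  power. This is the origin of the factor m in the Brouwer degree.\<close>

lemma homologous_rel_set_sum_const:
  assumes "singular_relcycle p X S a"
  shows "homologous_rel_set p X S (\<Sum>k<(m::nat). a) =
    homologous_rel_set p X S a [^]\<^bsub>relative_homology_group (int p) X S\<^esub> m"
proof (induction m)
  case 0
  have "homologous_rel_set p X S 0 = singular_relboundary_set p X S"
    by (simp add: homologous_rel_set_eq_relboundary singular_relboundary_0)
  then show ?case by simp
next
  case (Suc m)
  interpret N: normal "singular_relboundary_set p X S" "relcycle_group p X S"
    by (rule normal_subgroup_singular_relboundary_relcycle)
  have h: "(\<lambda>a. homologous_rel_set p X S a) \<in> hom (relcycle_group p X S) (relative_homology_group (int p) X S)"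
    using N.r_coset_hom_Mod by (simp add: right_coset_singular_relboundary nontrivial_relative_homology_group)
  have "singular_relcycle p X S (\<Sum>k<m. a)"
    using assms by (intro singular_relcycle_sum)
  then have "homologous_rel_set p X S ((\<Sum>k<m. a) + a) =
    homologous_rel_set p X S (\<Sum>k<m. a) \<otimes>\<^bsub>relative_homology_group (int p) X S\<^esub> homologous_rel_set p X S a"
    using hom_mult[OF h] assms by simp
  then show ?case by (simp add: Suc)
qed

section \<open>The topology of the 2-sphere\<close>

lemma top_of_set_S2: "top_of_set S2 = nsphere 2"
  unfolding nsphere euclidean_product_topology topspace_euclidean_subtopology ..

lemma S2_iff: "x \<in> S2 \<longleftrightarrow> (x 0)\<^sup>2 + (x 1)\<^sup>2 + (x 2)\<^sup>2 = 1 \<and> (\<forall>i>2. x i = 0)"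
proof -
  have "{..2} = {0, 1, 2 :: nat}" by auto
  then show ?thesis
    unfolding nsphere euclidean_product_topology topspace_euclidean_subtopology by (simp add: add.assoc)
qed

text \<open>The points of \<open>S2\<close> live in an infinite product. Transport to
  \<open>complex \<times> real\<close> gives access to compactness and to the stereographic picture
  of the punctured sphere.\<close>

lemma homeomorphism_S2_sphere:
  obtains f :: "(nat \<Rightarrow> real) \<Rightarrow> complex \<times> real" and g where "homeomorphism S2 (sphere 0 1) f g"
proof -
  let ?B = "Basis :: (complex \<times> real) set"
  have "card ?B = 3" by simp
  obtain f g where "homeomorphic_maps (nsphere (3 - 1)) (top_of_set (sphere 0 1 \<inter> span ?B)) f g"
    by (rule homeomorphic_maps_nsphere_euclidean_sphere[OF independent_Basis orthogonal_Basis \<open>card ?B = 3\<close>]) auto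
  then have "homeomorphism S2 (sphere 0 1) f g"
    using homeomorphic_maps_iff_homeomorphism[of S2 "sphere 0 1" f g, unfolded top_of_set_S2] by simp
  then show ?thesis by (rule that)
qed

lemma compact_S2: "compact S2"
proof -
  obtain f :: "(nat \<Rightarrow> real) \<Rightarrow> complex \<times> real" and g where fg: "homeomorphism S2 (sphere 0 1) f g"
    by (rule homeomorphism_S2_sphere)
  show ?thesis
    using compact_continuous_image[OF homeomorphism_cont2[OF fg] compact_sphere] homeomorphism_image2[OF fg] by simp
qed

lemma t1_nsphere2: "t1_space (nsphere 2)"
proof -
  have "t1_space (top_of_set S2)"
    by (intro Hausdorff_imp_t1_space Hausdorff_space_subtopology Hausdorff_space_euclidean)
  then show ?thesis unfolding top_of_set_S2 .
qed

lemma homeomorphic_punctured_S2: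
  assumes "p \<in> S2"
  shows "S2 - {p} homeomorphic (UNIV :: complex set)"
proof -
  obtain f :: "(nat \<Rightarrow> real) \<Rightarrow> complex \<times> real" and g where fg: "homeomorphism S2 (sphere 0 1) f g"
    by (rule homeomorphism_S2_sphere)
  then have fp: "f p \<in> sphere 0 1" using assms unfolding homeomorphism_def by blast
  have inj: "inj_on f S2" by (rule inj_on_inverseI[of _ g]) (rule homeomorphism_apply1[OF fg])
  have im: "f ` (S2 - {p}) = sphere 0 1 - {f p}"
    using inj_on_image_set_diff[OF inj, of S2 "{p}"] assms homeomorphism_image1[OF fg] by simp
  have "homeomorphism (S2 - {p}) (sphere 0 1 - {f p}) f g"
    by (rule homeomorphism_of_subsets[OF fg _ _ im]) auto
  then have 1: "S2 - {p} homeomorphic sphere 0 1 - {f p}" unfolding homeomorphic_def by blast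
  have 2: "sphere 0 1 - {f p} homeomorphic (UNIV :: complex set)"
    by (rule homeomorphic_punctured_sphere_affine) (use fp in auto)
  show ?thesis by (rule homeomorphic_trans[OF 1 2])
qed

text \<open>Serves to identify the second homology of the sphere with its local homology at
  p.\<close>

lemma contractible_punctured_S2:
  assumes "p \<in> S2"
  shows "contractible_space (subtopology (nsphere 2) (S2 - {p}))"
proof -
  have "top_of_set (S2 - {p}) homeomorphic_space top_of_set (UNIV :: complex set)"
    using homeomorphic_punctured_S2[OF assms] by (simp only: homeomorphic_space_iff_homeomorphic)
  moreover have "contractible_space (top_of_set (UNIV :: complex set))"
    by (simp only: contractible_space_top_of_set convex_imp_contractible convex_UNIV)
  ultimately have "contractible_space (top_of_set (S2 - {p}))"
    using homeomorphic_space_contractibility by blast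
  moreover have "subtopology (nsphere 2) (S2 - {p}) = top_of_set (S2 - {p})"
  proof -
    have "S2 \<inter> (S2 - {p}) = S2 - {p}" by blast
    then show ?thesis by (metis top_of_set_S2 subtopology_subtopology)
  qed
  ultimately show ?thesis by simp
qed

lemma iso_eq_one_iff:
  assumes "f \<in> iso G H" "group G" "group H" "x \<in> carrier G"
  shows "f x = \<one>\<^bsub>H\<^esub> \<longleftrightarrow> x = \<one>\<^bsub>G\<^esub>"
proof -
  interpret group_hom G H f
    using assms by (simp add: group_hom_def group_hom_axioms_def iso_def)
  have "inj_on f (carrier G)" using assms(1) by (simp add: iso_def bij_betw_def)
  then show ?thesis using assms(4) by (metis G.one_closed hom_one inj_onD)
qed

text \<open>
  A fundamental cycle is homologous to a sum of local cycles at the points of one fibre.  The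
  maps \<open>\<rho> k\<close> permute these local cycles and do not change their images under g, so all m of them contribute the same
  local class; it is nonzero because g is a local homeomorphism.
\<close>

theorem Brouwer_degree2_cyclic:
  fixes g :: "(nat \<Rightarrow> real) \<Rightarrow> (nat \<Rightarrow> real)"
  assumes g: "continuous_map (nsphere 2) (nsphere 2) g"
    and \<rho>: "\<And>k. k < m \<Longrightarrow> homotopic_with (\<lambda>_. True) (nsphere 2) (nsphere 2) (\<rho> k) id"
      "\<And>k. k < m \<Longrightarrow> inj_on (\<rho> k) S2"
      "\<And>k x. k < m \<Longrightarrow> x \<in> S2 \<Longrightarrow> g (\<rho> k x) = g x"
    and \<rho>0: "\<And>x. \<rho> 0 x = x" and m: "0 < m"
    and x0: "x0 \<in> U0" and U0: "\<And>k. k < m \<Longrightarrow> openin (nsphere 2) (\<rho> k ` U0)"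
    and disj: "disjoint_family_on (\<lambda>k. \<rho> k ` U0) {..<m}"
    and fib: "\<And>x. x \<in> S2 \<Longrightarrow> g x = g x0 \<Longrightarrow> \<exists>k<m. x = \<rho> k x0"
    and V: "openin (nsphere 2) V" "homeomorphic_map (subtopology (nsphere 2) U0) (subtopology (nsphere 2) V) g"
  shows "\<exists>e. e \<noteq> 0 \<and> Brouwer_degree2 2 g = int m * e"
proof -
  let ?X = "nsphere 2"
  let ?y = "g x0"
  let ?H = "homology_group 2 ?X"
  define R where "R y = relative_homology_group 2 ?X (S2 - {y})" for y
  define J where "J y = hom_induced 2 ?X {} ?X (S2 - {y}) id" for y
  have opU0: "openin ?X U0"
    using U0[OF m] by (simp add: \<rho>0)
  have U0S: "U0 \<subseteq> S2" using opU0 openin_subset by blast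
  have x0S: "x0 \<in> S2" using x0 U0S by blast
  have gS: "g x \<in> S2" if "x \<in> S2" for x using g that by (simp add: continuous_map_def Pi_iff)
  have \<rho>S: "\<rho> k x \<in> S2" if "k < m" "x \<in> S2" for k x
    using homotopic_with_imp_continuous_maps[OF \<rho>(1)[OF that(1)]] that(2)
    by (simp add: continuous_map_def Pi_iff)
  have inj_g: "inj_on g U0"
    using homeomorphic_imp_injective_map[OF V(2)] U0S by (simp add: Int_absorb1)
  have redH: "reduced_homology_group 2 ?X = ?H"
    by (rule un_reduced_homology_group) simp
  \<comment> \<open>The complement of y is contractible, so passing to the local homology at y loses
    nothing.\<close>
  have Jiso: "J y \<in> iso ?H (R y)" if "y \<in> S2" for y
  proof -
    have "S2 \<inter> (S2 - {y}) \<noteq> {}"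
    proof -
      have "(\<lambda>i. if i = 0 then 1 else 0) \<in> S2" "(\<lambda>i. if i = 1 then 1 else 0) \<in> S2"
        by (auto simp: S2_iff)
      moreover have "(\<lambda>i::nat. if i = 0 then 1 else 0 :: real) \<noteq> (\<lambda>i. if i = 1 then 1 else 0)"
        by (metis zero_neq_one)
      ultimately show ?thesis by (metis DiffI Int_iff empty_iff singletonD)
    qed
    then show ?thesis
      using iso_reduced_homology_by_contractible[OF contractible_punctured_S2[OF that], of 2]
      unfolding J_def R_def redH[symmetric] by simp
  qed
  define EU where "EU k = hom_induced 2 (subtopology ?X (\<rho> k ` U0)) (\<rho> k ` U0 - {\<rho> k x0}) ?X (S2 - {\<rho> k x0}) id" for k
  have EUiso: "EU k \<in> iso (relative_homology_group 2 (subtopology ?X (\<rho> k ` U0)) (\<rho> k ` U0 - {\<rho> k x0})) (R (\<rho> k x0))"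
    if "k < m" for k
    unfolding EU_def R_def using iso_excision_open[OF t1_nsphere2 U0[OF that], of "\<rho> k x0" 2] x0 by blast
  have yV: "?y \<in> V" and gU0: "g ` U0 = V"
    using V x0 homeomorphic_imp_surjective_map[OF V(2)] U0S openin_subset[OF V(1)]
    by (auto simp: Int_absorb1)
  define EV where "EV = hom_induced 2 (subtopology ?X V) (V - {?y}) ?X (S2 - {?y}) id"
  have EViso: "EV \<in> iso (relative_homology_group 2 (subtopology ?X V) (V - {?y})) (R ?y)"
    unfolding EV_def R_def using iso_excision_open[OF t1_nsphere2 V(1) yV, of 2] by blast
  define \<gamma> where "\<gamma> = hom_induced 2 (subtopology ?X U0) (U0 - {x0}) (subtopology ?X V) (V - {?y}) g"
  have \<gamma>iso: "\<gamma> \<in> iso (relative_homology_group 2 (subtopology ?X U0) (U0 - {x0})) (relative_homology_group 2 (subtopology ?X V) (V - {?y}))"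
    unfolding \<gamma>_def
  proof (rule homeomorphic_map_relative_homology_iso[OF V(2)])
    show "U0 - {x0} \<subseteq> topspace (subtopology ?X U0)" using U0S by auto
    show "g ` (U0 - {x0}) = V - {?y}"
      using inj_on_image_set_diff[OF inj_g, of U0 "{x0}"] gU0 x0 by simp
  qed
  have EU0: "EU 0 \<in> iso (relative_homology_group 2 (subtopology ?X U0) (U0 - {x0})) (R x0)"
    using EUiso[OF m] by (simp add: \<rho>0)
  \<comment> \<open>Here z is the part of the class w at x0. Each of the m points of the fibre
    contributes the image of z to the push-forward of w.\<close>
  have claim: "\<exists>z \<in> carrier (relative_homology_group 2 (subtopology ?X U0) (U0 - {x0})).
     EU 0 z = J x0 w \<and> J ?y (hom_induced 2 ?X {} ?X {} g w) = EV (\<gamma> z) [^]\<^bsub>R ?y\<^esub> m"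
    if w: "w \<in> carrier ?H" for w
  proof -
    obtain c where c: "singular_relcycle 2 ?X {} c" "w = homologous_rel_set 2 ?X {} c"
      using w carrier_relative_homology_group[of 2 ?X "{}"] by auto
    have op: "openin ?X (S2 - (\<lambda>k. \<rho> k x0) ` {..<m})"
    proof -
      have "(\<lambda>k. \<rho> k x0) ` {..<m} \<subseteq> S2" using \<rho>S x0S by auto
      then have "closedin ?X ((\<lambda>k. \<rho> k x0) ` {..<m})"
        using iffD1[OF t1_space_closedin_finite t1_nsphere2] by simp
      then show ?thesis by (simp add: openin_diff)
    qed
    obtain c' where c': "\<And>k. k < m \<Longrightarrow> singular_relcycle 2 (subtopology ?X (\<rho> k ` U0)) (\<rho> k ` U0 - {\<rho> k x0}) (c' k)"
       and hc': "homologous_rel 2 ?X (S2 - (\<lambda>k. \<rho> k x0) ` {..<m}) c (\<Sum>k<m. c' k)"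
      using cycle_split_at_points[OF c(1) finite_lessThan[of m], of "\<lambda>k. \<rho> k ` U0" "\<lambda>k. \<rho> k x0" thesis]
        disj op x0 U0 by auto
    have cch: "singular_chain 2 ?X c" using c(1) by (simp add: singular_relcycle)
    have UkS: "\<rho> k ` U0 \<subseteq> S2" if "k < m" for k using U0[OF that] openin_subset by blast
    have cU: "singular_chain 2 (subtopology ?X (\<rho> k ` U0)) (c' k)"
      "singular_chain 1 (subtopology ?X (\<rho> k ` U0 - {\<rho> k x0})) (chain_boundary 2 (c' k))" if "k < m" for k
    proof -
      have "\<rho> k ` U0 \<inter> (\<rho> k ` U0 - {\<rho> k x0}) = \<rho> k ` U0 - {\<rho> k x0}" by blast
      then show "singular_chain 2 (subtopology ?X (\<rho> k ` U0)) (c' k)"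
        "singular_chain 1 (subtopology ?X (\<rho> k ` U0 - {\<rho> k x0})) (chain_boundary 2 (c' k))"
        using c'[OF that] by (simp_all add: singular_relcycle subtopology_subtopology)
    qed
    have c'X: "singular_relcycle 2 ?X (S2 - {\<rho> k x0}) (c' k)" if "k < m" for k
    proof -
      have "\<rho> k ` U0 - {\<rho> k x0} \<subseteq> S2 - {\<rho> k x0}" using UkS[OF that] by blast
      then have "singular_chain 1 (subtopology ?X (S2 - {\<rho> k x0})) (chain_boundary 2 (c' k))"
        using cU(2)[OF that] singular_chain_mono by blast
      moreover have "singular_chain 2 ?X (c' k)" using cU(1)[OF that] by (simp add: singular_chain_subtopology)
      ultimately show ?thesis by (simp add: singular_relcycle)
    qed
    have loc: "homologous_rel 2 ?X (S2 - {\<rho> k x0}) c (c' k)" if k: "k < m" for k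
    proof -
      have "singular_chain 2 (subtopology ?X (S2 - {\<rho> k x0})) (c' j)" if j: "j \<in> {..<m} - {k}" for j
      proof -
        have "\<rho> j ` U0 \<inter> \<rho> k ` U0 = {}" using disj j k unfolding disjoint_family_on_def by blast
        then have "\<rho> j ` U0 \<subseteq> S2 - {\<rho> k x0}" using UkS[of j] j x0 by blast
        then show ?thesis using cU(1)[of j] j singular_chain_mono by blast
      qed
      then have e: "singular_chain 2 (subtopology ?X (S2 - {\<rho> k x0})) (\<Sum>j\<in>{..<m} - {k}. c' j)"
        by (rule singular_chain_sum)
      have "(\<Sum>k<m. c' k) = c' k + (\<Sum>j\<in>{..<m} - {k}. c' j)"
        using k by (simp add: sum.remove)
      then have "homologous_rel 2 ?X (S2 - {\<rho> k x0}) (\<Sum>k<m. c' k) (c' k)"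
        using homologous_rel_sum_zero_outside[OF e, of "c' k"] by simp
      moreover have "homologous_rel 2 ?X (S2 - {\<rho> k x0}) c (\<Sum>k<m. c' k)"
        by (rule homologous_rel_mono[OF hc']) (use k in auto)
      ultimately show ?thesis using homologous_rel_trans by blast
    qed
    \<comment> \<open>Both \<open>chain_map 2 (\<rho> k) (c' 0)\<close> and \<open>c' k\<close>
      represent c locally at the k-th point, because \<rho> k is homotopic to the identity. Excision
      transfers this from the sphere to the k-th neighbourhood, where g takes the value
      \<open>?y\<close> only at the centre, so that g may be applied.\<close>
    have same: "homologous_rel 2 ?X (S2 - {?y}) (chain_map 2 g (c' k)) (chain_map 2 g (c' 0))" if k: "k < m" for k
    proof -
      let ?U = "\<rho> k ` U0" and ?x = "\<rho> k x0"
      have \<rho>c: "continuous_map ?X ?X (\<rho> k)"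
        using \<rho>(1)[OF k] homotopic_with_imp_continuous_maps by blast
      have \<rho>x: "\<rho> k \<in> S2 - {x0} \<rightarrow> S2 - {?x}"
        using \<rho>(2)[OF k] \<rho>S[OF k] x0S by (auto simp: inj_on_def)
      have "homologous_rel 2 ?X {} (chain_map 2 (\<rho> k) c) (chain_map 2 id c)"
        by (rule homotopic_imp_homologous_rel_chain_maps[OF _ c(1)]) (use \<rho>(1)[OF k] in simp)
      then have "homologous_rel 2 ?X {} (chain_map 2 (\<rho> k) c) c"
        using chain_map_ident[OF cch] by simp
      then have h1: "homologous_rel 2 ?X (S2 - {?x}) (chain_map 2 (\<rho> k) c) c"
        by (rule homologous_rel_mono) simp
      have "homologous_rel 2 ?X (S2 - {?x}) (chain_map 2 (\<rho> k) c) (chain_map 2 (\<rho> k) (c' 0))"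
        using homologous_rel_chain_map[OF loc[OF m] \<rho>c, of "S2 - {?x}"] \<rho>x by (simp add: \<rho>0)
      then have h2: "homologous_rel 2 ?X (S2 - {?x}) (chain_map 2 (\<rho> k) (c' 0)) (c' k)"
        using h1 loc[OF k] by (meson homologous_rel_sym homologous_rel_trans)
      have cm: "continuous_map (subtopology ?X U0) (subtopology ?X ?U) (\<rho> k)"
        using \<rho>c by (auto simp: continuous_map_in_subtopology continuous_map_from_subtopology)
      have r0: "singular_relcycle 2 (subtopology ?X U0) (U0 - {x0}) (c' 0)"
        using c'[OF m] by (simp add: \<rho>0)
      have \<rho>x': "\<rho> k \<in> U0 - {x0} \<rightarrow> ?U - {?x}" using \<rho>x U0S by (auto simp: Pi_iff)
      have r1: "singular_relcycle 2 (subtopology ?X ?U) (?U - {?x}) (chain_map 2 (\<rho> k) (c' 0))"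
        by (rule singular_relcycle_chain_map[OF r0 cm \<rho>x'])
      let ?A = "homologous_rel_set 2 (subtopology ?X ?U) (?U - {?x})"
      have idc: "continuous_map (subtopology ?X ?U) ?X id" "id \<in> ?U - {?x} \<rightarrow> S2 - {?x}"
        using UkS[OF k] by (auto simp: continuous_map_from_subtopology)
      have E: "EU k (?A a) = homologous_rel_set 2 ?X (S2 - {?x}) a"
        if a: "singular_relcycle 2 (subtopology ?X ?U) (?U - {?x}) a" for a
      proof -
        have "chain_map 2 id a = a" using a chain_map_ident by (auto simp: singular_relcycle)
        then show ?thesis
          unfolding EU_def using hom_induced_chain_map[OF idc a] by simp
      qed
      have "EU k (?A (chain_map 2 (\<rho> k) (c' 0))) = EU k (?A (c' k))"
        using E[OF r1] E[OF c'[OF k]] h2 homologous_rel_set_eq by metis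
      moreover have "inj_on (EU k) (carrier (relative_homology_group 2 (subtopology ?X ?U) (?U - {?x})))"
        using EUiso[OF k] by (simp add: iso_def bij_betw_def)
      moreover have "?A a \<in> carrier (relative_homology_group 2 (subtopology ?X ?U) (?U - {?x}))"
        if "singular_relcycle 2 (subtopology ?X ?U) (?U - {?x}) a" for a
        using that carrier_relative_homology_group[of 2 "subtopology ?X ?U" "?U - {?x}"] by auto
      ultimately have "?A (chain_map 2 (\<rho> k) (c' 0)) = ?A (c' k)"
        using r1 c'[OF k] by (meson inj_onD)
      then have h3: "homologous_rel 2 (subtopology ?X ?U) (?U - {?x}) (chain_map 2 (\<rho> k) (c' 0)) (c' k)"
        by (simp add: homologous_rel_set_eq)
      have "g \<in> ?U - {?x} \<rightarrow> S2 - {?y}"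
      proof
        fix v assume "v \<in> ?U - {?x}"
        then obtain u where u: "u \<in> U0" "v = \<rho> k u" "u \<noteq> x0" by blast
        then have "g v = g u" using \<rho>(3)[OF k] U0S by blast
        moreover have "g u \<noteq> ?y" using inj_g u x0 by (auto dest: inj_onD)
        ultimately show "g v \<in> S2 - {?y}" using gS u U0S by auto
      qed
      then have h4: "homologous_rel 2 ?X (S2 - {?y}) (chain_map 2 g (chain_map 2 (\<rho> k) (c' 0))) (chain_map 2 g (c' k))"
        using homologous_rel_chain_map[OF h3, of ?X g "S2 - {?y}"] g by (simp add: continuous_map_from_subtopology)
      have "singular_chain 2 ?X (c' 0)" using cU(1)[OF m] by (simp add: singular_chain_subtopology)
      then have "chain_map 2 (g \<circ> \<rho> k) (c' 0) = chain_map 2 g (c' 0)"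
        by (rule chain_map_eq) (use \<rho>(3)[OF k] in auto)
      then show ?thesis using h4 by (simp add: chain_map_compose homologous_rel_sym)
    qed
    let ?z = "homologous_rel_set 2 (subtopology ?X U0) (U0 - {x0}) (c' 0)"
    have r0: "singular_relcycle 2 (subtopology ?X U0) (U0 - {x0}) (c' 0)"
      using c'[OF m] by (simp add: \<rho>0)
    have z: "?z \<in> carrier (relative_homology_group 2 (subtopology ?X U0) (U0 - {x0}))"
      using r0 carrier_relative_homology_group[of 2 "subtopology ?X U0" "U0 - {x0}"] by auto
    have c0ch: "singular_chain 2 ?X (c' 0)" using cU(1)[OF m] by (simp add: singular_chain_subtopology)
    have "EU 0 ?z = homologous_rel_set 2 ?X (S2 - {x0}) (c' 0)"
    proof -
      have "continuous_map (subtopology ?X U0) ?X id" "id \<in> U0 - {x0} \<rightarrow> S2 - {x0}"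
        using U0S by (auto simp: continuous_map_from_subtopology)
      from hom_induced_chain_map[OF this r0] show ?thesis
        unfolding EU_def using chain_map_ident[OF c0ch] by (simp add: \<rho>0)
    qed
    also have "\<dots> = homologous_rel_set 2 ?X (S2 - {x0}) c"
      using loc[OF m] homologous_rel_set_eq[of 2 ?X "S2 - {x0}" c "c' 0"] by (simp add: \<rho>0)
    also have "\<dots> = J x0 w"
    proof -
      have "continuous_map ?X ?X id" "id \<in> {} \<rightarrow> S2 - {x0}" by auto
      from hom_induced_chain_map[OF this c(1)] show ?thesis
        unfolding J_def c(2) using chain_map_ident[OF cch] by simp
    qed
    finally have z1: "EU 0 ?z = J x0 w" .
    have "\<gamma> ?z = homologous_rel_set 2 (subtopology ?X V) (V - {?y}) (chain_map 2 g (c' 0))"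
    proof -
      have 1: "continuous_map (subtopology ?X U0) (subtopology ?X V) g"
        using V(2) homeomorphic_imp_continuous_map by blast
      have 2: "g \<in> U0 - {x0} \<rightarrow> V - {?y}" using gU0 inj_g x0 by (auto dest: inj_onD)
      show ?thesis using hom_induced_chain_map[OF 1 2 r0] unfolding \<gamma>_def by simp
    qed
    moreover have rg: "singular_relcycle 2 (subtopology ?X V) (V - {?y}) (chain_map 2 g (c' 0))"
    proof (rule singular_relcycle_chain_map[OF r0])
      show "continuous_map (subtopology ?X U0) (subtopology ?X V) g"
        using V(2) homeomorphic_imp_continuous_map by blast
      show "g \<in> U0 - {x0} \<rightarrow> V - {?y}" using gU0 inj_g x0 by (auto dest: inj_onD)
    qed
    ultimately have z2: "EV (\<gamma> ?z) = homologous_rel_set 2 ?X (S2 - {?y}) (chain_map 2 g (c' 0))"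
    proof -
      assume *: "\<gamma> ?z = homologous_rel_set 2 (subtopology ?X V) (V - {?y}) (chain_map 2 g (c' 0))"
      have VS: "V \<subseteq> S2" using V(1) openin_subset by blast
      have "continuous_map (subtopology ?X V) ?X id" "id \<in> V - {?y} \<rightarrow> S2 - {?y}"
        using VS by (auto simp: continuous_map_from_subtopology)
      from hom_induced_chain_map[OF this rg] show ?thesis
        using singular_chain_chain_map[OF c0ch g] unfolding EV_def * by (simp add: chain_map_ident)
    qed
    have rgX: "singular_relcycle 2 ?X (S2 - {?y}) (chain_map 2 g (c' 0))"
    proof -
      have "V \<subseteq> S2" using V(1) openin_subset by blast
      then have "continuous_map (subtopology ?X V) ?X id" "id \<in> V - {?y} \<rightarrow> S2 - {?y}"
        by (auto simp: continuous_map_from_subtopology)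
      from singular_relcycle_chain_map[OF rg this] show ?thesis
        using chain_map_ident[OF singular_chain_chain_map[OF c0ch g]] by simp
    qed
    have rc: "singular_relcycle 2 ?X {} (chain_map 2 g c)"
      by (rule singular_relcycle_chain_map[OF c(1) g]) simp
    have "J ?y (hom_induced 2 ?X {} ?X {} g w) = homologous_rel_set 2 ?X (S2 - {?y}) (chain_map 2 g c)"
    proof -
      have 1: "hom_induced 2 ?X {} ?X {} g w = homologous_rel_set 2 ?X {} (chain_map 2 g c)"
        using hom_induced_chain_map[OF g _ c(1), of "{}"] c(2) by simp
      have "continuous_map ?X ?X id" "id \<in> {} \<rightarrow> S2 - {?y}" by auto
      from hom_induced_chain_map[OF this rc] show ?thesis
        unfolding J_def 1 using chain_map_ident[OF singular_chain_chain_map[OF cch g]] by simp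
    qed
    also have "\<dots> = homologous_rel_set 2 ?X (S2 - {?y}) (\<Sum>k<m. chain_map 2 g (c' 0))"
    proof -
      have "g \<in> S2 - (\<lambda>k. \<rho> k x0) ` {..<m} \<rightarrow> S2 - {?y}"
        using fib gS by (auto simp: image_iff)
      then have "homologous_rel 2 ?X (S2 - {?y}) (chain_map 2 g c) (chain_map 2 g (\<Sum>k<m. c' k))"
        by (rule homologous_rel_chain_map[OF hc' g])
      then have 1: "homologous_rel 2 ?X (S2 - {?y}) (chain_map 2 g c) (\<Sum>k<m. chain_map 2 g (c' k))"
        by (simp add: chain_map_sum o_def)
      have 2: "homologous_rel 2 ?X (S2 - {?y}) (\<Sum>k<m. chain_map 2 g (c' k)) (\<Sum>k<m. chain_map 2 g (c' 0))"
        by (rule homologous_rel_sum) (use same in auto)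
      have "homologous_rel 2 ?X (S2 - {?y}) (chain_map 2 g c) (\<Sum>k<m. chain_map 2 g (c' 0))"
        by (rule homologous_rel_trans[OF 2 1])
      then show ?thesis by (simp add: homologous_rel_set_eq)
    qed
    also have "\<dots> = EV (\<gamma> ?z) [^]\<^bsub>R ?y\<^esub> m"
      using homologous_rel_set_sum_const[OF rgX, of m] unfolding z2 R_def by simp
    finally show ?thesis using z z1 by blast
  qed
  interpret H: group ?H by simp
  interpret Ry: group "R ?y" unfolding R_def by simp
  interpret Jh: group_hom ?H "R ?y" "J ?y"
    using Jiso[OF gS[OF x0S]] by (simp add: group_hom_def group_hom_axioms_def iso_def)
  obtain a where a: "a \<in> carrier ?H" and aeq: "subgroup_generated ?H {a} = ?H"
    using cyclic_reduced_homology_group_nsphere[of 2 2] by (auto simp: cyclic_group_def redH)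
  have a1: "a \<noteq> \<one>\<^bsub>?H\<^esub>"
  proof
    assume "a = \<one>\<^bsub>?H\<^esub>"
    then have "trivial_group ?H"
      using aeq H.trivial_group_subgroup_generated[of "{a}"] by simp
    then show False using trivial_reduced_homology_group_nsphere[of 2 2] redH by simp
  qed
  obtain z where z: "z \<in> carrier (relative_homology_group 2 (subtopology ?X U0) (U0 - {x0}))"
    and z1: "EU 0 z = J x0 a" and z2: "J ?y (hom_induced 2 ?X {} ?X {} g a) = EV (\<gamma> z) [^]\<^bsub>R ?y\<^esub> m"
    using claim[OF a] by blast
  have \<gamma>z: "\<gamma> z \<in> carrier (relative_homology_group 2 (subtopology ?X V) (V - {?y}))"
    using \<gamma>iso z by (auto simp: iso_def hom_def)
  have "EV (\<gamma> z) \<in> carrier (R ?y)" using EViso \<gamma>z by (auto simp: iso_def hom_def)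
  moreover have "J ?y ` carrier ?H = carrier (R ?y)"
    using Jiso[OF gS[OF x0S]] by (simp add: iso_def bij_betw_def)
  ultimately obtain b where b: "b \<in> carrier ?H" "J ?y b = EV (\<gamma> z)" by (metis imageE)
  obtain e :: int where e: "b = a [^]\<^bsub>?H\<^esub> e"
    using b(1) H.carrier_subgroup_generated_by_singleton[OF a] unfolding aeq by blast
  have "J ?y (hom_induced 2 ?X {} ?X {} g a) = J ?y (b [^]\<^bsub>?H\<^esub> m)"
    using z2 b Jh.hom_nat_pow by simp
  moreover have "hom_induced 2 ?X {} ?X {} g a \<in> carrier ?H" by (rule hom_induced_carrier)
  moreover have "inj_on (J ?y) (carrier ?H)" using Jiso[OF gS[OF x0S]] by (simp add: iso_def bij_betw_def)
  ultimately have "hom_induced 2 ?X {} ?X {} g a = b [^]\<^bsub>?H\<^esub> m"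
    using b(1) H.nat_pow_closed by (meson inj_onD)
  also have "\<dots> = a [^]\<^bsub>?H\<^esub> (int m * e)"
    using H.int_pow_pow[OF a, of e "int m"] unfolding e int_pow_int[symmetric] by (simp add: mult.commute)
  finally have "Brouwer_degree2 2 g = int m * e"
    using Brouwer_degree2_iff[OF g, of a "int m * e"] a a1 redH by simp
  \<comment> \<open>Otherwise the local class z would be trivial and, through the chain of
    isomorphisms, so would the generator a.\<close>
  moreover have "e \<noteq> 0"
  proof
    assume "e = 0"
    then have "EV (\<gamma> z) = \<one>\<^bsub>R ?y\<^esub>" using b e by simp
    then have "\<gamma> z = \<one>\<^bsub>relative_homology_group 2 (subtopology ?X V) (V - {?y})\<^esub>"
      using iso_eq_one_iff[OF EViso _ _ \<gamma>z] unfolding R_def by simp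
    then have "z = \<one>\<^bsub>relative_homology_group 2 (subtopology ?X U0) (U0 - {x0})\<^esub>"
      using iso_eq_one_iff[OF \<gamma>iso _ _ z] by simp
    then have "J x0 a = \<one>\<^bsub>R x0\<^esub>" using iso_eq_one_iff[OF EU0 _ _ z] z1 unfolding R_def by simp
    then have "a = \<one>\<^bsub>?H\<^esub>" using iso_eq_one_iff[OF Jiso[OF x0S] _ _ a] unfolding R_def by simp
    then show False using a1 by simp
  qed
  ultimately show ?thesis by blast
qed

section \<open>Gaussian integers and square roots of even functions\<close>

definition gint :: "complex set" where
  "gint = {z. Re z \<in> \<int> \<and> Im z \<in> \<int>}"

lemma gint_closed [simp]: "0 \<in> gint" "1 \<in> gint" "\<i> \<in> gint"
  by (auto simp: gint_def)

lemma gint_add: "a \<in> gint \<Longrightarrow> b \<in> gint \<Longrightarrow> a + b \<in> gint"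
  and gint_diff: "a \<in> gint \<Longrightarrow> b \<in> gint \<Longrightarrow> a - b \<in> gint"
  by (auto simp: gint_def)

lemma gint_double: "a \<in> gint \<Longrightarrow> 2 * a \<in> gint"
  by (auto simp: gint_def)

lemma gint_norm_ge_1:
  assumes "z \<in> gint" "z \<noteq> 0"
  shows "1 \<le> norm z"
proof -
  have "1 \<le> \<bar>Re z\<bar> \<or> 1 \<le> \<bar>Im z\<bar>"
    using assms Ints_nonzero_abs_ge1[of "Re z"] Ints_nonzero_abs_ge1[of "Im z"]
    by (auto simp: gint_def complex_eq_iff)
  then show ?thesis
    using abs_Re_le_cmod[of z] abs_Im_le_cmod[of z] by linarith
qed

lemma closed_gint: "closed gint"
proof -
  have "gint = Re -` \<int> \<inter> Im -` \<int>" by (auto simp: gint_def)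
  moreover have "closed (Re -` \<int>)" "closed (Im -` \<int>)"
    by (intro closed_vimage closed_Ints continuous_intros)+
  ultimately show ?thesis by (metis closed_Int)
qed

lemma countable_gint: "countable gint"
proof -
  have "gint \<subseteq> range (\<lambda>(a::int, b::int). Complex (of_int a) (of_int b))"
  proof
    fix z assume "z \<in> gint"
    then obtain a b :: int where "Re z = of_int a" "Im z = of_int b"
      by (auto simp: gint_def elim!: Ints_cases)
    then have "z = Complex (of_int a) (of_int b)" by (simp add: complex_eq_iff)
    then show "z \<in> range (\<lambda>(a::int, b::int). Complex (of_int a) (of_int b))"
      by (auto intro: image_eqI[where x = "(a, b)"])
  qed
  then show ?thesis by (rule countable_subset) simp
qed

lemma open_minus_gint: "open D \<Longrightarrow> open (D - gint)"
  using closed_gint by (simp add: open_Diff)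

lemma connected_minus_gint:
  assumes "open D" "Topological_Spaces.connected D" shows "Topological_Spaces.connected (D - gint)"
  by (rule connected_open_diff_countable) (use assms countable_gint in auto)

lemma open_meets_non_gint:
  assumes "open D" "z \<in> D"
  obtains w where "w \<in> D" "w \<notin> gint"
proof -
  have "\<not> countable D"
    using uncountable_open_interval assms by (metis open_contains_ball uncountable_ball countable_subset dist_self mem_ball)
  then have "\<not> D \<subseteq> gint" using countable_gint countable_subset by blast
  then show ?thesis using that by blast
qed

text \<open>In the coordinate \<open>exp\<close>, F has a logarithm h, and evenness makes h(t + pi
  i) - h(t) a constant K with exp K = 1. Over the full period h changes by 2K, so exp(h/2) is
  periodic and descends to a square root. In other words, the winding number of F about 0 is
  even.\<close>

lemma even_function_sqrt:
  fixes F :: "complex \<Rightarrow> complex"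
  assumes r: "0 < r" and contF: "continuous_on (ball 0 r) F"
    and even: "\<And>z. norm z < r \<Longrightarrow> F (- z) = F z"
    and zero: "\<And>z. norm z < r \<Longrightarrow> F z = 0 \<longleftrightarrow> z = 0"
  obtains s where "continuous_on (ball 0 r) s" "\<And>z. norm z < r \<Longrightarrow> (s z)\<^sup>2 = F z"
proof -
  let ?T = "{t. Re t < ln r}"
  have expT: "norm (exp t) < r" if "t \<in> ?T" for t
    using that r by (simp add: norm_exp_eq_Re) (metis exp_less_cancel_iff exp_ln)
  have opT: "open ?T" by (rule open_halfspace_Re_lt)
  have cvT: "convex ?T" by (rule convex_halfspace_Re_lt)
  have "continuous_on ?T (F \<circ> exp)"
    by (rule continuous_on_compose[OF continuous_on_exp[OF continuous_on_id] continuous_on_subset[OF contF]])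
      (use expT in auto)
  moreover have "(F \<circ> exp) t \<noteq> 0" if "t \<in> ?T" for t
    using zero[OF expT[OF that]] by simp
  ultimately obtain h where h: "continuous_on ?T h" "\<And>t. t \<in> ?T \<Longrightarrow> (F \<circ> exp) t = exp (h t)"
    using continuous_logarithm_on_contractible[OF _ convex_imp_contractible[OF cvT]] by metis
  have shift: "t + pi * \<i> * of_int n \<in> ?T" if "t \<in> ?T" for t n using that by simp
  have ek: "exp (h (t + pi * \<i>) - h t) = 1" if "t \<in> ?T" for t
  proof -
    have "exp (h (t + pi * \<i>)) = exp (h t)"
      using h(2)[OF that] h(2)[OF shift[OF that, of 1]] even[OF expT[OF that]]
      by (simp add: exp_add)
    then show ?thesis by (simp add: exp_diff)
  qed
  have "(\<lambda>t. h (t + pi * \<i>) - h t) constant_on ?T"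
  proof (rule continuous_discrete_range_constant)
    show "Topological_Spaces.connected ?T" using cvT convex_connected by blast
    have "continuous_on ?T (\<lambda>t. h (t + pi * \<i>))"
      by (rule continuous_on_compose2[OF h(1)]) (auto intro!: continuous_intros)
    then show "continuous_on ?T (\<lambda>t. h (t + pi * \<i>) - h t)"
      using h(1) by (intro continuous_intros)
    fix t assume t: "t \<in> ?T"
    show "\<exists>e>0. \<forall>y. y \<in> ?T \<and> h (y + pi * \<i>) - h y \<noteq> h (t + pi * \<i>) - h t \<longrightarrow>
        e \<le> norm (h (y + pi * \<i>) - h y - (h (t + pi * \<i>) - h t))"
    proof (intro exI[of _ 1] conjI allI impI)
      fix y assume y: "y \<in> ?T \<and> h (y + pi * \<i>) - h y \<noteq> h (t + pi * \<i>) - h t"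
      \<comment> \<open>Two values of the difference differ by a multiple of 2 pi i, so distinct
        values are at least 1 apart.\<close>
      have "exp (h (y + pi * \<i>) - h y) = exp (h (t + pi * \<i>) - h t)"
        using ek y t by simp
      then obtain n :: int where n: "h (y + pi * \<i>) - h y = h (t + pi * \<i>) - h t + (of_int (2 * n) * pi) * \<i>"
        using exp_eq by blast
      then have "n \<noteq> 0" using y by auto
      then have "1 \<le> \<bar>real_of_int n\<bar>" by linarith
      moreover have "norm (h (y + pi * \<i>) - h y - (h (t + pi * \<i>) - h t)) = 2 * \<bar>real_of_int n\<bar> * pi"
        unfolding n by (simp add: norm_mult)
      ultimately show "1 \<le> norm (h (y + pi * \<i>) - h y - (h (t + pi * \<i>) - h t))"
        using pi_gt3 mult_mono[of 1 "\<bar>real_of_int n\<bar>" 1 pi] by simp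
    qed simp
  qed
  then obtain K where K: "\<And>t. t \<in> ?T \<Longrightarrow> h (t + pi * \<i>) - h t = K"
    by (auto simp: constant_on_def)
  have "exp K = 1" using K[of "of_real (ln r - 1)"] ek[of "of_real (ln r - 1)"] by simp
  have per: "exp (h (t + 2 * pi * \<i>) / 2) = exp (h t / 2)" if "t \<in> ?T" for t
  proof -
    have "h (t + 2 * pi * \<i>) = h (t + pi * \<i>) + K"
      using K[of "t + pi * \<i>"] that by (simp add: algebra_simps)
    also have "\<dots> = h t + 2 * K" using K[OF that] by (simp add: algebra_simps)
    finally have "exp (h (t + 2 * pi * \<i>) / 2) = exp (h t / 2 + K)" by (simp add: add_divide_distrib)
    then show ?thesis using \<open>exp K = 1\<close> by (simp add: exp_add)
  qed
  have per': "exp (h (t + of_nat n * (2 * pi * \<i>)) / 2) = exp (h t / 2)" if "t \<in> ?T" for t and n :: nat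
  proof (induction n)
    case (Suc n)
    then show ?case using per[of "t + of_nat n * (2 * pi * \<i>)"] that by (simp add: algebra_simps)
  qed simp
  have perZ: "exp (h (t + of_int n * (2 * pi * \<i>)) / 2) = exp (h t / 2)" if "t \<in> ?T" for t and n :: int
  proof (cases n)
    case (nonneg k) then show ?thesis using per'[OF that, of k] by simp
  next
    case (neg k)
    have "t + of_int n * (2 * pi * \<i>) \<in> ?T" using that by simp
    from per'[OF this, of "Suc k"] show ?thesis unfolding neg by (simp add: algebra_simps)
  qed
  define s where "s z = (if z = 0 then 0 else exp (h (Ln z) / 2))" for z
  have s_exp: "s (exp t) = exp (h t / 2)" if "t \<in> ?T" for t
  proof -
    have "exp t = exp (Ln (exp t))" by simp
    then obtain n :: int where n: "t = Ln (exp t) + (of_int (2 * n) * pi) * \<i>"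
      using exp_eq by blast
    have "Ln (exp t) \<in> ?T" using that expT[OF that] r by (simp add: Re_Ln)
    from perZ[OF this, of n] have "exp (h t / 2) = exp (h (Ln (exp t)) / 2)"
      by (subst n) (simp add: algebra_simps)
    then show ?thesis by (simp add: s_def)
  qed
  have sq: "(s z)\<^sup>2 = F z" if "norm z < r" for z
  proof (cases "z = 0")
    case True then show ?thesis using zero r by (simp add: s_def)
  next
    case False
    have t: "Ln z \<in> ?T" using that False by (simp add: Re_Ln r)
    have "(s z)\<^sup>2 = exp (h (Ln z))" using False by (simp add: s_def flip: exp_double)
    also have "\<dots> = F z" using h(2)[OF t] False by simp
    finally show ?thesis .
  qed
  have "isCont s z0" if z0: "z0 \<in> ball 0 r" for z0
  proof (cases "z0 = 0")
    case True
    \<comment> \<open>No branch of the logarithm exists at the origin; continuity there comes from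
      the identity norm (s z) = sqrt (norm (F z)).\<close>
    have "isCont F 0" using contF r by (simp add: continuous_on_eq_continuous_at)
    then have "(F \<longlongrightarrow> 0) (at 0)"
      using r zero[of 0] by (simp add: isCont_def)
    then have "((\<lambda>z. sqrt (norm (F z))) \<longlongrightarrow> sqrt 0) (at 0)"
      by (intro tendsto_real_sqrt tendsto_norm_zero)
    moreover have "\<forall>\<^sub>F z in at 0. sqrt (norm (F z)) = norm (s z)"
    proof -
      have "\<forall>\<^sub>F z in at 0. z \<in> ball (0::complex) r"
        using r by (intro eventually_at_in_open') auto
      then show ?thesis
      proof eventually_elim
        case (elim z)
        then have "norm (F z) = (norm (s z))\<^sup>2" using sq[of z] by (simp flip: norm_power)
        then show ?case by simp
      qed
    qed
    ultimately have "((\<lambda>z. norm (s z)) \<longlongrightarrow> sqrt 0) (at 0)"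
      by (rule Lim_transform_eventually)
    then have "((\<lambda>z. norm (s z)) \<longlongrightarrow> 0) (at 0)" by simp
    then have "(s \<longlongrightarrow> 0) (at 0)" by (rule tendsto_norm_zero_cancel)
    moreover have "s 0 = 0" by (simp add: s_def)
    ultimately have "isCont s 0" unfolding isCont_def by (rule ssubst[of "s 0" 0 "\<lambda>y. (s \<longlongrightarrow> y) (at 0)", rotated])
    then show ?thesis using True by simp
  next
    case False
    \<comment> \<open>A branch of the logarithm whose cut avoids z0, even when z0 is a negative real
      number.\<close>
    define t where "t z = Ln (z / z0) + Ln z0" for z
    have et: "exp (t z) = z" if "z \<noteq> 0" for z using that False by (simp add: t_def exp_add)
    have tz0: "t z0 = Ln z0" using False by (simp add: t_def)
    have "Ln z0 \<in> ?T" using z0 False r by (simp add: Re_Ln)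
    then have "isCont h (t z0)" using h(1) opT tz0 by (simp add: continuous_on_eq_continuous_at)
    moreover have "isCont t z0"
      unfolding t_def using False by (intro continuous_intros) (auto simp: complex_nonpos_Reals_iff)
    ultimately have "isCont (\<lambda>z. exp (h (t z) / 2)) z0"
      by (intro continuous_intros) (auto intro: isCont_o2)
    moreover have "\<forall>\<^sub>F z in nhds z0. s z = exp (h (t z) / 2)"
    proof -
      have "open (ball 0 r - {0})" "z0 \<in> ball 0 r - {0}" using z0 False by auto
      then have "\<forall>\<^sub>F z in nhds z0. z \<in> ball 0 r - {0}" by (rule eventually_nhds_in_open)
      then show ?thesis
      proof eventually_elim
        case (elim z)
        have "t z \<in> ?T"
        proof -
          have "exp (Re (t z)) = norm z" using et[of z] elim by (metis Diff_iff norm_exp_eq_Re insertI1)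
          then have "exp (Re (t z)) < exp (ln r)" using elim r by simp
          then show ?thesis by simp
        qed
        then show ?case using s_exp[of "t z"] et[of z] elim by simp
      qed
    qed
    ultimately show ?thesis using isCont_cong by fastforce
  qed
  then have "continuous_on (ball 0 r) s" by (simp add: continuous_on_eq_continuous_at)
  then show ?thesis using sq that by blast
qed

section \<open>Lifting through the pillowcase quotient\<close>

lemma centred_chart_iff:
  "centred_chart U x \<phi> \<longleftrightarrow> openin (top_of_set S2) U \<and> x \<in> U \<and> \<phi> x = 0 \<and> (\<exists>\<phi>'. homeomorphism U (ball 0 1) \<phi> \<phi>')"
proof (cases "openin (top_of_set S2) U")
  case True
  then have "U \<subseteq> S2" using openin_imp_subset by blast
  then have "S2 \<inter> U = U" by blast
  then have "subtopology (nsphere 2) U = top_of_set U"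
    by (metis subtopology_subtopology top_of_set_S2)
  moreover have chart: "homeomorphic_maps (top_of_set U) (top_of_set (ball 0 1)) \<phi> = homeomorphism U (ball 0 1) \<phi>"
    by (rule ext) (rule homeomorphic_maps_iff_homeomorphism)
  ultimately show ?thesis
    unfolding centred_chart_def homeomorphic_map_maps
    using True by (simp add: top_of_set_S2 chart)
next
  case False
  then show ?thesis by (simp add: centred_chart_def top_of_set_S2)
qed

text \<open>Carries the same information as \<open>has_local_degree\<close>, with the inverses of
  both charts as arguments, because lifts are built from the inverse charts.\<close>

definition power_charts ::
  "((nat \<Rightarrow> real) \<Rightarrow> (nat \<Rightarrow> real)) \<Rightarrow> (nat \<Rightarrow> real) \<Rightarrow> nat \<Rightarrow> (nat \<Rightarrow> real) set \<Rightarrow> (nat \<Rightarrow> real) set \<Rightarrow>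
   ((nat \<Rightarrow> real) \<Rightarrow> complex) \<Rightarrow> (complex \<Rightarrow> (nat \<Rightarrow> real)) \<Rightarrow> ((nat \<Rightarrow> real) \<Rightarrow> complex) \<Rightarrow> (complex \<Rightarrow> (nat \<Rightarrow> real)) \<Rightarrow> bool" where
  "power_charts f x d U V \<phi> \<phi>' \<psi> \<psi>' \<longleftrightarrow>
     openin (top_of_set S2) U \<and> openin (top_of_set S2) V \<and> x \<in> U \<and> f x \<in> V \<and> \<phi> x = 0 \<and> \<psi> (f x) = 0 \<and>
     homeomorphism U (ball 0 1) \<phi> \<phi>' \<and> homeomorphism V (ball 0 1) \<psi> \<psi>' \<and>
     (\<forall>u\<in>U. f u \<in> V) \<and> (\<forall>u\<in>U. \<psi> (f u) = \<phi> u ^ d) \<and> 1 \<le> d"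

lemma power_chartsD:
  assumes "power_charts f x d U V \<phi> \<phi>' \<psi> \<psi>'"
  shows "openin (top_of_set S2) U" "openin (top_of_set S2) V" "x \<in> U" "f x \<in> V" "\<phi> x = 0" "\<psi> (f x) = 0"
    "homeomorphism U (ball 0 1) \<phi> \<phi>'" "homeomorphism V (ball 0 1) \<psi> \<psi>'"
    "\<And>u. u \<in> U \<Longrightarrow> f u \<in> V" "\<And>u. u \<in> U \<Longrightarrow> \<psi> (f u) = \<phi> u ^ d" "1 \<le> d"
  using assms by (auto simp: power_charts_def)

lemma has_local_degree_iff:
  "has_local_degree f x d \<longleftrightarrow> (\<exists>U V \<phi> \<phi>' \<psi> \<psi>'. power_charts f x d U V \<phi> \<phi>' \<psi> \<psi>')"
proof
  assume "has_local_degree f x d"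
  then obtain U V \<phi> \<psi> where 1: "centred_chart U x \<phi>" "centred_chart V (f x) \<psi>" "f ` U \<subseteq> V"
    "\<forall>u\<in>U. \<psi> (f u) = \<phi> u ^ d" "1 \<le> d"
    unfolding has_local_degree_def by blast
  obtain \<phi>' where 2: "homeomorphism U (ball 0 1) \<phi> \<phi>'"
    using 1(1) unfolding centred_chart_iff by blast
  obtain \<psi>' where 3: "homeomorphism V (ball 0 1) \<psi> \<psi>'"
    using 1(2) unfolding centred_chart_iff by blast
  have "power_charts f x d U V \<phi> \<phi>' \<psi> \<psi>'"
    unfolding power_charts_def using 1 2 3 by (auto simp: centred_chart_iff)
  then show "\<exists>U V \<phi> \<phi>' \<psi> \<psi>'. power_charts f x d U V \<phi> \<phi>' \<psi> \<psi>'" by blast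
next
  assume "\<exists>U V \<phi> \<phi>' \<psi> \<psi>'. power_charts f x d U V \<phi> \<phi>' \<psi> \<psi>'"
  then obtain U V \<phi> \<phi>' \<psi> \<psi>' where pc: "power_charts f x d U V \<phi> \<phi>' \<psi> \<psi>'" by blast
  note * = power_chartsD[OF pc]
  have "centred_chart U x \<phi>" "centred_chart V (f x) \<psi>"
    unfolding centred_chart_iff using * by blast+
  moreover have "f ` U \<subseteq> V" using *(9) by blast
  ultimately show "has_local_degree f x d"
    unfolding has_local_degree_def using *(10,11) by blast
qed

lemma local_inj_if_degree_1:
  assumes "has_local_degree f x 1"
  obtains U where "openin (top_of_set S2) U" "x \<in> U" "inj_on f U"
proof -
  obtain U V \<phi> \<phi>' \<psi> \<psi>' where pc: "power_charts f x 1 U V \<phi> \<phi>' \<psi> \<psi>'"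
      using assms unfolding has_local_degree_iff by blast
    note * = power_chartsD[OF pc]
  have "inj_on f U"
  proof (rule inj_onI)
    fix a b assume ab: "a \<in> U" "b \<in> U" "f a = f b"
    then have "\<phi> a = \<phi> b" using *(10)[of a] *(10)[of b] by simp
    then show "a = b" using ab homeomorphism_apply1[OF *(7)] by metis
  qed
  then show ?thesis using * that by blast
qed

text \<open>The quotient by the half-turns about the Gaussian integers, kept abstract because these
  properties survive a homeomorphism of the sphere. This allows the corners to be placed at any four
  points.\<close>

locale pillow =
  fixes P :: "complex \<Rightarrow> (nat \<Rightarrow> real)"
  assumes contP: "continuous_on UNIV P"
    and rangeP: "range P = S2"
    and openP: "open D \<Longrightarrow> openin (top_of_set S2) (P ` D)"
    and eqP: "P u = P v \<longleftrightarrow> (\<exists>c\<in>gint. v = u + 2 * c \<or> v = 2 * c - u)"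
begin

lemma P_in [simp]: "P u \<in> S2" using rangeP by blast

lemma P_gint_iff: "P u \<in> P ` gint \<longleftrightarrow> u \<in> gint"
proof
  assume "P u \<in> P ` gint"
  then obtain v where v: "v \<in> gint" "P v = P u" by force
  then obtain c where c: "c \<in> gint" "u = v + 2 * c \<or> u = 2 * c - v" using eqP by blast
  then show "u \<in> gint" using v gint_add gint_diff gint_double by metis
qed simp

lemma P_shift: "c \<in> gint \<Longrightarrow> P (u + 2 * c) = P u"
  using eqP by metis

lemma P_flip: "c \<in> gint \<Longrightarrow> P (2 * c - u) = P u"
  using eqP by metis

text \<open>If the two values agree, then w - z or w + z is twice a Gaussian integer, and the bound
  1/2 makes its norm less than 1. So P folds like a square at c.\<close>

lemma P_eq_near_gint:
  assumes "c \<in> gint" "norm z < 1/2" "norm w < 1/2"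
  shows "P (c + z) = P (c + w) \<longleftrightarrow> w = z \<or> w = - z"
proof
  assume "P (c + z) = P (c + w)"
  then obtain k where k: "k \<in> gint" "c + w = c + z + 2 * k \<or> c + w = 2 * k - (c + z)"
    using eqP by metis
  have small: "norm (w - z) < 1" "norm (w + z) < 1"
    using assms norm_triangle_ineq4[of w z] norm_triangle_ineq[of w z] by linarith+
  have gz: "j = 0" if "j \<in> gint" "norm (2 * j) < 1" for j
    using gint_norm_ge_1[OF that(1)] that(2) by (auto simp: norm_mult)
  from k(2) show "w = z \<or> w = - z"
  proof
    assume "c + w = c + z + 2 * k"
    then have "w - z = 2 * k" by (simp add: algebra_simps)
    then show ?thesis using gz[of k] k small by auto
  next
    assume "c + w = 2 * k - (c + z)"
    then have "w + z = 2 * (k - c)" by (simp add: algebra_simps)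
    then show ?thesis using gz[of "k - c"] k small assms gint_diff by (auto simp: eq_neg_iff_add_eq_0)
  qed
next
  have "P (c + - z) = P (c + z)"
    using P_flip[OF assms(1), of "c + z"] by (simp add: algebra_simps)
  moreover assume "w = z \<or> w = - z"
  ultimately show "P (c + z) = P (c + w)" by auto
qed

text \<open>A translation identifying two such points would move them by less than 1, and a
  half-turn would have its centre within \<delta> of c. The choice of r excludes both.\<close>

lemma P_inj_near_nongint:
  assumes "c \<notin> gint"
  obtains r where "0 < r" "\<And>z w. norm z < r \<Longrightarrow> norm w < r \<Longrightarrow> P (c + z) = P (c + w) \<Longrightarrow> z = w"
    "\<And>z. norm z < r \<Longrightarrow> c + z \<notin> gint"
proof -
  have "open (- gint)" using closed_gint by auto
  then obtain \<delta> where \<delta>: "0 < \<delta>" "ball c \<delta> \<subseteq> - gint"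
    using assms by (meson ComplI openE)
  define r where "r = min \<delta> (1/2)"
  have "z = w" if zw: "norm z < r" "norm w < r" "P (c + z) = P (c + w)" for z w
  proof -
    obtain k where k: "k \<in> gint" "c + w = c + z + 2 * k \<or> c + w = 2 * k - (c + z)"
      using iffD1[OF eqP zw(3)] by blast
    from k(2) show ?thesis
    proof
      assume "c + w = c + z + 2 * k"
      then have wz: "w - z = 2 * k" by (simp add: algebra_simps)
      have "norm (w - z) < 1" using that norm_triangle_ineq4[of w z] by (simp add: r_def)
      then have "k = 0" using gint_norm_ge_1[OF k(1)] unfolding wz by (auto simp: norm_mult)
      then show ?thesis using wz by simp
    next
      assume "c + w = 2 * k - (c + z)"
      then have wz: "w + z = 2 * (k - c)" by (simp add: algebra_simps)
      have "norm (w + z) < 2 * \<delta>" using that norm_triangle_ineq[of w z] by (simp add: r_def)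
      then have "norm (k - c) < \<delta>" unfolding wz norm_mult by simp
      then have "k \<in> ball c \<delta>" by (simp add: dist_norm norm_minus_commute)
      then show ?thesis using \<delta> k by blast
    qed
  qed
  moreover have "c + z \<notin> gint" if "norm z < r" for z
    using \<delta>(2) that by (auto simp: r_def dist_norm subset_iff)
  moreover have "0 < r" using \<delta> by (simp add: r_def)
  ultimately show ?thesis using that by blast
qed

end

text \<open>P looks like a square at the Gaussian integers and is injective near all other points.
  The degree assumptions say that f branches at most as much as P does, which is what lets P factor
  through f.\<close>

locale pillow_lift = pillow +
  fixes f :: "(nat \<Rightarrow> real) \<Rightarrow> (nat \<Rightarrow> real)"
  assumes contf: "continuous_on S2 f" and f_in: "x \<in> S2 \<Longrightarrow> f x \<in> S2"
    and deg12: "x \<in> S2 \<Longrightarrow> has_local_degree f x 1 \<or> has_local_degree f x 2"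
    and deg1: "x \<in> S2 \<Longrightarrow> f x \<notin> P ` gint \<Longrightarrow> has_local_degree f x 1"
begin

definition lift :: "complex set \<Rightarrow> (complex \<Rightarrow> (nat \<Rightarrow> real)) \<Rightarrow> bool" where
  "lift D l \<longleftrightarrow> continuous_on D l \<and> (\<forall>z\<in>D. l z \<in> S2 \<and> f (l z) = P z)"

lemma lift_subset: "lift D l \<Longrightarrow> D' \<subseteq> D \<Longrightarrow> lift D' l"
  unfolding lift_def using continuous_on_subset by blast

lemma lift_cong: "lift D l \<Longrightarrow> (\<And>z. z \<in> D \<Longrightarrow> l z = l' z) \<Longrightarrow> lift D l'"
  unfolding lift_def by (metis continuous_on_cong)

text \<open>Off the Gaussian integers f is injective near a common value, so there the set of
  agreement is open and closed. The base point has to be generic: a lift and its composite with a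
  half-turn agree at the centre.\<close>

lemma lift_unique:
  assumes D: "open D" "Topological_Spaces.connected D" and l: "lift D l" "lift D l'"
    and w: "w \<in> D" "w \<notin> gint" "l w = l' w" and z: "z \<in> D"
  shows "l z = l' z"
proof -
  have cont: "continuous_on D (\<lambda>z. dist (l z) (l' z))"
    using l unfolding lift_def by (intro continuous_on_dist) auto
  let ?E = "{z \<in> D - gint. l z = l' z}"
  have "closedin (top_of_set (D - gint)) ?E"
  proof -
    have "closedin (top_of_set (D - gint)) ((D - gint) \<inter> (\<lambda>z. dist (l z) (l' z)) -` {0})"
      by (rule continuous_closedin_preimage[OF continuous_on_subset[OF cont]]) auto
    moreover have "(D - gint) \<inter> (\<lambda>z. dist (l z) (l' z)) -` {0} = ?E" by auto
    ultimately show ?thesis by simp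
  qed
  moreover have "openin (top_of_set (D - gint)) ?E"
  proof -
    have "open ?E"
    proof (subst open_subopen, intro ballI)
      fix z assume z: "z \<in> ?E"
      then have zz: "z \<in> D" "z \<notin> gint" "l z = l' z" by auto
      then have "l z \<in> S2" "f (l z) = P z" using l by (auto simp: lift_def)
      moreover have "P z \<notin> P ` gint" using P_gint_iff zz by simp
      ultimately obtain U where U: "openin (top_of_set S2) U" "l z \<in> U" "inj_on f U"
        using deg1[of "l z"] local_inj_if_degree_1[of f "l z"] by metis
      obtain W where W: "open W" "U = S2 \<inter> W" using U(1) openin_open by metis
      have "open (D \<inter> l -` W)" "open (D \<inter> l' -` W)"
        using l D W continuous_open_preimage unfolding lift_def by blast+
      then have "open ((D - gint) \<inter> (D \<inter> l -` W) \<inter> (D \<inter> l' -` W))"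
        using open_minus_gint[OF D(1)] by blast
      moreover have "z \<in> (D - gint) \<inter> (D \<inter> l -` W) \<inter> (D \<inter> l' -` W)"
        using zz U W by auto
      moreover have "(D - gint) \<inter> (D \<inter> l -` W) \<inter> (D \<inter> l' -` W) \<subseteq> ?E"
      proof
        fix v assume v: "v \<in> (D - gint) \<inter> (D \<inter> l -` W) \<inter> (D \<inter> l' -` W)"
        then have "l v \<in> U" "l' v \<in> U" "f (l v) = f (l' v)"
          using l W unfolding lift_def by auto
        then have "l v = l' v" using U(3) by (meson inj_onD)
        then show "v \<in> ?E" using v by blast
      qed
      ultimately show "\<exists>T. open T \<and> z \<in> T \<and> T \<subseteq> ?E" by blast
    qed
    then show ?thesis by (rule open_subset[rotated]) blast
  qed
  moreover have "Topological_Spaces.connected (D - gint)" using connected_minus_gint[OF D] .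
  moreover have "?E \<noteq> {}" using w by blast
  ultimately have E: "?E = D - gint" unfolding connected_clopen by metis
  \<comment> \<open>A disagreement at a Gaussian integer would spread to generic points
    nearby.\<close>
  show ?thesis
  proof (rule ccontr)
    assume ne: "l z \<noteq> l' z"
    have "open (D \<inter> (\<lambda>z. dist (l z) (l' z)) -` {0<..})"
      by (rule continuous_open_preimage[OF cont D(1)]) simp
    moreover have "z \<in> D \<inter> (\<lambda>z. dist (l z) (l' z)) -` {0<..}" using z ne by simp
    ultimately obtain v where "v \<in> D \<inter> (\<lambda>z. dist (l z) (l' z)) -` {0<..}" "v \<notin> gint"
      by (rule open_meets_non_gint)
    then show False using E by auto
  qed
qed

text \<open>A chart shows that x is isolated in its fibre, and a closed discrete subset of the
  compact sphere is finite.\<close>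

lemma finite_fibre:
  assumes "y \<in> S2"
  shows "finite {x \<in> S2. f x = y}"
proof -
  let ?F = "{x \<in> S2. f x = y}"
  have "closedin (top_of_set S2) ?F"
    by (rule continuous_closedin_preimage_constant[OF contf])
  then have "compact ?F"
    using closedin_compact compact_S2 by blast
  moreover have "\<exists>e>0. \<forall>x'\<in>?F. dist x x' < e \<longrightarrow> x' = x" if x: "x \<in> ?F" for x
  proof -
    obtain d where "has_local_degree f x d" using deg12[of x] x by blast
    then obtain U V \<phi> \<phi>' \<psi> \<psi>' where pc: "power_charts f x d U V \<phi> \<phi>' \<psi> \<psi>'"
      unfolding has_local_degree_iff by blast
    note * = power_chartsD[OF pc]
    obtain W where W: "open W" "U = S2 \<inter> W" using *(1) openin_open by metis
    then have "x \<in> W" using *(3) by blast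
    then obtain e where e: "e > 0" "ball x e \<subseteq> W" using W(1) by (meson openE)
    have "x' = x" if "x' \<in> ?F" "dist x x' < e" for x'
    proof -
      have "x' \<in> U" using that e W by auto
      moreover have "f x' = f x" using that x by auto
      ultimately have "\<phi> x' ^ d = 0" using *(6) *(10)[of x'] by simp
      then have "\<phi> x' = \<phi> x" using *(5) by simp
      then show ?thesis using homeomorphism_apply1[OF *(7)] *(3) \<open>x' \<in> U\<close> by metis
    qed
    then show ?thesis using e(1) by blast
  qed
  then have "\<not> (\<exists>x\<in>?F. x islimpt ?F)"
    unfolding islimpt_approachable by (simp add: dist_commute) blast
  ultimately show ?thesis
    using compact_eq_Bolzano_Weierstrass by blast
qed


text \<open>The counterpart of an evenly covered disc: every point over the disc lies on a lift
  defined on the whole disc. Over a Gaussian integer there may be several such lifts through one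
  point.\<close>

definition good :: "complex \<Rightarrow> real \<Rightarrow> bool" where
  "good u r \<longleftrightarrow> 0 < r \<and> (\<forall>v\<in>ball u r. \<forall>x\<in>S2. f x = P v \<longrightarrow> (\<exists>l. lift (ball u r) l \<and> l v = x))"

lemma good_subset:
  assumes "good u r" "0 < r'" "ball u' r' \<subseteq> ball u r"
  shows "good u' r'"
  unfolding good_def
proof (intro conjI ballI impI)
  fix v x assume "v \<in> ball u' r'" "x \<in> S2" "f x = P v"
  then obtain l where "lift (ball u r) l" "l v = x"
    using assms unfolding good_def by blast
  then show "\<exists>l. lift (ball u' r') l \<and> l v = x"
    using lift_subset assms(3) by blast
qed (rule assms)

lemma good_shift:
  assumes "good u r" "c \<in> gint"
  shows "good (u + 2 * c) r"
  unfolding good_def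
proof (intro conjI ballI impI)
  show "0 < r" using assms by (simp add: good_def)
  fix v x assume v: "v \<in> ball (u + 2 * c) r" and x: "x \<in> S2" "f x = P v"
  have "v - 2 * c \<in> ball u r" using v by (simp add: dist_norm algebra_simps)
  moreover have "P (v - 2 * c) = P v" using P_shift[OF assms(2), of "v - 2 * c"] by simp
  ultimately obtain l where l: "lift (ball u r) l" "l (v - 2 * c) = x"
    using assms x unfolding good_def by metis
  have "lift (ball (u + 2 * c) r) (\<lambda>z. l (z - 2 * c))"
    unfolding lift_def
  proof (intro conjI ballI)
    have sub: "(\<lambda>z. z - 2 * c) ` ball (u + 2 * c) r \<subseteq> ball u r"
      by (auto simp: dist_norm algebra_simps)
    show "continuous_on (ball (u + 2 * c) r) (\<lambda>z. l (z - 2 * c))"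
      by (rule continuous_on_compose2[of "ball u r" l]) (use l sub in \<open>auto simp: lift_def intro!: continuous_intros\<close>)
    fix z assume "z \<in> ball (u + 2 * c) r"
    then have "z - 2 * c \<in> ball u r" by (simp add: dist_norm algebra_simps)
    then have "l (z - 2 * c) \<in> S2 \<and> f (l (z - 2 * c)) = P (z - 2 * c)" using l by (auto simp: lift_def)
    then show "l (z - 2 * c) \<in> S2" "f (l (z - 2 * c)) = P z"
      using P_shift[OF assms(2), of "z - 2 * c"] by simp_all
  qed
  then show "\<exists>l. lift (ball (u + 2 * c) r) l \<and> l v = x" using l(2) by blast
qed

text \<open>Since f is a d-th power in the charts, lifting P amounts to choosing a continuous d-th
  root of its coordinate expression.\<close>

lemma lift_in_chart:
  fixes \<phi> :: "(nat \<Rightarrow> real) \<Rightarrow> complex"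
  assumes h: "homeomorphism U (ball 0 1) \<phi> \<phi>'" "homeomorphism V (ball 0 1) \<psi> \<psi>'" "U \<subseteq> S2"
    and fU: "\<And>u. u \<in> U \<Longrightarrow> f u \<in> V" "\<And>u. u \<in> U \<Longrightarrow> \<psi> (f u) = \<phi> u ^ d"
    and D: "\<And>z. z \<in> D \<Longrightarrow> P z \<in> V" and s: "continuous_on D s" "\<And>z. z \<in> D \<Longrightarrow> s z ^ d = \<psi> (P z)" "1 \<le> d"
  shows "lift D (\<lambda>z. \<phi>' (s z))" "z \<in> D \<Longrightarrow> \<phi> (\<phi>' (s z)) = s z \<and> \<phi>' (s z) \<in> U"
proof -
  have sb: "s z \<in> ball 0 1" if "z \<in> D" for z
  proof -
    have "\<psi> (P z) \<in> ball 0 1" using D[OF that] h(2) homeomorphism_image1 by blast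
    then have "norm (s z) ^ d < 1" using s(2)[OF that] by (simp add: norm_power[symmetric])
    then show ?thesis using s(3) by (simp add: power_less_one_iff)
  qed
  have in_U: "\<phi>' (s z) \<in> U" if "z \<in> D" for z using sb[OF that] h(1) homeomorphism_image2 by blast
  have inv: "\<phi> (\<phi>' (s z)) = s z" if "z \<in> D" for z using sb[OF that] h(1) homeomorphism_apply2 by metis
  then show "z \<in> D \<Longrightarrow> \<phi> (\<phi>' (s z)) = s z \<and> \<phi>' (s z) \<in> U" using in_U by blast
  show "lift D (\<lambda>z. \<phi>' (s z))"
    unfolding lift_def
  proof (intro conjI ballI)
    show "continuous_on D (\<lambda>z. \<phi>' (s z))"
      by (rule continuous_on_compose2[OF homeomorphism_cont2[OF h(1)] s(1)]) (use sb in blast)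
    fix z assume z: "z \<in> D"
    show "\<phi>' (s z) \<in> S2" using in_U[OF z] h(3) by blast
    have "\<psi> (f (\<phi>' (s z))) = \<psi> (P z)" using fU(2)[OF in_U[OF z]] inv[OF z] s(2)[OF z] by simp
    then show "f (\<phi>' (s z)) = P z"
      using fU(1)[OF in_U[OF z]] D[OF z] h(2) homeomorphism_apply1 by metis
  qed
qed

text \<open>At a Gaussian integer the coordinate expression of P in a chart is an even function, hence
  a square, so P lifts through the double points of f lying above.\<close>

lemma good_near_fibre_point:
  assumes x: "x \<in> S2" "f x = P u"
  obtains W r where "openin (top_of_set S2) W" "x \<in> W" "0 < r"
    "\<And>r' v y. 0 < r' \<Longrightarrow> r' \<le> r \<Longrightarrow> v \<in> ball u r' \<Longrightarrow> y \<in> W \<Longrightarrow> f y = P v \<Longrightarrow> \<exists>l. lift (ball u r') l \<and> l v = y"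
proof -
  obtain d where d: "has_local_degree f x d" "d = 1 \<or> d = 2" "u \<notin> gint \<Longrightarrow> d = 1"
    using deg12[OF x(1)] deg1[OF x(1)] x(2) P_gint_iff by metis
  obtain U V \<phi> \<phi>' \<psi> \<psi>' where pc: "power_charts f x d U V \<phi> \<phi>' \<psi> \<psi>'"
      using d(1) unfolding has_local_degree_iff by blast
    note * = power_chartsD[OF pc]
  have US: "U \<subseteq> S2" using *(1) openin_imp_subset by blast
  have "open (P -` V)"
  proof -
    obtain W where W: "open W" "V = S2 \<inter> W" using *(2) unfolding openin_open by blast
    then have "P -` V = P -` W" by auto
    then show ?thesis using contP W(1) by (simp add: open_vimage)
  qed
  moreover have "u \<in> P -` V" using *(4) x by simp
  ultimately obtain r0 where r0: "0 < r0" "ball u r0 \<subseteq> P -` V" by (meson openE)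
  have PV: "P z \<in> V" if "z \<in> ball u r0" for z using r0 that by blast
  have cont: "continuous_on (ball u r0) (\<lambda>z. \<psi> (P z))"
    by (rule continuous_on_compose2[OF homeomorphism_cont1[OF *(8)] continuous_on_subset[OF contP]]) (use PV in auto)
  define r where "r = min r0 (1/2)"
  have r: "0 < r" "r \<le> r0" "r \<le> 1/2" using r0 by (auto simp: r_def)
  have main: "\<exists>l. lift (ball u r) l \<and> l v = y" if v: "v \<in> ball u r" "y \<in> U" "f y = P v" for v y
  proof (cases "d = 1")
    case True
    have "lift (ball u r) (\<lambda>z. \<phi>' (\<psi> (P z)))"
      by (rule lift_in_chart(1)[OF *(7,8) US, of d "ball u r" "\<lambda>z. \<psi> (P z)"])
        (use * True PV r continuous_on_subset[OF cont, of "ball u r"] in \<open>auto simp: subset_ball\<close>)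
    moreover have "\<phi>' (\<psi> (P v)) = y"
      using *(10)[OF v(2)] v True *(7) homeomorphism_apply1 by (metis power_one_right)
    ultimately show ?thesis by blast
  next
    case False
    then have d2: "d = 2" and ug: "u \<in> gint" using d by auto
    define F where "F z = \<psi> (P (u + z))" for z
    have "continuous_on (ball 0 r) F"
      unfolding F_def
      by (rule continuous_on_compose2[OF cont]) (use r in \<open>auto intro!: continuous_intros simp: dist_norm\<close>)
    moreover have "F (- z) = F z" if "norm z < r" for z
      using P_eq_near_gint[OF ug, of z "- z"] that r by (simp add: F_def)
    moreover have "F z = 0 \<longleftrightarrow> z = 0" if "norm z < r" for z
    proof -
      have "P (u + z) \<in> V" "P u \<in> V" using PV that r by (auto simp: dist_norm)
      moreover have "\<psi> (P u) = 0" using *(6) x by simp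
      ultimately have "F z = 0 \<longleftrightarrow> P (u + z) = P (u + 0)"
        unfolding F_def using *(8) homeomorphism_apply1 by (metis add.right_neutral)
      also have "\<dots> \<longleftrightarrow> z = 0" using P_eq_near_gint[OF ug, of z 0] that r by auto
      finally show ?thesis .
    qed
    ultimately obtain s where s: "continuous_on (ball 0 r) s" "\<And>z. norm z < r \<Longrightarrow> (s z)\<^sup>2 = F z"
      using even_function_sqrt[OF r(1)] by metis
    define s' where "s' z = s (z - u)" for z
    have cs': "continuous_on (ball u r) s'"
      unfolding s'_def by (rule continuous_on_compose2[OF s(1)]) (auto intro!: continuous_intros simp: dist_norm norm_minus_commute)
    have sq: "s' z ^ d = \<psi> (P z)" if "z \<in> ball u r" for z
      using s(2)[of "z - u"] that by (simp add: s'_def F_def d2 dist_norm norm_minus_commute)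
    have sqm: "(- s' z) ^ d = \<psi> (P z)" if "z \<in> ball u r" for z
      using sq[OF that] by (simp add: d2)
    have PVr: "P z \<in> V" if "z \<in> ball u r" for z using PV r that by auto
    have l1: "lift (ball u r) (\<lambda>z. \<phi>' (s' z))"
      by (rule lift_in_chart(1)[OF *(7,8) US *(9,10) PVr cs' sq *(11)])
    have l2: "lift (ball u r) (\<lambda>z. \<phi>' (- s' z))"
      by (rule lift_in_chart(1)[OF *(7,8) US *(9,10) PVr continuous_on_minus[OF cs'] sqm *(11)])
    \<comment> \<open>The two square roots give two lifts, which between them reach every point of U
      over v.\<close>
    have "(\<phi> y)\<^sup>2 = (s' v)\<^sup>2" using *(10)[OF v(2)] v(3) sq[OF v(1)] d2 by simp
    then have "\<phi> y = s' v \<or> \<phi> y = - s' v" by (simp add: power2_eq_iff)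
    moreover have "\<phi>' (\<phi> y) = y" using v(2) *(7) homeomorphism_apply1 by metis
    ultimately have "\<phi>' (s' v) = y \<or> \<phi>' (- s' v) = y" by metis
    then show ?thesis using l1 l2 by blast
  qed
  show ?thesis
  proof (rule that[OF *(1,3) r(1)])
    fix r' v y assume "0 < r'" and r': "r' \<le> r" and v: "v \<in> ball u r'" "y \<in> U" "f y = P v"
    have "v \<in> ball u r" using v r' by auto
    then obtain l where "lift (ball u r) l" "l v = y" using main v by blast
    then show "\<exists>l. lift (ball u r') l \<and> l v = y" using lift_subset subset_ball[OF r'] by blast
  qed
qed

text \<open>The finitely many points of the fibre have neighbourhoods that admit lifts. The rest of
  the sphere is compact and its image misses \<open>P u\<close>, so over a small disc all preimages
  lie in these neighbourhoods.\<close>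

lemma ex_good: "\<exists>r. good u r"
proof -
  let ?F = "{x \<in> S2. f x = P u}"
  have fin: "finite ?F" by (rule finite_fibre) simp
  define L where "L x W r \<longleftrightarrow> openin (top_of_set S2) W \<and> x \<in> W \<and> 0 < r \<and>
    (\<forall>r' v y. 0 < r' \<longrightarrow> r' \<le> r \<longrightarrow> v \<in> ball u r' \<longrightarrow> y \<in> W \<longrightarrow> f y = P v \<longrightarrow> (\<exists>l. lift (ball u r') l \<and> l v = y))"
    for x W r
  have "\<forall>x\<in>?F. \<exists>p. L x (fst p) (snd p)"
  proof
    fix x assume "x \<in> ?F"
    then have x: "x \<in> S2" "f x = P u" by auto
    obtain W r where "openin (top_of_set S2) W" "x \<in> W" "0 < r"
      "\<And>r' v y. 0 < r' \<Longrightarrow> r' \<le> r \<Longrightarrow> v \<in> ball u r' \<Longrightarrow> y \<in> W \<Longrightarrow> f y = P v \<Longrightarrow> \<exists>l. lift (ball u r') l \<and> l v = y"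
      by (rule good_near_fibre_point[OF x]) blast
    then have "L x W r" unfolding L_def by blast
    then have "L x (fst (W, r)) (snd (W, r))" by simp
    then show "\<exists>p. L x (fst p) (snd p)" ..
  qed
  from bchoice[OF this] obtain p where p: "\<And>x. x \<in> ?F \<Longrightarrow> L x (fst (p x)) (snd (p x))" by blast
  define W where "W x = fst (p x)" for x
  define r where "r x = snd (p x)" for x
  have Wr: "\<And>x. x \<in> ?F \<Longrightarrow> openin (top_of_set S2) (W x)" "\<And>x. x \<in> ?F \<Longrightarrow> x \<in> W x"
    "\<And>x. x \<in> ?F \<Longrightarrow> 0 < r x"
    "\<And>x r' v y. x \<in> ?F \<Longrightarrow> 0 < r' \<Longrightarrow> r' \<le> r x \<Longrightarrow> v \<in> ball u r' \<Longrightarrow> y \<in> W x \<Longrightarrow> f y = P v \<Longrightarrow> \<exists>l. lift (ball u r') l \<and> l v = y"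
    using p unfolding L_def W_def r_def by blast+
  let ?K = "S2 - (\<Union>x\<in>?F. W x)"
  have "openin (top_of_set S2) (\<Union>x\<in>?F. W x)" using Wr(1) by (intro openin_Union) blast
  then have "closedin (top_of_set S2) ?K" by (intro closedin_diff closedin_subtopology_refl[THEN iffD2]) auto
  then have "compact ?K" using closedin_compact compact_S2 by blast
  then have "compact (f ` ?K)"
    by (rule compact_continuous_image[OF continuous_on_subset[OF contf], rotated]) blast
  then have "open (- (f ` ?K))" using compact_imp_closed by blast
  then have "open (P -` (- (f ` ?K)))" using contP by (simp add: open_vimage)
  moreover have "u \<in> P -` (- (f ` ?K))" using Wr(2) by auto
  ultimately obtain r1 where r1: "0 < r1" "ball u r1 \<subseteq> P -` (- (f ` ?K))" by (meson openE)
  define R where "R = Min (insert r1 (r ` ?F))"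
  have finI: "finite (insert r1 (r ` ?F))" using fin by simp
  have R: "0 < R" "R \<le> r1" "\<And>x. x \<in> ?F \<Longrightarrow> R \<le> r x"
    unfolding R_def using finI Wr(3) r1(1) by (auto simp: Min_gr_iff intro!: Min_le)
  have "good u R"
    unfolding good_def
  proof (intro conjI ballI impI R(1))
    fix v y assume v: "v \<in> ball u R" "y \<in> S2" "f y = P v"
    have "v \<in> ball u r1" using v(1) R(2) by auto
    then have "f y \<notin> f ` ?K" using r1(2) v(3) by auto
    then have "y \<notin> ?K" by blast
    then obtain x where "x \<in> ?F" "y \<in> W x" using v(2) by blast
    then show "\<exists>l. lift (ball u R) l \<and> l v = y" using Wr(4) R v by blast
  qed
  then show ?thesis ..
qed

text \<open>Translations by doubles of Gaussian integers preserve goodness, so a Lebesgue number of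
  one square of side 2 works in the whole plane.\<close>

lemma uniform_good: "\<exists>\<epsilon>>0. \<forall>u. good u \<epsilon>"
proof -
  obtain \<rho> where \<rho>: "\<And>u. good u (\<rho> u)" using ex_good by metis
  have "\<rho> u > 0" for u using \<rho>[of u] by (simp add: good_def)
  then have "u \<in> ball u (\<rho> u)" for u by simp
  then have "cbox 0 (Complex 2 2) \<subseteq> \<Union>(range (\<lambda>u. ball u (\<rho> u)))" by blast
  then obtain e where e: "0 < e" "\<And>x. x \<in> cbox 0 (Complex 2 2) \<Longrightarrow> \<exists>G\<in>range (\<lambda>u. ball u (\<rho> u)). ball x e \<subseteq> G"
    by (rule Heine_Borel_lemma[OF compact_cbox]) auto
  have "good u e" for u
  proof -
    define c where "c = Complex (of_int \<lfloor>Re u / 2\<rfloor>) (of_int \<lfloor>Im u / 2\<rfloor>)"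
    have "c \<in> gint" by (simp add: c_def gint_def)
    have "u - 2 * c \<in> cbox 0 (Complex 2 2)"
      unfolding c_def in_cbox_complex_iff by (simp; linarith)
    then obtain v where "ball (u - 2 * c) e \<subseteq> ball v (\<rho> v)" using e(2) by blast
    then have "good (u - 2 * c) e" using good_subset \<rho> e(1) by blast
    from good_shift[OF this \<open>c \<in> gint\<close>] show ?thesis by simp
  qed
  then show ?thesis using e(1) by blast
qed

end

text \<open>Moving from b slightly towards the centre u reaches a point where a new lift around b
  can be compared with one already given on the ball about u.\<close>

lemma point_near_sphere:
  fixes b u :: "'a::real_normed_vector"
  assumes "dist u b = R" "0 < R" "0 < \<delta>"
  obtains w where "w \<in> ball b \<delta>" "w \<in> ball u R"
proof -
  define \<eta> where "\<eta> = min (1/2) (\<delta> / (2 * R))"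
  have \<eta>: "0 < \<eta>" "\<eta> \<le> 1/2" "\<eta> * R \<le> \<delta> / 2"
    using assms unfolding \<eta>_def by (auto simp: min_def field_simps)
  define w where "w = b + \<eta> *\<^sub>R (u - b)"
  have "dist b w = \<eta> * R" using assms(1) \<eta>(1) by (simp add: w_def dist_norm)
  moreover have "dist u w = (1 - \<eta>) * R"
  proof -
    have "u - w = (1 - \<eta>) *\<^sub>R (u - b)" by (simp add: w_def algebra_simps)
    then show ?thesis using assms(1) \<eta>(2) by (simp add: dist_norm)
  qed
  moreover have "(1 - \<eta>) * R < R" using \<eta>(1) assms(2) by (simp add: algebra_simps)
  moreover have "\<eta> * R < \<delta>" using \<eta>(3) assms(3) by linarith
  ultimately have "w \<in> ball b \<delta>" "w \<in> ball u R" by auto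
  then show ?thesis by (rule that)
qed

context pillow_lift
begin

section \<open>Continuing a lift to the whole plane\<close>

lemma lift_local:
  assumes "\<And>z. z \<in> D \<Longrightarrow> \<exists>N. open N \<and> z \<in> N \<and> lift N l"
  shows "lift D l"
  unfolding lift_def
proof (intro conjI ballI)
  show "continuous_on D l"
  proof (rule continuous_at_imp_continuous_on, intro ballI)
    fix z assume "z \<in> D"
    then obtain N where N: "open N" "z \<in> N" "lift N l" using assms by blast
    then have "continuous_on N l" by (simp add: lift_def)
    then show "isCont l z" using N(1,2) by (simp add: continuous_on_eq_continuous_at)
  qed
  fix z assume "z \<in> D"
  then obtain N where N: "open N" "z \<in> N" "lift N l" using assms by blast
  then show "l z \<in> S2" "f (l z) = P z" by (auto simp: lift_def)
qed

text \<open>The lift on the disc about b is started at the value of l at a generic common point. The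
  intersection of the two balls is convex, so uniqueness applies on all of it.\<close>

lemma lift_extend_sphere_point:
  assumes g: "good b \<epsilon>" and b: "dist u0 b = R" "0 < R" and l: "lift (ball u0 R) l"
  obtains lb where "lift (ball b \<epsilon>) lb" "\<And>z. z \<in> ball b \<epsilon> \<Longrightarrow> z \<in> ball u0 R \<Longrightarrow> lb z = l z"
proof -
  have \<epsilon>: "0 < \<epsilon>" using g by (simp add: good_def)
  let ?D = "ball b \<epsilon> \<inter> ball u0 R"
  have opD: "open ?D" by blast
  have cD: "Topological_Spaces.connected ?D" by (intro convex_connected convex_Int convex_ball)
  obtain w0 where "w0 \<in> ball b \<epsilon>" "w0 \<in> ball u0 R" by (rule point_near_sphere[OF b \<epsilon>])
  then have w0D: "w0 \<in> ?D" by blast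
  obtain w where w: "w \<in> ?D" "w \<notin> gint" by (rule open_meets_non_gint[OF opD w0D])
  have "l w \<in> S2" "f (l w) = P w" using w l by (auto simp: lift_def)
  then obtain lb where lb: "lift (ball b \<epsilon>) lb" "lb w = l w"
    using g w(1) unfolding good_def by blast
  have "lb z = l z" if "z \<in> ball b \<epsilon>" "z \<in> ball u0 R" for z
    by (rule lift_unique[OF opD cD lift_subset[OF lb(1)] lift_subset[OF l] w lb(2)]) (use that in auto)
  then show ?thesis using that lb(1) by blast
qed

text \<open>An outer point uses the lift attached to its radial projection onto the sphere of radius
  R. Two of these lifts agree with l inside the old ball, hence with each other where their discs
  overlap. The gain is only \<epsilon>/2 so that the discs of two projections close to one point
  still share a point of the old ball.\<close>

lemma lift_extend:
  assumes g: "\<And>u. good u \<epsilon>" and R: "0 < R" and l: "lift (ball u0 R) l"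
  obtains l' where "lift (ball u0 (R + \<epsilon> / 2)) l'" "\<And>z. z \<in> ball u0 R \<Longrightarrow> l' z = l z"
proof -
  have \<epsilon>: "0 < \<epsilon>" using g by (simp add: good_def)
  have "\<forall>b\<in>sphere u0 R. \<exists>lb. lift (ball b \<epsilon>) lb \<and> (\<forall>z. z \<in> ball b \<epsilon> \<longrightarrow> z \<in> ball u0 R \<longrightarrow> lb z = l z)"
  proof
    fix b assume "b \<in> sphere u0 R"
    then have b: "dist u0 b = R" by simp
    obtain lb where "lift (ball b \<epsilon>) lb" "\<And>z. z \<in> ball b \<epsilon> \<Longrightarrow> z \<in> ball u0 R \<Longrightarrow> lb z = l z"
      by (rule lift_extend_sphere_point[OF g b R l]) blast
    then show "\<exists>lb. lift (ball b \<epsilon>) lb \<and> (\<forall>z. z \<in> ball b \<epsilon> \<longrightarrow> z \<in> ball u0 R \<longrightarrow> lb z = l z)" by blast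
  qed
  from bchoice[OF this] obtain B where B0: "\<forall>b\<in>sphere u0 R. lift (ball b \<epsilon>) (B b) \<and>
    (\<forall>z. z \<in> ball b \<epsilon> \<longrightarrow> z \<in> ball u0 R \<longrightarrow> B b z = l z)" by blast
  have B: "\<And>b. dist u0 b = R \<Longrightarrow> lift (ball b \<epsilon>) (B b)"
    "\<And>b z. dist u0 b = R \<Longrightarrow> z \<in> ball b \<epsilon> \<Longrightarrow> z \<in> ball u0 R \<Longrightarrow> B b z = l z"
    using B0 by simp_all
  define pr where "pr z = u0 + (R / norm (z - u0)) *\<^sub>R (z - u0)" for z
  have pr: "dist u0 (pr z) = R" "dist z (pr z) = norm (z - u0) - R" if "R \<le> norm (z - u0)" for z
  proof -
    have n: "0 < norm (z - u0)" using that R by linarith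
    show "dist u0 (pr z) = R" using n R by (simp add: pr_def dist_norm)
    have "z - pr z = (1 - R / norm (z - u0)) *\<^sub>R (z - u0)" by (simp add: pr_def algebra_simps)
    then have "dist z (pr z) = \<bar>1 - R / norm (z - u0)\<bar> * norm (z - u0)" by (simp add: dist_norm)
    also have "\<bar>1 - R / norm (z - u0)\<bar> = 1 - R / norm (z - u0)" using that n by simp
    finally show "dist z (pr z) = norm (z - u0) - R" using n by (simp add: algebra_simps)
  qed
  have agree: "B b z = B b0 z"
    if b: "dist u0 b = R" "dist u0 b0 = R" and z: "dist z b < \<epsilon> / 2" "dist z b0 < \<epsilon> / 2" for b b0 z
  proof -
    let ?D = "ball b \<epsilon> \<inter> ball b0 \<epsilon>"
    have opD: "open ?D" by blast
    have cD: "Topological_Spaces.connected ?D" by (intro convex_connected convex_Int convex_ball)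
    have "dist b b0 < \<epsilon>" using z dist_triangle[of b b0 z] by (simp add: dist_commute)
    then have "0 < \<epsilon> - dist b b0" by simp
    then obtain w0 where w0: "w0 \<in> ball b0 (\<epsilon> - dist b b0)" "w0 \<in> ball u0 R"
      using point_near_sphere[OF b(2) R] by blast
    have "dist b w0 < \<epsilon>" "dist b0 w0 < \<epsilon>"
      using w0(1) dist_triangle[of b w0 b0] zero_le_dist[of b b0] unfolding mem_ball by linarith+
    then have w0D: "w0 \<in> ?D \<inter> ball u0 R" using w0(2) by simp
    have opn: "open (?D \<inter> ball u0 R)" by blast
    obtain w where w: "w \<in> ?D \<inter> ball u0 R" "w \<notin> gint"
      by (rule open_meets_non_gint[OF opn w0D])
    have "B b w = l w" "B b0 w = l w" using B(2) b w by auto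
    then have eqw: "B b w = B b0 w" by simp
    have zD: "z \<in> ?D" using z \<epsilon> by (simp add: dist_commute)
    show ?thesis
      by (rule lift_unique[OF opD cD lift_subset[OF B(1)[OF b(1)]] lift_subset[OF B(1)[OF b(2)]] _ w(2) eqw zD])
        (use w in auto)
  qed
  define l' where "l' z = (if z \<in> ball u0 R then l z else B (pr z) z)" for z
  have "lift (ball u0 (R + \<epsilon> / 2)) l'"
  proof (rule lift_local)
    fix z0 assume z0: "z0 \<in> ball u0 (R + \<epsilon> / 2)"
    show "\<exists>N. open N \<and> z0 \<in> N \<and> lift N l'"
    proof (cases "z0 \<in> ball u0 R")
      case True
      have "lift (ball u0 R) l'" by (rule lift_cong[OF l]) (simp add: l'_def)
      then show ?thesis using True open_ball by blast
    next
      case False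
      then have z0R: "R \<le> norm (z0 - u0)" by (simp add: dist_norm norm_minus_commute)
      let ?b = "pr z0"
      have d0: "dist z0 ?b < \<epsilon> / 2" using pr(2)[OF z0R] z0 by (simp add: dist_norm norm_minus_commute)
      let ?N = "ball z0 (\<epsilon> / 2 - dist z0 ?b) \<inter> ball u0 (R + \<epsilon> / 2)"
      have near: "dist z ?b < \<epsilon> / 2" if "z \<in> ?N" for z
        using that dist_triangle[of z ?b z0] by (simp add: dist_commute)
      have "lift ?N l'"
      proof (rule lift_cong[OF lift_subset[OF B(1)[OF pr(1)[OF z0R]]]])
        show "?N \<subseteq> ball ?b \<epsilon>"
        proof
          fix z assume "z \<in> ?N"
          then show "z \<in> ball ?b \<epsilon>" using near[of z] \<epsilon> by (simp add: dist_commute)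
        qed
        fix z assume z: "z \<in> ?N"
        have zb: "z \<in> ball ?b \<epsilon>" using near[OF z] \<epsilon> by (simp add: dist_commute)
        show "B ?b z = l' z"
        proof (cases "z \<in> ball u0 R")
          case True
          then show ?thesis using B(2)[OF pr(1)[OF z0R] zb True] by (simp add: l'_def)
        next
          case False
          then have zR: "R \<le> norm (z - u0)" by (simp add: dist_norm norm_minus_commute)
          have "dist z (pr z) < \<epsilon> / 2" using pr(2)[OF zR] z by (simp add: dist_norm norm_minus_commute)
          then have "B ?b z = B (pr z) z" using agree[OF pr(1)[OF z0R] pr(1)[OF zR] near[OF z]] by blast
          then show ?thesis using False by (simp add: l'_def)
        qed
      qed
      moreover have "open ?N" "z0 \<in> ?N" using z0 d0 by auto
      ultimately show ?thesis by blast
    qed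
  qed
  then show ?thesis using that by (simp add: l'_def)
qed

text \<open>The radius grows by the same \<epsilon>/2 in every step, so finitely many steps reach
  any given point of the plane.\<close>

theorem global_lift:
  assumes u0: "u0 \<notin> gint" and x0: "x0 \<in> S2" "f x0 = P u0"
  obtains Q where "lift UNIV Q" "Q u0 = x0"
proof -
  obtain \<epsilon> where \<epsilon>: "0 < \<epsilon>" "\<And>u. good u \<epsilon>" using uniform_good by blast
  define \<rho> where "\<rho> n = \<epsilon> + real n * (\<epsilon> / 2)" for n
  have \<rho>0: "0 < \<rho> n" for n using \<epsilon>(1) by (simp add: \<rho>_def add_pos_nonneg)
  have "\<exists>l. lift (ball u0 (\<rho> n)) l \<and> l u0 = x0" for n
  proof (induction n)
    case 0
    show ?case using \<epsilon>(2)[of u0] \<epsilon>(1) x0 unfolding good_def \<rho>_def by simp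
  next
    case (Suc n)
    then obtain l where l: "lift (ball u0 (\<rho> n)) l" "l u0 = x0" by blast
    obtain l' where l': "lift (ball u0 (\<rho> n + \<epsilon> / 2)) l'" "\<And>z. z \<in> ball u0 (\<rho> n) \<Longrightarrow> l' z = l z"
      by (rule lift_extend[OF \<epsilon>(2) \<rho>0 l(1)]) blast
    have "l' u0 = x0" using l'(2)[of u0] l(2) \<rho>0[of n] by simp
    moreover have "\<rho> (Suc n) = \<rho> n + \<epsilon> / 2" by (simp add: \<rho>_def field_simps)
    ultimately show ?case using l'(1) by metis
  qed
  then obtain L where L: "\<And>n. lift (ball u0 (\<rho> n)) (L n)" "\<And>n. L n u0 = x0" by metis
  have mono: "\<rho> n \<le> \<rho> m" if "n \<le> m" for n m
    using that \<epsilon>(1) by (simp add: \<rho>_def mult_right_mono)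
  have agree': "L n z = L m z" if "n \<le> m" "z \<in> ball u0 (\<rho> n)" for n m z
  proof (rule lift_unique[OF open_ball connected_ball L(1) lift_subset[OF L(1)[of m]] _ u0 _ that(2)])
    show "ball u0 (\<rho> n) \<subseteq> ball u0 (\<rho> m)" using mono[OF that(1)] by auto
  qed (use \<rho>0 L(2) in auto)
  have agree: "L n z = L m z" if "z \<in> ball u0 (\<rho> n)" "z \<in> ball u0 (\<rho> m)" for n m z
    using agree'[OF _ that(1), of m] agree'[OF _ that(2), of n] nat_le_linear[of n m] by metis
  have "\<exists>n. z \<in> ball u0 (\<rho> n)" for z
  proof -
    obtain n where "dist u0 z / (\<epsilon> / 2) < real n" using reals_Archimedean2 by blast
    then have "dist u0 z < real n * (\<epsilon> / 2)" using \<epsilon>(1) by (simp add: field_simps)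
    then show ?thesis using \<epsilon>(1) by (intro exI[of _ n]) (simp add: \<rho>_def)
  qed
  then obtain N where N: "\<And>z. z \<in> ball u0 (\<rho> (N z))" by metis
  define Q where "Q z = L (N z) z" for z
  have "lift UNIV Q"
  proof (rule lift_local)
    fix z
    have "lift (ball u0 (\<rho> (N z))) Q"
    proof (rule lift_cong[OF L(1)])
      fix v assume "v \<in> ball u0 (\<rho> (N z))"
      then show "L (N z) v = Q v" unfolding Q_def by (rule agree[OF _ N])
    qed
    then show "\<exists>N. open N \<and> z \<in> N \<and> lift N Q" using N open_ball by blast
  qed
  moreover have "Q u0 = x0" using L(2) by (simp add: Q_def)
  ultimately show ?thesis by (rule that)
qed

text \<open>Near a generic value f is injective, and P is open: a point y close to l u satisfies f y
  = P v for some v close to u, and injectivity gives y = l v.\<close>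

lemma lift_open_generic:
  assumes l: "lift D l" and D: "open D" "D \<inter> gint = {}"
  shows "openin (top_of_set S2) (l ` D)"
proof (subst openin_subopen, intro ballI)
  fix x assume "x \<in> l ` D"
  then obtain u where u: "u \<in> D" "x = l u" by blast
  have cl: "continuous_on D l" using l by (simp add: lift_def)
  have xS: "x \<in> S2" "f x = P u" using u l by (auto simp: lift_def)
  moreover have "P u \<notin> P ` gint" using P_gint_iff u D(2) by blast
  ultimately have "has_local_degree f x 1" using deg1 by simp
  then obtain U where U: "openin (top_of_set S2) U" "x \<in> U" "inj_on f U"
    by (rule local_inj_if_degree_1)
  obtain W where W: "open W" "U = S2 \<inter> W" using U(1) unfolding openin_open by blast
  have op0: "open (D \<inter> l -` W)" by (rule continuous_open_preimage[OF cl D(1) W(1)])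
  obtain O' where O': "open O'" "P ` (D \<inter> l -` W) = S2 \<inter> O'"
    using openP[OF op0] unfolding openin_open by blast
  have op1: "openin (top_of_set S2) (S2 \<inter> f -` O')"
    using continuous_openin_preimage_gen[OF contf O'(1)] .
  let ?W = "U \<inter> (S2 \<inter> f -` O')"
  have "openin (top_of_set S2) ?W" using U(1) op1 by (rule openin_Int)
  moreover have "x \<in> ?W"
  proof -
    have "u \<in> D \<inter> l -` W" using u U(2) W(2) by auto
    then have "f x \<in> O'" using O'(2) xS(2) by blast
    then show ?thesis using U(2) xS(1) by blast
  qed
  moreover have "?W \<subseteq> l ` D"
  proof
    fix y assume y: "y \<in> ?W"
    then have "f y \<in> S2 \<inter> O'" using f_in by blast
    then obtain v where v: "v \<in> D \<inter> l -` W" "f y = P v" using O'(2) by blast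
    then have "l v \<in> U" "f (l v) = f y" using l W(2) unfolding lift_def by auto
    then have "l v = y" using U(3) y by (meson IntD1 inj_onD)
    then show "y \<in> l ` D" using v by blast
  qed
  ultimately show "\<exists>T. openin (top_of_set S2) T \<and> x \<in> T \<and> T \<subseteq> l ` D" by blast
qed

end

section \<open>Uniqueness of the local degree; lifts are open\<close>

lemma openin_chart_ball:
  assumes U: "openin (top_of_set S2) U" and h: "homeomorphism U (ball 0 1) \<phi> \<phi>'" and r: "r \<le> 1"
  shows "openin (top_of_set S2) (\<phi>' ` ball (0::complex) r)"
proof -
  have "openin (top_of_set (ball 0 1)) (ball (0::complex) r)"
    by (rule open_subset) (use r in auto)
  then have "openin (top_of_set U) (\<phi>' ` ball 0 r)"
    using homeomorphism_imp_open_map[OF homeomorphism_symD[OF h]] by blast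
  then show ?thesis using U openin_trans by blast
qed

lemma chart_ball_in_nbhd:
  assumes h: "homeomorphism U (ball 0 1) \<phi> \<phi>'" and x: "x \<in> U" "\<phi> x = (0::complex)"
    and W: "openin (top_of_set S2) W" "x \<in> W" and US: "U \<subseteq> S2"
  obtains r where "0 < r" "r \<le> 1" "\<phi>' ` ball 0 r \<subseteq> W" "x \<in> \<phi>' ` ball 0 r"
proof -
  obtain T where T: "open T" "W = S2 \<inter> T" using W(1) unfolding openin_open by blast
  have c: "continuous_on (ball 0 1) \<phi>'" by (rule homeomorphism_cont2[OF h])
  have "open (ball 0 1 \<inter> \<phi>' -` T)" by (rule continuous_open_preimage[OF c open_ball T(1)])
  moreover have x0: "\<phi>' 0 = x" using homeomorphism_apply1[OF h x(1)] x(2) by simp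
  then have "0 \<in> ball 0 1 \<inter> \<phi>' -` T" using W(2) T(2) by auto
  ultimately obtain r where r: "0 < r" "ball 0 r \<subseteq> ball 0 1 \<inter> \<phi>' -` T" by (meson openE)
  define r' where "r' = min r 1"
  have "\<phi>' ` ball 0 r' \<subseteq> W"
  proof
    fix y assume "y \<in> \<phi>' ` ball 0 r'"
    then obtain z where z: "z \<in> ball 0 r'" "y = \<phi>' z" by blast
    then have "z \<in> ball 0 1" "z \<in> ball 0 r" by (auto simp: r'_def)
    then have "y \<in> U" "y \<in> T" using z r(2) homeomorphism_image2[OF h] by auto
    then show "y \<in> W" using T US by blast
  qed
  moreover have "x \<in> \<phi>' ` ball 0 r'" using x0 r(1) by (auto simp: r'_def image_iff intro!: bexI[of _ 0])
  moreover have "0 < r'" "r' \<le> 1" using r(1) by (auto simp: r'_def)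
  ultimately show ?thesis using that by blast
qed

text \<open>The local degree is a count of preimages and so independent of the charts: a value close
  to f x but different from it has d distinct roots in the chart, all close to x.\<close>

lemma has_local_degree_many_preimages:
  assumes "has_local_degree f x d" and W: "openin (top_of_set S2) W" "x \<in> W"
  obtains S y where "S \<subseteq> W" "finite S" "card S = d" "\<And>a. a \<in> S \<Longrightarrow> f a = y"
proof -
  obtain U V \<phi> \<phi>' \<psi> \<psi>' where pc: "power_charts f x d U V \<phi> \<phi>' \<psi> \<psi>'"
    using assms(1) unfolding has_local_degree_iff by blast
  note * = power_chartsD[OF pc]
  have US: "U \<subseteq> S2" using *(1) openin_imp_subset by blast
  obtain r where r: "0 < r" "r \<le> 1" "\<phi>' ` ball 0 r \<subseteq> W" "x \<in> \<phi>' ` ball 0 r"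
    by (rule chart_ball_in_nbhd[OF *(7,3,5) W US])
  define t where "t = complex_of_real (r / 2)"
  have t: "t \<noteq> 0" "norm t = r / 2" using r by (auto simp: t_def)
  let ?Z = "{z. z ^ d = t ^ d}"
  have nz: "norm z = r / 2" if "z \<in> ?Z" for z
  proof -
    have "norm z ^ d = norm t ^ d" using that by (simp flip: norm_power)
    then have "norm z = norm t" by (rule power_eq_imp_eq_base) (use *(11) in auto)
    then show ?thesis using t(2) by simp
  qed
  have inj: "inj_on \<phi>' ?Z"
  proof (rule inj_onI)
    fix a b assume "a \<in> ?Z" "b \<in> ?Z" "\<phi>' a = \<phi>' b"
    moreover have "a \<in> ball 0 1" "b \<in> ball 0 1" using nz[OF \<open>a \<in> ?Z\<close>] nz[OF \<open>b \<in> ?Z\<close>] r by auto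
    ultimately show "a = b" using homeomorphism_apply2[OF *(7)] by metis
  qed
  have "card ?Z = d" using card_nth_roots[of "t ^ d" d] t(1) *(11) by simp
  then have cS: "card (\<phi>' ` ?Z) = d" using card_image[OF inj] by simp
  then have fin: "finite (\<phi>' ` ?Z)" using *(11) card_ge_0_finite by force
  have sub: "\<phi>' ` ?Z \<subseteq> W"
  proof -
    have "?Z \<subseteq> ball 0 r"
    proof
      fix z assume "z \<in> ?Z"
      from nz[OF this] show "z \<in> ball 0 r" using r(1) by simp
    qed
    then show ?thesis using r(3) by blast
  qed
  have "f a = \<psi>' (t ^ d)" if "a \<in> \<phi>' ` ?Z" for a
  proof -
    from that obtain z where z: "z \<in> ?Z" "a = \<phi>' z" by (auto simp del: mem_Collect_eq)
    have zb: "z \<in> ball 0 1" using nz[OF z(1)] r by simp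
    then have aU: "a \<in> U" using homeomorphism_image2[OF *(7)] z by blast
    have "\<phi> a = z" using homeomorphism_apply2[OF *(7) zb] z by simp
    then have "\<psi> (f a) = t ^ d" using *(10)[OF aU] z by simp
    then show ?thesis using homeomorphism_apply1[OF *(8) *(9)[OF aU]] by metis
  qed
  then show ?thesis using that[OF sub fin cS] by blast
qed

lemma has_local_degree_few_preimages:
  assumes "has_local_degree f x d"
  obtains W where "openin (top_of_set S2) W" "x \<in> W"
    "\<And>S y. S \<subseteq> W \<Longrightarrow> finite S \<Longrightarrow> (\<And>a. a \<in> S \<Longrightarrow> f a = y) \<Longrightarrow> card S \<le> d"
proof -
  obtain U V \<phi> \<phi>' \<psi> \<psi>' where pc: "power_charts f x d U V \<phi> \<phi>' \<psi> \<psi>'"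
    using assms(1) unfolding has_local_degree_iff by blast
  note * = power_chartsD[OF pc]
  have "card S \<le> d" if S: "S \<subseteq> U" "finite S" "\<And>a. a \<in> S \<Longrightarrow> f a = y" for S y
  proof -
    have inj: "inj_on \<phi> S"
      by (rule inj_on_subset[OF _ S(1)], rule inj_on_inverseI, rule homeomorphism_apply1[OF *(7)])
    have sub: "\<phi> ` S \<subseteq> {z. z ^ d = \<psi> y}"
    proof
      fix z assume "z \<in> \<phi> ` S"
      then obtain a where a: "a \<in> S" "z = \<phi> a" by blast
      then show "z \<in> {z. z ^ d = \<psi> y}" using *(10)[of a] S(1,3) by auto
    qed
    have fin: "finite {z. z ^ d = \<psi> y}" by (rule finite_nth_roots) (use *(11) in simp)
    have "card {z. z ^ d = \<psi> y} \<le> d"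
    proof (cases "\<psi> y = 0")
      case True
      then have "{z. z ^ d = \<psi> y} = {0}" using *(11) by auto
      then show ?thesis using *(11) by simp
    next
      case False
      then show ?thesis using card_nth_roots[of "\<psi> y" d] *(11) by simp
    qed
    then show ?thesis using card_mono[OF fin sub] card_image[OF inj] by simp
  qed
  then show ?thesis using that[OF *(1,3)] by blast
qed

text \<open>The lower count for d, taken inside the neighbourhood of the upper count for e, gives d
  \<le> e, and conversely. This gives the \<open>THE\<close> in \<open>local_degree\<close> its
  meaning.\<close>

lemma has_local_degree_unique:
  assumes "has_local_degree f x d" "has_local_degree f x e"
  shows "d = e"
proof -
  have "d \<le> e" if d: "has_local_degree f x d" "has_local_degree f x e" for d e
  proof -
    obtain W where W: "openin (top_of_set S2) W" "x \<in> W"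
      "\<And>S y. S \<subseteq> W \<Longrightarrow> finite S \<Longrightarrow> (\<And>a. a \<in> S \<Longrightarrow> f a = y) \<Longrightarrow> card S \<le> e"
      by (rule has_local_degree_few_preimages[OF d(2)]) blast
    obtain S y where S: "S \<subseteq> W" "finite S" "card S = d" "\<And>a. a \<in> S \<Longrightarrow> f a = y"
      by (rule has_local_degree_many_preimages[OF d(1) W(1,2)]) blast
    show ?thesis using W(3)[OF S(1,2,4)] S(3) by simp
  qed
  from this[OF assms] this[OF assms(2,1)] show ?thesis by simp
qed

lemma local_degree_eq: "has_local_degree f x d \<Longrightarrow> local_degree f x = d"
  unfolding local_degree_def using has_local_degree_unique by blast

lemma local_inj_not_degree_2:
  assumes "openin (top_of_set S2) W" "x \<in> W" "inj_on f W"
  shows "\<not> has_local_degree f x 2"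
proof
  assume "has_local_degree f x 2"
  then obtain S y where S: "S \<subseteq> W" "finite S" "card S = 2" "\<And>a. a \<in> S \<Longrightarrow> f a = y"
    by (rule has_local_degree_many_preimages[OF _ assms(1,2)]) blast
  have "inj_on f S" using assms(3) S(1) inj_on_subset by blast
  then have "card (f ` S) = 2" using S(3) card_image by metis
  moreover have "f ` S \<subseteq> {y}" using S(4) by blast
  then have "card (f ` S) \<le> 1" using card_mono[of "{y}" "f ` S"] by simp
  ultimately show False by simp
qed

context pillow_lift
begin

text \<open>The image of a punctured disc about u is open and closed in a punctured neighbourhood of
  l u. That neighbourhood is connected, so it is covered completely; openness comes from the generic
  case.\<close>

lemma lift_nbhd_gint:
  assumes l: "lift D l" and D: "open D" and u: "u \<in> D" "u \<in> gint"
  obtains W where "openin (top_of_set S2) W" "l u \<in> W" "W \<subseteq> l ` D"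
proof -
  define x where "x = l u"
  have xS: "x \<in> S2" "f x = P u" using l u by (auto simp: x_def lift_def)
  obtain r0 where r0: "0 < r0" "cball u r0 \<subseteq> D" using D u(1) open_contains_cball by blast
  define r where "r = min r0 (1/3)"
  have r: "0 < r" "r < 1/2" "cball u r \<subseteq> D" using r0 by (auto simp: r_def subset_cball)
  have cl: "continuous_on D l" using l by (simp add: lift_def)
  have Pl: "f (l v) = P v" "l v \<in> S2" if "v \<in> D" for v using l that by (auto simp: lift_def)
  have Pnear: "P v = P w \<longleftrightarrow> w = v \<or> w = 2 * u - v" if "dist u v < 1/2" "dist u w < 1/2" for v w
  proof -
    have "P (u + (v - u)) = P (u + (w - u)) \<longleftrightarrow> w - u = v - u \<or> w - u = - (v - u)"
      using P_eq_near_gint[OF u(2), of "v - u" "w - u"] that by (simp add: dist_norm norm_minus_commute)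
    then show ?thesis by (auto simp: algebra_simps)
  qed
  obtain d where "has_local_degree f x d" using deg12[OF xS(1)] by blast
  then obtain U V \<phi> \<phi>' \<psi> \<psi>' where pc: "power_charts f x d U V \<phi> \<phi>' \<psi> \<psi>'"
    unfolding has_local_degree_iff by blast
  note * = power_chartsD[OF pc]
  have US: "U \<subseteq> S2" using *(1) openin_imp_subset by blast
  have "openin (top_of_set S2) (P ` ball u (r/2))" by (rule openP) simp
  then obtain T where T: "open T" "P ` ball u (r/2) = S2 \<inter> T" unfolding openin_open by blast
  have op1: "openin (top_of_set S2) (S2 \<inter> f -` T)" by (rule continuous_openin_preimage_gen[OF contf T(1)])
  have "f x \<in> P ` ball u (r/2)" using xS(2) r(1) by auto
  then have x1: "x \<in> S2 \<inter> f -` T" using T(2) xS(1) by blast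
  obtain \<rho> where \<rho>: "0 < \<rho>" "\<rho> \<le> 1" "\<phi>' ` ball 0 \<rho> \<subseteq> S2 \<inter> f -` T" "x \<in> \<phi>' ` ball 0 \<rho>"
    by (rule chart_ball_in_nbhd[OF *(7,3,5) op1 x1 US])
  let ?W = "\<phi>' ` ball 0 \<rho>"
  have opW: "openin (top_of_set S2) ?W" by (rule openin_chart_ball[OF *(1,7) \<rho>(2)])
  have WP: "f a \<in> P ` ball u (r/2)" if "a \<in> ?W" for a
  proof -
    have "a \<in> S2 \<inter> f -` T" using \<rho>(3) that by blast
    then have "f a \<in> S2 \<inter> T" using f_in by blast
    then show ?thesis using T(2) by blast
  qed
  have x0: "\<phi>' 0 = x" using homeomorphism_apply1[OF *(7) *(3)] *(5) by simp
  have "?W - {x} = \<phi>' ` (ball 0 \<rho> - {0})"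
  proof -
    have "inj_on \<phi>' (ball 0 \<rho>)"
      using homeomorphism_apply2[OF *(7)] \<rho>(2) by (intro inj_on_inverseI[of _ \<phi>]) auto
    from inj_on_image_set_diff[OF this, of "ball 0 \<rho>" "{0}"] show ?thesis using x0 \<rho>(1) by simp
  qed
  moreover have "Topological_Spaces.connected (\<phi>' ` (ball 0 \<rho> - {0}))"
  proof (rule connected_continuous_image)
    show "continuous_on (ball 0 \<rho> - {0}) \<phi>'"
      by (rule continuous_on_subset[OF homeomorphism_cont2[OF *(7)]]) (use \<rho>(2) in auto)
    show "Topological_Spaces.connected (ball (0::complex) \<rho> - {0})"
      by (rule connected_open_delete) auto
  qed
  ultimately have conn: "Topological_Spaces.connected (?W - {x})" by simp
  let ?A = "l ` (ball u r - {u}) \<inter> (?W - {x})"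
  have ball_nogint: "(ball u r - {u}) \<inter> gint = {}"
  proof -
    have "v = u" if "v \<in> ball u r" "v \<in> gint" for v
      using gint_norm_ge_1[OF gint_diff[OF that(2) u(2)]] that(1) r(2)
      by (auto simp: dist_norm norm_minus_commute)
    then show ?thesis by blast
  qed
  have br: "ball u r \<subseteq> D" using r(3) ball_subset_cball by blast
  then have "lift (ball u r - {u}) l" by (intro lift_subset[OF l]) blast
  then have "openin (top_of_set S2) (l ` (ball u r - {u}))"
    by (rule lift_open_generic) (use ball_nogint in auto)
  then have A_op: "openin (top_of_set (?W - {x})) ?A"
  proof -
    assume "openin (top_of_set S2) (l ` (ball u r - {u}))"
    then obtain O' where O': "open O'" "l ` (ball u r - {u}) = S2 \<inter> O'" unfolding openin_open by blast
    have "?A = (?W - {x}) \<inter> O'" using O'(2) openin_imp_subset[OF opW] by blast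
    then show ?thesis using O'(1) by (simp add: openin_open_Int)
  qed
  \<comment> \<open>Points of the image inside \<open>?W\<close> already come from the disc of half
    the radius: f maps \<open>?W\<close> into the image of that disc under P, and near u the map P
    identifies v only with 2u - v. Compactness of the closed half disc then yields
    closedness.\<close>
  have A_eq: "?A = l ` cball u (r/2) \<inter> (?W - {x})"
  proof
    show "?A \<subseteq> l ` cball u (r/2) \<inter> (?W - {x})"
    proof
      fix a assume a: "a \<in> ?A"
      then obtain v where v: "v \<in> ball u r" "a = l v" by blast
      have vD: "v \<in> D" using v(1) r(3) by auto
      obtain w where w: "w \<in> ball u (r/2)" "f a = P w" using WP a by blast
      have "P v = P w" using Pl(1)[OF vD] v(2) w(2) by simp
      then have "w = v \<or> w = 2 * u - v" using Pnear[of v w] v(1) w(1) r(2) by auto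
      moreover have "dist u (2 * u - v) = dist u v" by (simp add: dist_norm norm_minus_commute)
      ultimately have "v \<in> cball u (r/2)" using w(1) by auto
      then have "a \<in> l ` cball u (r/2)" using v(2) by simp
      then show "a \<in> l ` cball u (r/2) \<inter> (?W - {x})" using a by simp
    qed
    show "l ` cball u (r/2) \<inter> (?W - {x}) \<subseteq> ?A"
    proof
      fix a assume a: "a \<in> l ` cball u (r/2) \<inter> (?W - {x})"
      then obtain v where v: "v \<in> cball u (r/2)" "a = l v" by (auto simp del: mem_cball)
      have "a \<noteq> x" using a by simp
      then have "v \<noteq> u" using v(2) x_def by auto
      moreover have "v \<in> ball u r" using v(1) r(1) by auto
      ultimately have "l v \<in> l ` (ball u r - {u})" by simp
      then show "a \<in> ?A" using a v(2) by simp
    qed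
  qed
  have A_cl: "closedin (top_of_set (?W - {x})) ?A"
  proof -
    have "compact (l ` cball u (r/2))"
      by (rule compact_continuous_image[OF continuous_on_subset[OF cl] compact_cball]) (use r(1,3) in auto)
    then have "closed (l ` cball u (r/2))" by (rule compact_imp_closed)
    then show ?thesis unfolding A_eq using closedin_closed_Int by (metis Int_commute)
  qed
  have A_ne: "?A \<noteq> {}"
  proof -
    obtain T' where T': "open T'" "?W = S2 \<inter> T'" using opW unfolding openin_open by blast
    have "open (D \<inter> l -` T')" by (rule continuous_open_preimage[OF cl D T'(1)])
    then have opn: "open (ball u r \<inter> (D \<inter> l -` T'))" by blast
    have uin: "u \<in> ball u r \<inter> (D \<inter> l -` T')" using r(1) u(1) \<rho>(4) T'(2) x_def by auto
    obtain v where v: "v \<in> ball u r \<inter> (D \<inter> l -` T')" "v \<notin> gint"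
      by (rule open_meets_non_gint[OF opn uin])
    have "l v \<in> ?W" using v(1) T'(2) Pl(2) by blast
    moreover have "l v \<noteq> x"
    proof
      assume "l v = x"
      then have "P v = P u" using Pl(1)[of v] v(1) xS(2) by simp
      then show False using P_gint_iff[of v] P_gint_iff[of u] u(2) v(2) by simp
    qed
    moreover have "v \<noteq> u" using v(2) u(2) by blast
    ultimately show ?thesis using v(1) by blast
  qed
  have A_all: "?A = ?W - {x}" using conn A_op A_cl A_ne unfolding connected_clopen by metis
  have "?W \<subseteq> l ` D"
  proof
    fix a assume "a \<in> ?W"
    show "a \<in> l ` D"
    proof (cases "a = x")
      case True
      then show ?thesis using u(1) x_def by simp
    next
      case False
      then have "a \<in> ?A" unfolding A_all using \<open>a \<in> ?W\<close> by simp
      then have "a \<in> l ` (ball u r - {u})" by (rule IntD1)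
      then show ?thesis using br by blast
    qed
  qed
  then show ?thesis by (rule that[OF opW, rotated]) (use \<rho>(4) x_def in simp)
qed

theorem lift_open_map:
  assumes l: "lift D l" and D: "open D"
  shows "openin (top_of_set S2) (l ` D)"
proof (subst openin_subopen, intro ballI)
  fix x assume "x \<in> l ` D"
  then obtain u where u: "u \<in> D" "x = l u" by blast
  show "\<exists>T. openin (top_of_set S2) T \<and> x \<in> T \<and> T \<subseteq> l ` D"
  proof (cases "u \<in> gint")
    case True
    obtain W where "openin (top_of_set S2) W" "l u \<in> W" "W \<subseteq> l ` D"
      by (rule lift_nbhd_gint[OF l D u(1) True])
    then show ?thesis using u(2) by blast
  next
    case False
    have "openin (top_of_set S2) (l ` (D - gint))"
      by (rule lift_open_generic[OF lift_subset[OF l] open_minus_gint[OF D]]) auto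
    moreover have "x \<in> l ` (D - gint)" using u False by blast
    ultimately show ?thesis by blast
  qed
qed

end

section \<open>The group of symmetries of a lift\<close>

locale pillow_cover = pillow_lift +
  fixes Q :: "complex \<Rightarrow> (nat \<Rightarrow> real)"
  assumes liftQ: "lift UNIV Q"
begin

lemma fQ: "f (Q z) = P z" and Q_in [simp]: "Q z \<in> S2"
  using liftQ by (auto simp: lift_def)

lemma contQ: "continuous_on UNIV Q" using liftQ by (simp add: lift_def)

text \<open>The symmetries of Q are the translations by \<open>2 * c\<close> with c in L and the half-turns about the points of I.\<close>

definition L :: "complex set" where "L = {c \<in> gint. \<forall>u. Q (u + 2 * c) = Q u}"
definition I :: "complex set" where "I = {c \<in> gint. \<forall>u. Q (2 * c - u) = Q u}"

lemma L_gint: "l \<in> L \<Longrightarrow> l \<in> gint" and I_gint: "c \<in> I \<Longrightarrow> c \<in> gint"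
  by (auto simp: L_def I_def)

lemma L_shift: "l \<in> L \<Longrightarrow> Q (u + 2 * l) = Q u" and I_flip: "c \<in> I \<Longrightarrow> Q (2 * c - u) = Q u"
  by (auto simp: L_def I_def)

lemma lift_comp:
  assumes "continuous_on UNIV g" "\<And>z. P (g z) = P z" shows "lift UNIV (\<lambda>z. Q (g z))"
  unfolding lift_def
proof (intro conjI ballI)
  show "continuous_on UNIV (\<lambda>z. Q (g z))"
    by (rule continuous_on_compose2[OF contQ assms(1)]) simp
qed (use assms(2) fQ in simp_all)

lemma lift_comp_shift: "c \<in> gint \<Longrightarrow> lift UNIV (\<lambda>z. Q (z + 2 * c))"
  by (rule lift_comp) (auto intro!: continuous_intros simp: P_shift)

lemma lift_comp_flip: "c \<in> gint \<Longrightarrow> lift UNIV (\<lambda>z. Q (2 * c - z))"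
  by (rule lift_comp) (auto intro!: continuous_intros simp: P_flip)

lemma lift_UNIV_unique:
  assumes "lift UNIV l" "w \<notin> gint" "l w = Q w" shows "l z = Q z"
  using lift_unique[OF open_UNIV connected_UNIV assms(1) liftQ, of w z] assms(2,3) by simp

lemma same_fibre:
  assumes "Q v = Q w"
  obtains c where "c \<in> gint" "w = v + 2 * c \<or> w = 2 * c - v"
proof -
  have "P v = P w" using fQ[of v] fQ[of w] assms by simp
  then show ?thesis using iffD1[OF eqP] that by blast
qed

text \<open>By uniqueness of lifts, one coincidence at a generic point makes Q agree everywhere with
  its composite with a translation or a half-turn.\<close>

lemma Q_eq_generic:
  assumes v: "v \<notin> gint" and eq: "Q v = Q w"
  shows "(\<exists>l\<in>L. w = v + 2 * l) \<or> (\<exists>c\<in>I. w = 2 * c - v)"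
proof -
  obtain c where c: "c \<in> gint" "w = v + 2 * c \<or> w = 2 * c - v" by (rule same_fibre[OF eq])
  from c(2) show ?thesis
  proof
    assume w: "w = v + 2 * c"
    have "Q (z + 2 * c) = Q z" for z
      by (rule lift_UNIV_unique[OF lift_comp_shift[OF c(1)] v]) (use eq w in simp)
    then show ?thesis using c(1) w by (auto simp: L_def)
  next
    assume w: "w = 2 * c - v"
    have "Q (2 * c - z) = Q z" for z
      by (rule lift_UNIV_unique[OF lift_comp_flip[OF c(1)] v]) (use eq w in simp)
    then show ?thesis using c(1) w by (auto simp: I_def)
  qed
qed

lemma open_vimage_Q:
  assumes "openin (top_of_set S2) W" shows "open (Q -` W)"
proof -
  obtain T where T: "open T" "W = S2 \<inter> T" using assms unfolding openin_open by blast
  have "Q -` W = Q -` T" using T(2) Q_in by auto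
  then show ?thesis using open_vimage[OF T(1) contQ] by simp
qed

text \<open>The range is open. It is also closed: a lift through a missing point that met the range
  would equal Q composed with a translation or half-turn, and would therefore stay in the
  range.\<close>

lemma range_Q: "range Q = S2"
proof (rule ccontr)
  assume ne: "range Q \<noteq> S2"
  have op: "openin (top_of_set S2) (range Q)" by (rule lift_open_map[OF liftQ open_UNIV])
  have sub: "range Q \<subseteq> S2" using Q_in by blast
  obtain \<epsilon> where \<epsilon>: "0 < \<epsilon>" "\<And>u. good u \<epsilon>" using uniform_good by blast
  have "openin (top_of_set S2) (S2 - range Q)"
  proof (subst openin_subopen, intro ballI)
    fix x assume x: "x \<in> S2 - range Q"
    then have "f x \<in> range P" using f_in rangeP by blast
    then obtain u where u: "f x = P u" by blast
    obtain l where l: "lift (ball u \<epsilon>) l" "l u = x"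
    proof -
      have "good u \<epsilon>" "u \<in> ball u \<epsilon>" "x \<in> S2" using \<epsilon> x by auto
      then show ?thesis using u that unfolding good_def by blast
    qed
    have cl: "continuous_on (ball u \<epsilon>) l" using l(1) by (simp add: lift_def)
    have "l ` ball u \<epsilon> \<inter> range Q = {}"
    proof (rule ccontr)
      assume "l ` ball u \<epsilon> \<inter> range Q \<noteq> {}"
      then obtain v where v: "v \<in> ball u \<epsilon>" "l v \<in> range Q" by blast
      obtain T where T: "open T" "range Q = S2 \<inter> T" using op unfolding openin_open by blast
      have opn: "open (ball u \<epsilon> \<inter> l -` T)" by (rule continuous_open_preimage[OF cl open_ball T(1)])
      have vin: "v \<in> ball u \<epsilon> \<inter> l -` T" using v T(2) by simp
      obtain w where w: "w \<in> ball u \<epsilon> \<inter> l -` T" "w \<notin> gint" by (rule open_meets_non_gint[OF opn vin])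
      have lw: "l w \<in> S2" "f (l w) = P w" using l(1) w(1) by (auto simp: lift_def)
      then have "l w \<in> range Q" using w(1) T(2) by simp
      then obtain w' where w': "l w = Q w'" by blast
      have "P w = P w'" using lw(2) w' fQ by simp
      then obtain c where c: "c \<in> gint" "w' = w + 2 * c \<or> w' = 2 * c - w" using iffD1[OF eqP] by blast
      have "\<exists>g. lift UNIV (\<lambda>z. Q (g z)) \<and> w' = g w"
      proof (cases "w' = w + 2 * c")
        case True
        then show ?thesis using lift_comp_shift[OF c(1)] by (intro exI[of _ "\<lambda>z. z + 2 * c"]) simp
      next
        case False
        then show ?thesis using c(2) lift_comp_flip[OF c(1)] by (intro exI[of _ "\<lambda>z. 2 * c - z"]) simp
      qed
      then obtain g where g: "lift UNIV (\<lambda>z. Q (g z))" "w' = g w" by (elim exE conjE)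
      have "l u = Q (g u)"
      proof (rule lift_unique[OF open_ball connected_ball l(1) lift_subset[OF g(1)] _ w(2)])
        show "l w = Q (g w)" using w' g(2) by simp
      qed (use w(1) \<epsilon>(1) in auto)
      then show False using l(2) x by blast
    qed
    moreover have opl: "openin (top_of_set S2) (l ` ball u \<epsilon>)" by (rule lift_open_map[OF l(1) open_ball])
    moreover have "l ` ball u \<epsilon> \<subseteq> S2" using openin_imp_subset[OF opl] .
    ultimately have "l ` ball u \<epsilon> \<subseteq> S2 - range Q" by blast
    moreover have "x \<in> l ` ball u \<epsilon>" using l(2) \<epsilon>(1) by (metis centre_in_ball imageI)
    ultimately show "\<exists>T. openin (top_of_set S2) T \<and> x \<in> T \<and> T \<subseteq> S2 - range Q"
      using opl by blast
  qed
  then have "closedin (top_of_set S2) (range Q)"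
    unfolding closedin_def topspace_euclidean_subtopology using sub by simp
  moreover have "Topological_Spaces.connected S2"
    using connected_continuous_image[OF contP connected_UNIV] rangeP by simp
  ultimately have "range Q = {} \<or> range Q = S2" using op unfolding connected_clopen by blast
  then show False using ne by blast
qed

lemma openin_Q_ball: "openin (top_of_set S2) (Q ` ball v r)"
  by (rule lift_open_map[OF lift_subset[OF liftQ subset_UNIV] open_ball])

lemma Q_eq_gint:
  assumes v: "v \<in> gint" and eq: "Q v = Q w"
  shows "w \<in> gint" and "(\<exists>l\<in>L. w = v + 2 * l) \<or> (\<exists>c\<in>I. w = 2 * c - v)"
proof -
  obtain c where c: "c \<in> gint" "w = v + 2 * c \<or> w = 2 * c - v" by (rule same_fibre[OF eq])
  then show w: "w \<in> gint" using v gint_add[OF v gint_double] gint_diff[OF gint_double v] by metis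
  have opn: "open (ball v (1/4) \<inter> Q -` (Q ` ball w (1/4)))"
    by (intro open_Int open_ball open_vimage_Q openin_Q_ball)
  have vin: "v \<in> ball v (1/4) \<inter> Q -` (Q ` ball w (1/4))" using eq by simp
  obtain v' where v': "v' \<in> ball v (1/4) \<inter> Q -` (Q ` ball w (1/4))" "v' \<notin> gint"
    by (rule open_meets_non_gint[OF opn vin])
  then obtain w' where w': "w' \<in> ball w (1/4)" "Q v' = Q w'" by auto
  have d: "norm (v' - v) < 1/4" "norm (w' - w) < 1/4"
    using v'(1) w'(1) by (auto simp: dist_norm norm_minus_commute)
  have small: "norm ((w - w') - (v - v')) < 1" "norm ((w - w') + (v - v')) < 1"
    using d norm_triangle_ineq4[of "w - w'" "v - v'"] norm_triangle_ineq[of "w - w'" "v - v'"]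
    by (simp_all add: norm_minus_commute)
  from Q_eq_generic[OF v'(2) w'(2)]
  show "(\<exists>l\<in>L. w = v + 2 * l) \<or> (\<exists>c\<in>I. w = 2 * c - v)"
  proof
    assume "\<exists>l\<in>L. w' = v' + 2 * l"
    then obtain l where l: "l \<in> L" "w' = v' + 2 * l" by blast
    have "w - v - 2 * l \<in> gint" using w v L_gint[OF l(1)] by (intro gint_diff gint_double)
    moreover have "norm (w - v - 2 * l) < 1" using small(1) l(2) by (simp add: algebra_simps)
    ultimately have "w - v - 2 * l = 0" using gint_norm_ge_1 by force
    then have "w = v + 2 * l" by (simp add: algebra_simps)
    then show ?thesis using l(1) by blast
  next
    assume "\<exists>c\<in>I. w' = 2 * c - v'"
    then obtain c where c: "c \<in> I" "w' = 2 * c - v'" by blast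
    have "w + v - 2 * c \<in> gint" using w v I_gint[OF c(1)] by (intro gint_diff gint_add gint_double)
    moreover have "norm (w + v - 2 * c) < 1" using small(2) c(2) by (simp add: algebra_simps)
    ultimately have "w + v - 2 * c = 0" using gint_norm_ge_1 by force
    then have "w = 2 * c - v" by (simp add: algebra_simps)
    then show ?thesis using c(1) by blast
  qed
qed

text \<open>If the half-turn about v is a symmetry of Q, then Q already makes the identifications
  that P makes near v, and f has nothing left to fold.\<close>

lemma degree_1_if_I:
  assumes v: "v \<in> I" shows "has_local_degree f (Q v) 1"
proof -
  have vg: "v \<in> gint" using v by (rule I_gint)
  have "inj_on f (Q ` ball v (1/2))"
  proof (rule inj_onI)
    fix x y assume "x \<in> Q ` ball v (1/2)" "y \<in> Q ` ball v (1/2)" and eq: "f x = f y"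
    then obtain a b where ab: "a \<in> ball v (1/2)" "b \<in> ball v (1/2)" "x = Q a" "y = Q b" by blast
    have "P (v + (a - v)) = P (v + (b - v))" using eq ab(3,4) fQ by simp
    then have "b - v = a - v \<or> b - v = - (a - v)"
      using P_eq_near_gint[OF vg, of "a - v" "b - v"] ab(1,2) by (simp add: dist_norm norm_minus_commute)
    then have "b = a \<or> b = 2 * v - a" by (auto simp: algebra_simps)
    then show "x = y" using I_flip[OF v] ab(3,4) by metis
  qed
  then have "\<not> has_local_degree f (Q v) 2"
    by (intro local_inj_not_degree_2[OF openin_Q_ball]) auto
  then show ?thesis using deg12[OF Q_in] by blast
qed

text \<open>If f were injective near \<open>Q v\<close>, then Q would be invariant under the
  half-turn about v at one generic point, hence everywhere, and v would lie in I.\<close>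

lemma degree_2_if_not_I:
  assumes v: "v \<in> gint" "v \<notin> I" shows "has_local_degree f (Q v) 2"
proof (rule ccontr)
  assume "\<not> has_local_degree f (Q v) 2"
  then have "has_local_degree f (Q v) 1" using deg12[OF Q_in] by blast
  then obtain U where U: "openin (top_of_set S2) U" "Q v \<in> U" "inj_on f U"
    by (rule local_inj_if_degree_1)
  have opU: "open (Q -` U)" by (rule open_vimage_Q[OF U(1)])
  then have "open ((\<lambda>z. 2 * v - z) -` (Q -` U))"
    by (rule open_vimage) (intro continuous_intros)
  then have opn: "open (Q -` U \<inter> (\<lambda>z. 2 * v - z) -` (Q -` U))" using opU by blast
  have vin: "v \<in> Q -` U \<inter> (\<lambda>z. 2 * v - z) -` (Q -` U)" using U(2) by simp
  obtain w where w: "w \<in> Q -` U \<inter> (\<lambda>z. 2 * v - z) -` (Q -` U)" "w \<notin> gint"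
    by (rule open_meets_non_gint[OF opn vin])
  have "f (Q (2 * v - w)) = f (Q w)" using fQ P_flip[OF v(1)] by simp
  then have "Q (2 * v - w) = Q w" using U(3) w(1) by (auto dest: inj_onD)
  then have "Q (2 * v - z) = Q z" for z
    by (rule lift_UNIV_unique[OF lift_comp_flip[OF v(1)] w(2)])
  then show False using v by (auto simp: I_def)
qed

lemma L_zero: "0 \<in> L" by (simp add: L_def)

lemma L_diff: "a \<in> L \<Longrightarrow> b \<in> L \<Longrightarrow> a - b \<in> L"
proof -
  assume a: "a \<in> L" and b: "b \<in> L"
  have "Q (u + 2 * (a - b)) = Q u" for u
  proof -
    have "Q (u + 2 * (a - b)) = Q (u + 2 * (a - b) + 2 * b)" using L_shift[OF b] by metis
    also have "u + 2 * (a - b) + 2 * b = u + 2 * a" by (simp add: algebra_simps)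
    finally show ?thesis using L_shift[OF a] by simp
  qed
  then show ?thesis using gint_diff[OF L_gint[OF a] L_gint[OF b]] by (auto simp: L_def)
qed

text \<open>Two half-turns compose to the translation by twice the difference of their centres.
  Together with \<open>I_L_diff\<close> this makes I either empty or a coset of L.\<close>

lemma I_diff: "a \<in> I \<Longrightarrow> b \<in> I \<Longrightarrow> a - b \<in> L"
proof -
  assume a: "a \<in> I" and b: "b \<in> I"
  have "Q (u + 2 * (a - b)) = Q u" for u
  proof -
    have "Q (u + 2 * (a - b)) = Q (2 * a - (u + 2 * (a - b)))" using I_flip[OF a] by metis
    also have "2 * a - (u + 2 * (a - b)) = 2 * b - u" by (simp add: algebra_simps)
    finally show ?thesis using I_flip[OF b] by simp
  qed
  then show ?thesis using gint_diff[OF I_gint[OF a] I_gint[OF b]] by (auto simp: L_def)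
qed

lemma I_L_diff: "a \<in> I \<Longrightarrow> l \<in> L \<Longrightarrow> a - l \<in> I"
proof -
  assume a: "a \<in> I" and l: "l \<in> L"
  have "Q (2 * (a - l) - u) = Q u" for u
  proof -
    have "Q (2 * (a - l) - u) = Q (2 * (a - l) - u + 2 * l)" using L_shift[OF l] by metis
    also have "2 * (a - l) - u + 2 * l = 2 * a - u" by (simp add: algebra_simps)
    finally show ?thesis using I_flip[OF a] by simp
  qed
  then show ?thesis using gint_diff[OF I_gint[OF a] L_gint[OF l]] by (auto simp: I_def)
qed

end

section \<open>Counting fibres by lattice classes\<close>

lemma int_subgroup_generator:
  fixes S :: "int set"
  assumes "0 \<in> S" "\<And>a b. a \<in> S \<Longrightarrow> b \<in> S \<Longrightarrow> a - b \<in> S"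
  obtains g where "g \<in> S" "\<And>x. x \<in> S \<Longrightarrow> g dvd x"
proof (cases "S = {0}")
  case True
  then show ?thesis using that by simp
next
  case False
  then obtain a where a: "a \<in> S" "a \<noteq> 0" using assms(1) by blast
  have "- a \<in> S" using assms(2)[OF assms(1) a(1)] by simp
  then have "int (nat \<bar>a\<bar>) \<in> S \<and> 0 < nat \<bar>a\<bar>" using a by (auto simp: abs_if)
  then have ex: "\<exists>n. int n \<in> S \<and> 0 < n" by blast
  define n where "n = (LEAST n. int n \<in> S \<and> 0 < n)"
  have n: "int n \<in> S" "0 < n" using LeastI_ex[OF ex] unfolding n_def by auto
  have least: "n \<le> m" if "int m \<in> S" "0 < m" for m
    unfolding n_def by (rule Least_le) (use that in simp)
  have mult: "int k * int n \<in> S" for k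
  proof (induction k)
    case (Suc k)
    have "0 - int n \<in> S" using assms n(1) by blast
    from assms(2)[OF Suc this] show ?case by (simp add: algebra_simps)
  qed (use assms(1) in simp)
  have multZ: "k * int n \<in> S" for k :: int
  proof (cases k)
    case (nonneg m) then show ?thesis using mult by simp
  next
    case (neg m)
    have "k * int n = 0 - int (Suc m) * int n" by (simp only: neg mult_minus_left diff_0)
    then show ?thesis using assms(2)[OF assms(1) mult[of "Suc m"]] by metis
  qed
  have "int n dvd x" if x: "x \<in> S" for x
  proof -
    have "x - (x div int n) * int n \<in> S" using assms(2)[OF x multZ] .
    then have r: "x mod int n \<in> S" by (simp add: minus_div_mult_eq_mod)
    have "x mod int n = 0"
    proof (rule ccontr)
      assume "x mod int n \<noteq> 0"
      moreover have "0 \<le> x mod int n" using n(2) by simp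
      ultimately have "0 < x mod int n" by linarith
      then have "n \<le> nat (x mod int n)" using least[of "nat (x mod int n)"] r by simp
      then show False using pos_mod_bound[of "int n" x] n(2) by linarith
    qed
    then show ?thesis by (simp add: dvd_eq_mod_eq_0)
  qed
  then show ?thesis using n(1) that by blast
qed

lemma of_int_mod_2_div_2: "(of_int x :: 'a::ring_1) = of_int (x mod 2) + 2 * of_int (x div 2)"
proof -
  have "x = x mod 2 + 2 * (x div 2)" by simp
  then have "(of_int x :: 'a) = of_int (x mod 2 + 2 * (x div 2))" by (rule arg_cong)
  then show ?thesis by (simp only: of_int_add of_int_mult of_int_numeral)
qed

text \<open>Converts an equality of kernels into an equality of counts; it compares points of the
  sphere with classes modulo 2L.\<close>

lemma card_image_eq_if_same_kernel:
  assumes "\<And>v w. v \<in> A \<Longrightarrow> w \<in> A \<Longrightarrow> g v = g w \<longleftrightarrow> h v = h w"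
  shows "card (g ` A) = card (h ` A)" "finite (g ` A) \<longleftrightarrow> finite (h ` A)"
proof -
  have inv: "inv_into A g (g v) \<in> A" "g (inv_into A g (g v)) = g v" if "v \<in> A" for v
    using that by (auto simp: inv_into_into f_inv_into_f)
  then have val: "h (inv_into A g (g v)) = h v" if "v \<in> A" for v
    using assms that by metis
  have "bij_betw (\<lambda>x. h (inv_into A g x)) (g ` A) (h ` A)"
  proof (rule bij_betwI')
    fix x y assume "x \<in> g ` A" "y \<in> g ` A"
    then show "h (inv_into A g x) = h (inv_into A g y) \<longleftrightarrow> x = y"
      using val assms by auto
  next
    fix x assume "x \<in> g ` A"
    then show "h (inv_into A g x) \<in> h ` A" using val by auto
  next
    fix y assume "y \<in> h ` A"
    then show "\<exists>x\<in>g ` A. y = h (inv_into A g x)" using val by auto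
  qed
  then show "card (g ` A) = card (h ` A)" "finite (g ` A) \<longleftrightarrow> finite (h ` A)"
    using bij_betw_same_card bij_betw_finite by blast+
qed

section \<open>Residue classes modulo 2 and the four corners\<close>

definition cls :: "complex \<Rightarrow> complex set" where
  "cls e = {v. \<exists>c\<in>gint. v = e + 2 * c}"

definition E4 :: "complex set" where "E4 = {0, 1, \<i>, 1 + \<i>}"

lemma E4_gint: "e \<in> E4 \<Longrightarrow> e \<in> gint"
  by (auto simp: E4_def gint_def)

lemma finite_E4 [simp]: "finite E4" and card_E4: "card E4 = 4"
  by (simp_all add: E4_def complex_eq_iff)

lemma cls_gint: "e \<in> gint \<Longrightarrow> v \<in> cls e \<Longrightarrow> v \<in> gint"
  by (auto simp: cls_def intro!: gint_add gint_double)

lemma gint_in_cls: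
  assumes "v \<in> gint"
  obtains e where "e \<in> E4" "v \<in> cls e"
proof -
  obtain a b :: int where ab: "v = Complex (of_int a) (of_int b)"
    using assms by (auto simp: gint_def complex_eq_iff elim!: Ints_cases)
  define e where "e = Complex (of_int (a mod 2)) (of_int (b mod 2))"
  define c where "c = Complex (of_int (a div 2)) (of_int (b div 2))"
  have "v = e + 2 * c"
    using of_int_mod_2_div_2[of a, where ?'a = real] of_int_mod_2_div_2[of b, where ?'a = real]
    by (simp add: ab e_def c_def complex_eq_iff)
  moreover have "c \<in> gint" by (simp add: c_def gint_def)
  moreover have "a mod 2 = 0 \<or> a mod 2 = 1" "b mod 2 = 0 \<or> b mod 2 = 1" by presburger+
  then have "e \<in> E4" by (auto simp: e_def E4_def complex_eq_iff)
  ultimately show ?thesis using that by (auto simp: cls_def)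
qed

text \<open>Elements of \<open>E4\<close> are at most sqrt 2 apart, whereas distinct members of one
  class are at least 2 apart.\<close>

lemma cls_disjoint:
  assumes "e \<in> E4" "e' \<in> E4" "v \<in> cls e" "v \<in> cls e'" shows "e = e'"
proof -
  obtain c c' where c: "c \<in> gint" "c' \<in> gint" "e + 2 * c = e' + 2 * c'"
    using assms(3,4) unfolding cls_def by auto
  then have d: "e - e' = 2 * (c' - c)" by (simp add: algebra_simps)
  have "norm (e - e') < 2"
  proof -
    have "norm (e - e') \<le> sqrt 2" using assms(1,2) by (auto simp: E4_def norm_complex_def power2_eq_square)
    then show ?thesis using sqrt2_less_2 by linarith
  qed
  then have "norm (c' - c) < 1" unfolding d norm_mult by simp
  then have "c' - c = 0" using gint_norm_ge_1[OF gint_diff[OF c(2,1)]] by force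
  then show ?thesis using d by simp
qed

lemma (in pillow) P_eq_cls:
  assumes "e \<in> gint" shows "P v = P e \<longleftrightarrow> v \<in> cls e"
proof
  assume "P v = P e"
  then obtain c where c: "c \<in> gint" "v = e + 2 * c \<or> v = 2 * c - e"
    using iffD1[OF eqP, of e v] by auto
  moreover have "2 * c - e = e + 2 * (c - e)" by (simp add: algebra_simps)
  ultimately show "v \<in> cls e" using gint_diff[OF c(1) assms] unfolding cls_def by blast
next
  assume "v \<in> cls e"
  then show "P v = P e" using P_shift by (auto simp: cls_def)
qed

context pillow_cover
begin

definition \<kappa> :: "complex \<Rightarrow> complex set" where
  "\<kappa> v = (\<lambda>l. v + 2 * l) ` L"

lemma L_minus: "l \<in> L \<Longrightarrow> - l \<in> L"
  using L_diff[OF L_zero, of l] by simp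

lemma L_add: "a \<in> L \<Longrightarrow> b \<in> L \<Longrightarrow> a + b \<in> L"
  using L_diff[OF _ L_minus, of a b] by simp

lemma \<kappa>_eq_iff: "\<kappa> v = \<kappa> w \<longleftrightarrow> (\<exists>l\<in>L. w = v + 2 * l)"
proof
  assume "\<kappa> v = \<kappa> w"
  moreover have "w \<in> \<kappa> w" unfolding \<kappa>_def using L_zero by (rule image_eqI[rotated]) simp
  ultimately show "\<exists>l\<in>L. w = v + 2 * l" unfolding \<kappa>_def by auto
next
  assume "\<exists>l\<in>L. w = v + 2 * l"
  then obtain l where l: "l \<in> L" "w = v + 2 * l" by blast
  show "\<kappa> v = \<kappa> w"
  proof
    show "\<kappa> v \<subseteq> \<kappa> w"
    proof
      fix x assume "x \<in> \<kappa> v"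
      then obtain k where k: "k \<in> L" "x = v + 2 * k" unfolding \<kappa>_def by auto
      then have "x = w + 2 * (k - l)" using l(2) by (simp add: algebra_simps)
      then show "x \<in> \<kappa> w" unfolding \<kappa>_def using L_diff[OF k(1) l(1)] by (rule image_eqI)
    qed
    show "\<kappa> w \<subseteq> \<kappa> v"
    proof
      fix x assume "x \<in> \<kappa> w"
      then obtain k where k: "k \<in> L" "x = w + 2 * k" unfolding \<kappa>_def by auto
      then have "x = v + 2 * (k + l)" using l(2) by (simp add: algebra_simps)
      then show "x \<in> \<kappa> v" unfolding \<kappa>_def using L_add[OF k(1) l(1)] by (rule image_eqI)
    qed
  qed
qed

lemma \<kappa>_translate: "\<kappa> (t + v) = \<kappa> (t + w) \<longleftrightarrow> \<kappa> v = \<kappa> w"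
  unfolding \<kappa>_eq_iff by (simp add: add.assoc)

lemma card_\<kappa>_translate:
  "card (\<kappa> ` (\<lambda>v. t + v) ` A) = card (\<kappa> ` A)" "finite (\<kappa> ` (\<lambda>v. t + v) ` A) \<longleftrightarrow> finite (\<kappa> ` A)"
  using card_image_eq_if_same_kernel[of A "\<lambda>v. \<kappa> (t + v)" \<kappa>] \<kappa>_translate
  by (simp_all add: image_image)

lemma Q_eq_if_\<kappa>_eq: "\<kappa> v = \<kappa> w \<Longrightarrow> Q v = Q w"
  unfolding \<kappa>_eq_iff using L_shift by auto

text \<open>The index of L in the Gaussian integers: \<open>cls 0\<close> consists of their doubles,
  and \<kappa> divides out the doubles of L.\<close>

definition N :: nat where "N = card (\<kappa> ` cls 0)"

lemma cls_translate: "cls e = (\<lambda>v. e + v) ` cls 0"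
  by (auto simp: cls_def)

lemma finite_\<kappa>_cls: "finite (\<kappa> ` cls e)" and card_\<kappa>_cls: "card (\<kappa> ` cls e) = N"
proof -
  \<comment> \<open>The thirds keep 2u off the Gaussian integers, so no half-turn about a Gaussian
    integer carries u + v to u + w. Hence Q (u + v) separates exactly the classes of v modulo 2L,
    and all these points lie in one finite fibre.\<close>
  define u where "u = Complex (1/3) (1/3)"
  have third: "1/3 \<notin> (\<int> :: real set)" "2/3 \<notin> (\<int> :: real set)"
  proof -
    have False if "of_int k = (1/3 :: real)" for k :: int
    proof -
      have "real_of_int (3 * k) = of_int 1" using that by simp
      then have "3 * k = 1" by (simp only: of_int_eq_iff)
      then show False by presburger
    qed
    moreover have False if "of_int k = (2/3 :: real)" for k :: int
    proof -
      have "real_of_int (3 * k) = of_int 2" using that by simp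
      then have "3 * k = 2" by (simp only: of_int_eq_iff)
      then show False by presburger
    qed
    ultimately show "1/3 \<notin> (\<int> :: real set)" "2/3 \<notin> (\<int> :: real set)" by (auto elim!: Ints_cases)
  qed
  have u: "2 * u \<notin> gint" using third by (simp add: u_def gint_def)
  have ker: "Q (u + v) = Q (u + w) \<longleftrightarrow> \<kappa> v = \<kappa> w" if "v \<in> cls 0" "w \<in> cls 0" for v w
  proof
    assume "\<kappa> v = \<kappa> w"
    then show "Q (u + v) = Q (u + w)" by (intro Q_eq_if_\<kappa>_eq iffD2[OF \<kappa>_translate])
  next
    assume eq: "Q (u + v) = Q (u + w)"
    have vw: "v \<in> gint" "w \<in> gint" using that cls_gint[OF gint_closed(1)] by blast+
    have "u + v \<notin> gint"
    proof
      assume "u + v \<in> gint"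
      then have "u \<in> gint" using gint_diff[OF _ vw(1)] by force
      then show False using u gint_double by blast
    qed
    from Q_eq_generic[OF this eq] show "\<kappa> v = \<kappa> w"
    proof
      assume "\<exists>l\<in>L. u + w = u + v + 2 * l"
      then show ?thesis unfolding \<kappa>_eq_iff by (simp add: add.assoc)
    next
      assume "\<exists>c\<in>I. u + w = 2 * c - (u + v)"
      then obtain c where c: "c \<in> I" "u + w = 2 * c - (u + v)" by blast
      then have "2 * u = 2 * c - v - w" by (simp add: algebra_simps)
      then show ?thesis using u gint_diff[OF gint_diff[OF gint_double[OF I_gint[OF c(1)]] vw(1)] vw(2)] by simp
    qed
  qed
  have "(\<lambda>v. Q (u + v)) ` cls 0 \<subseteq> {x \<in> S2. f x = P u}"
    using fQ P_shift by (auto simp: cls_def)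
  then have "finite ((\<lambda>v. Q (u + v)) ` cls 0)" using finite_fibre[of "P u"] finite_subset by simp
  then have fin0: "finite (\<kappa> ` cls 0)" using card_image_eq_if_same_kernel(2)[of "cls 0" "\<lambda>v. Q (u + v)" \<kappa>] ker by blast
  show "finite (\<kappa> ` cls e)" "card (\<kappa> ` cls e) = N"
    using card_\<kappa>_translate[of e "cls 0"] fin0 by (simp_all add: N_def flip: cls_translate)
qed

lemma finite_\<kappa>_sub: "A \<subseteq> cls e \<Longrightarrow> finite (\<kappa> ` A)"
  using finite_\<kappa>_cls finite_subset image_mono by metis

definition crit :: "complex \<Rightarrow> (nat \<Rightarrow> real) set" where
  "crit e = {x \<in> S2. f x = P e \<and> has_local_degree f x 2}"

definition ncrit :: "complex \<Rightarrow> (nat \<Rightarrow> real) set" where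
  "ncrit e = {x \<in> S2. f x = P e \<and> has_local_degree f x 1}"

lemma crit_eq: "e \<in> gint \<Longrightarrow> crit e = Q ` (cls e - I)"
  and ncrit_eq: "e \<in> gint \<Longrightarrow> ncrit e = Q ` (cls e \<inter> I)"
proof -
  assume e: "e \<in> gint"
  have deg: "has_local_degree f (Q v) 2 \<longleftrightarrow> v \<notin> I" "has_local_degree f (Q v) 1 \<longleftrightarrow> v \<in> I" if "v \<in> cls e" for v
    using degree_1_if_I[of v] degree_2_if_not_I[OF cls_gint[OF e that]] has_local_degree_unique[of f "Q v" 1 2] by auto
  have fib: "f (Q v) = P e \<longleftrightarrow> v \<in> cls e" for v using fQ P_eq_cls[OF e] by simp
  show "crit e = Q ` (cls e - I)"
  proof
    show "crit e \<subseteq> Q ` (cls e - I)"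
    proof
      fix x assume x: "x \<in> crit e"
      then have "x \<in> range Q" using range_Q by (simp add: crit_def)
      then obtain v where v: "x = Q v" by blast
      then show "x \<in> Q ` (cls e - I)" using x fib[of v] deg(1)[of v] by (simp add: crit_def)
    qed
    show "Q ` (cls e - I) \<subseteq> crit e" using fib deg(1) by (auto simp: crit_def)
  qed
  show "ncrit e = Q ` (cls e \<inter> I)"
  proof
    show "ncrit e \<subseteq> Q ` (cls e \<inter> I)"
    proof
      fix x assume x: "x \<in> ncrit e"
      then have "x \<in> range Q" using range_Q by (simp add: ncrit_def)
      then obtain v where v: "x = Q v" by blast
      then show "x \<in> Q ` (cls e \<inter> I)" using x fib[of v] deg(2)[of v] by (simp add: ncrit_def)
    qed
    show "Q ` (cls e \<inter> I) \<subseteq> ncrit e" using fib deg(2) by (auto simp: ncrit_def)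
  qed
qed

text \<open>For v and c in I the half-turn about c moves v by 2(c - v), a vector of 2L. So on I the
  half-turns identify nothing beyond what the translations do.\<close>

lemma card_ncrit: "e \<in> gint \<Longrightarrow> card (ncrit e) = card (\<kappa> ` (cls e \<inter> I))"
proof -
  assume e: "e \<in> gint"
  have "Q v = Q w \<longleftrightarrow> \<kappa> v = \<kappa> w" if vw: "v \<in> cls e \<inter> I" "w \<in> cls e \<inter> I" for v w
  proof
    assume "Q v = Q w"
    then consider l where "l \<in> L" "w = v + 2 * l" | c where "c \<in> I" "w = 2 * c - v"
      using Q_eq_gint(2)[OF I_gint] vw by blast
    then show "\<kappa> v = \<kappa> w"
    proof cases
      case 1 then show ?thesis unfolding \<kappa>_eq_iff by blast
    next
      case 2
      have "w = v + 2 * (c - v)" using 2 by (simp add: algebra_simps)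
      moreover have "c - v \<in> L" using I_diff 2 vw by blast
      ultimately show ?thesis unfolding \<kappa>_eq_iff by blast
    qed
  qed (rule Q_eq_if_\<kappa>_eq)
  then show ?thesis using card_image_eq_if_same_kernel(1)[of "cls e \<inter> I" Q \<kappa>] ncrit_eq[OF e] by simp
qed

text \<open>Serves to rule out an empty I, in which case all corners would carry equally many
  critical points.\<close>

lemma card_crit_no_I: "e \<in> gint \<Longrightarrow> I = {} \<Longrightarrow> card (crit e) = N"
proof -
  assume e: "e \<in> gint" and I: "I = {}"
  have "Q v = Q w \<longleftrightarrow> \<kappa> v = \<kappa> w" if vw: "v \<in> cls e" "w \<in> cls e" for v w
  proof
    assume "Q v = Q w"
    then show "\<kappa> v = \<kappa> w" using Q_eq_gint(2)[OF cls_gint[OF e vw(1)]] I unfolding \<kappa>_eq_iff by blast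
  qed (rule Q_eq_if_\<kappa>_eq)
  then show ?thesis
    using card_image_eq_if_same_kernel(1)[of "cls e" Q \<kappa>] crit_eq[OF e] card_\<kappa>_cls I by simp
qed

text \<open>The half-turn about c0 pairs up the classes over \<open>P e\<close> outside I, and each
  pair is one critical point. Each class inside I is one non-critical point.\<close>

lemma card_crit:
  assumes e: "e \<in> gint" and c0: "c0 \<in> I"
  shows "N = 2 * card (crit e) + card (ncrit e)"
proof -
  let ?A = "cls e - I"
  have fl: "2 * c0 - v \<in> ?A" if v: "v \<in> ?A" for v
  proof -
    obtain c where c: "c \<in> gint" "v = e + 2 * c" using v by (auto simp: cls_def)
    have vg: "v \<in> gint" using cls_gint[OF e] v by blast
    have "2 * c0 - v = e + 2 * (c0 - v + c)" using c(2) by (simp add: algebra_simps)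
    moreover have "c0 - v + c \<in> gint" using gint_add[OF gint_diff[OF I_gint[OF c0] vg] c(1)] .
    ultimately have "2 * c0 - v \<in> cls e" unfolding cls_def by blast
    moreover have "2 * c0 - v \<notin> I"
    proof
      assume i: "2 * c0 - v \<in> I"
      have "c0 - ((2 * c0 - v) - c0) \<in> I" by (rule I_L_diff[OF c0 I_diff[OF i c0]])
      then show False using v by simp
    qed
    ultimately show ?thesis by blast
  qed
  have fib: "card (\<kappa> ` {v \<in> ?A. Q v = x}) = 2" if x: "x \<in> Q ` ?A" for x
  proof -
    obtain v where v: "v \<in> ?A" "x = Q v" using x by blast
    have vg: "v \<in> gint" using cls_gint[OF e] v by blast
    have "\<kappa> ` {w \<in> ?A. Q w = x} = {\<kappa> v, \<kappa> (2 * c0 - v)}"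
    proof
      show "\<kappa> ` {w \<in> ?A. Q w = x} \<subseteq> {\<kappa> v, \<kappa> (2 * c0 - v)}"
      proof
        fix X assume "X \<in> \<kappa> ` {w \<in> ?A. Q w = x}"
        then obtain w where w: "w \<in> ?A" "Q v = Q w" "X = \<kappa> w" using v(2) by auto
        from Q_eq_gint(2)[OF vg w(2)] consider l where "l \<in> L" "w = v + 2 * l" | c where "c \<in> I" "w = 2 * c - v" by blast
        then show "X \<in> {\<kappa> v, \<kappa> (2 * c0 - v)}"
        proof cases
          case 1
          then have "\<kappa> v = \<kappa> w" unfolding \<kappa>_eq_iff by blast
          then show ?thesis using w(3) by simp
        next
          case 2
          have "w = (2 * c0 - v) + 2 * (c - c0)" using 2 by (simp add: algebra_simps)
          then have "\<kappa> (2 * c0 - v) = \<kappa> w" unfolding \<kappa>_eq_iff using I_diff[OF 2(1) c0] by blast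
          then show ?thesis using w(3) by simp
        qed
      qed
      have "Q (2 * c0 - v) = x" using I_flip[OF c0] v(2) by simp
      then show "{\<kappa> v, \<kappa> (2 * c0 - v)} \<subseteq> \<kappa> ` {w \<in> ?A. Q w = x}" using v fl[OF v(1)] by auto
    qed
    \<comment> \<open>A class fixed by the half-turn would give v = c0 - l with l in L, and so v in
      I.\<close>
    moreover have "\<kappa> v \<noteq> \<kappa> (2 * c0 - v)"
    proof
      assume "\<kappa> v = \<kappa> (2 * c0 - v)"
      then obtain l where l: "l \<in> L" "2 * c0 - v = v + 2 * l" unfolding \<kappa>_eq_iff by blast
      have "c0 - l = (2 * c0 - 2 * l) / 2" by (simp add: diff_divide_distrib)
      also have "2 * c0 - 2 * l = 2 * v" using l(2) by (simp add: algebra_simps)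
      finally have "c0 - l = v" by simp
      then show False using I_L_diff[OF c0 l(1)] v(1) by simp
    qed
    ultimately show ?thesis by simp
  qed
  have finA: "finite (\<kappa> ` ?A)" by (rule finite_\<kappa>_sub) blast
  have finQ: "finite (Q ` ?A)"
  proof -
    have "Q ` ?A \<subseteq> {x \<in> S2. f x = P e}" using crit_eq[OF e] by (auto simp: crit_def)
    then show ?thesis using finite_fibre[of "P e"] finite_subset by simp
  qed
  have "\<kappa> ` ?A = (\<Union>x\<in>Q ` ?A. \<kappa> ` {v \<in> ?A. Q v = x})" by blast
  moreover have "card (\<Union>x\<in>Q ` ?A. \<kappa> ` {v \<in> ?A. Q v = x}) = (\<Sum>x\<in>Q ` ?A. card (\<kappa> ` {v \<in> ?A. Q v = x}))"
  proof (rule card_UN_disjoint[OF finQ])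
    show "\<forall>x\<in>Q ` ?A. finite (\<kappa> ` {v \<in> ?A. Q v = x})"
      using finite_subset[OF _ finA] by (metis (no_types, lifting) image_mono mem_Collect_eq subsetI)
    show "\<forall>x\<in>Q ` ?A. \<forall>y\<in>Q ` ?A. x \<noteq> y \<longrightarrow> \<kappa> ` {v \<in> ?A. Q v = x} \<inter> \<kappa> ` {v \<in> ?A. Q v = y} = {}"
      using Q_eq_if_\<kappa>_eq by blast
  qed
  ultimately have two: "card (\<kappa> ` ?A) = 2 * card (Q ` ?A)" using fib by simp
  have "\<kappa> ` cls e = \<kappa> ` ?A \<union> \<kappa> ` (cls e \<inter> I)" by blast
  moreover have "\<kappa> ` ?A \<inter> \<kappa> ` (cls e \<inter> I) = {}"
  proof -
    have False if vw: "v \<notin> I" "w \<in> I" "\<kappa> v = \<kappa> w" for v w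
    proof -
      obtain l where l: "l \<in> L" "w = v + 2 * l" using vw(3) unfolding \<kappa>_eq_iff by blast
      have "w - (l + l) \<in> I" by (rule I_L_diff[OF vw(2) L_add[OF l(1,1)]])
      then show False using vw(1) l(2) by simp
    qed
    then show ?thesis by blast
  qed
  ultimately have "card (\<kappa> ` cls e) = card (\<kappa> ` ?A) + card (\<kappa> ` (cls e \<inter> I))"
    using card_Un_disjoint[OF finA finite_\<kappa>_sub[of "cls e \<inter> I" e]] by simp
  then show ?thesis using two card_\<kappa>_cls crit_eq[OF e] card_ncrit[OF e] by simp
qed

section \<open>Bounding the half-turn centres modulo the lattice\<close>

lemma L_mult: "l \<in> L \<Longrightarrow> of_int m * l \<in> L"
proof -
  assume l: "l \<in> L"
  have nat: "of_nat k * l \<in> L" for k :: nat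
    by (induction k) (use l L_zero L_add in \<open>auto simp: algebra_simps\<close>)
  show ?thesis
  proof (cases m)
    case (nonneg n) then show ?thesis using nat[of n] by simp
  next
    case (neg n)
    have "of_int m * l = - (of_nat (Suc n) * l)" unfolding neg by (simp add: algebra_simps)
    then show ?thesis using L_minus[OF nat[of "Suc n"]] by metis
  qed
qed

text \<open>A triangular basis: the real parts of L, and the purely imaginary elements of L, are
  given by subgroups of the integers and so have generators. Subtracting a multiple of a vector with
  generating real part leaves a purely imaginary element.\<close>

lemma L_generators:
  obtains a b where "a \<in> L" "b \<in> L" "\<forall>l\<in>L. \<exists>m n :: int. l = of_int m * a + of_int n * b"
proof -
  define S1 where "S1 = {y :: int. Complex 0 (of_int y) \<in> L}"
  define S2' where "S2' = {x :: int. \<exists>y :: int. Complex (of_int x) (of_int y) \<in> L}"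
  have C: "Complex (of_int x) (of_int y) - Complex (of_int x') (of_int y') = Complex (of_int (x - x')) (of_int (y - y'))" for x y x' y'
    by (simp add: complex_eq_iff)
  have "0 \<in> S1" using L_zero by (simp add: S1_def flip: zero_complex.code)
  moreover have "p - q \<in> S1" if "p \<in> S1" "q \<in> S1" for p q
    using L_diff[of "Complex 0 (of_int p)" "Complex 0 (of_int q)"] that C[of 0 p 0 q] by (simp add: S1_def)
  ultimately obtain h where h: "h \<in> S1" "\<And>x. x \<in> S1 \<Longrightarrow> h dvd x" using int_subgroup_generator[of S1] by blast
  have "0 \<in> S2'" using L_zero by (auto simp: S2'_def simp flip: zero_complex.code intro!: exI[of _ 0])
  moreover have "p - q \<in> S2'" if pq: "p \<in> S2'" "q \<in> S2'" for p q
  proof -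
    obtain y y' where "Complex (of_int p) (of_int y) \<in> L" "Complex (of_int q) (of_int y') \<in> L" using pq by (auto simp: S2'_def)
    from L_diff[OF this] show ?thesis unfolding C S2'_def by blast
  qed
  ultimately obtain g where g: "g \<in> S2'" "\<And>x. x \<in> S2' \<Longrightarrow> g dvd x" using int_subgroup_generator[of S2'] by blast
  obtain y where y: "Complex (of_int g) (of_int y) \<in> L" using g(1) by (auto simp: S2'_def)
  let ?a = "Complex (of_int g) (of_int y)" and ?b = "Complex 0 (of_int h)"
  have "\<exists>m n :: int. l = of_int m * ?a + of_int n * ?b" if l: "l \<in> L" for l
  proof -
    obtain p q :: int where pq: "l = Complex (of_int p) (of_int q)"
      using L_gint[OF l] by (auto simp: gint_def complex_eq_iff elim!: Ints_cases)
    then have "p \<in> S2'" using l by (auto simp: S2'_def)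
    then obtain m where m: "p = g * m" using g(2) by blast
    have "l - of_int m * ?a = Complex 0 (of_int (q - m * y))"
      unfolding pq m by (simp add: complex_eq_iff)
    then have "q - m * y \<in> S1" using L_diff[OF l L_mult[OF y, of m]] by (simp add: S1_def)
    then obtain n where n: "q - m * y = h * n" using h(2) by blast
    then have "q = m * y + h * n" by simp
    then have "l = of_int m * ?a + of_int n * ?b"
      unfolding pq m by (simp add: complex_eq_iff)
    then show ?thesis by blast
  qed
  then have gen: "\<forall>l\<in>L. \<exists>m n :: int. l = of_int m * ?a + of_int n * ?b" by (rule ballI)
  have "?b \<in> L" using h(1) by (simp add: S1_def)
  then show ?thesis by (rule that[OF y _ gen])
qed

text \<open>Differences of points of I lie in L, which has two generators. Reducing both
  coefficients modulo 2 leaves at most 4 classes modulo 2L.\<close>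

lemma card_\<kappa>_I: "finite (\<kappa> ` I)" "card (\<kappa> ` I) \<le> 4"
proof -
  have "\<exists>F. finite F \<and> card F \<le> 4 \<and> \<kappa> ` I \<subseteq> F"
  proof (cases "I = {}")
    case False
    then obtain c0 where c0: "c0 \<in> I" by blast
    obtain a b where ab: "a \<in> L" "b \<in> L" "\<forall>l\<in>L. \<exists>m n :: int. l = of_int m * a + of_int n * b"
      by (rule L_generators)
    let ?h = "\<lambda>(i :: int, j :: int). \<kappa> (c0 + (of_int i * a + of_int j * b))"
    let ?F = "?h ` ({0, 1} \<times> {0, 1})"
    have "\<kappa> ` I \<subseteq> ?F"
    proof
      fix X assume "X \<in> \<kappa> ` I"
      then obtain c where c: "c \<in> I" "X = \<kappa> c" by blast
      obtain m n :: int where mn: "c - c0 = of_int m * a + of_int n * b" using bspec[OF ab(3) I_diff[OF c(1) c0]] by blast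
      define i where "i = m mod 2"
      define j where "j = n mod 2"
      let ?k = "of_int (m div 2) * a + of_int (n div 2) * b"
      have mc: "(of_int m :: complex) = of_int i + 2 * of_int (m div 2)" "(of_int n :: complex) = of_int j + 2 * of_int (n div 2)"
        unfolding i_def j_def by (rule of_int_mod_2_div_2)+
      have "c = c0 + (of_int m * a + of_int n * b)" using mn by (simp add: algebra_simps)
      then have "c = (c0 + (of_int i * a + of_int j * b)) + 2 * ?k" unfolding mc by (simp add: algebra_simps)
      moreover have "?k \<in> L" by (intro L_add L_mult ab)
      ultimately have "\<kappa> (c0 + (of_int i * a + of_int j * b)) = \<kappa> c" unfolding \<kappa>_eq_iff by blast
      then have "X = ?h (i, j)" using c(2) by simp
      moreover have "(i, j) \<in> {0, 1} \<times> {0, 1}" unfolding i_def j_def by auto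
      ultimately show "X \<in> ?F" by blast
    qed
    moreover have "card ?F \<le> 4" using card_image_le[of "{0, 1} \<times> {0, 1 :: int}" ?h] by simp
    moreover have "finite ?F" by simp
    ultimately show ?thesis by blast
  qed (auto intro: exI[of _ "{}"])
  then obtain F where F: "finite F" "card F \<le> 4" "\<kappa> ` I \<subseteq> F" by blast
  show "finite (\<kappa> ` I)" by (rule finite_subset[OF F(3,1)])
  show "card (\<kappa> ` I) \<le> 4" using card_mono[OF F(1,3)] F(2) by linarith
qed

lemma sum_card_ncrit: "(\<Sum>e\<in>E4. card (ncrit e)) = card (\<kappa> ` I)"
proof -
  have "\<kappa> ` I = (\<Union>e\<in>E4. \<kappa> ` (cls e \<inter> I))"
  proof
    show "\<kappa> ` I \<subseteq> (\<Union>e\<in>E4. \<kappa> ` (cls e \<inter> I))"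
    proof
      fix X assume "X \<in> \<kappa> ` I"
      then obtain c where c: "c \<in> I" "X = \<kappa> c" by blast
      obtain e where "e \<in> E4" "c \<in> cls e" by (rule gint_in_cls[OF I_gint[OF c(1)]])
      then show "X \<in> (\<Union>e\<in>E4. \<kappa> ` (cls e \<inter> I))" using c by blast
    qed
  qed blast
  moreover have "card (\<Union>e\<in>E4. \<kappa> ` (cls e \<inter> I)) = (\<Sum>e\<in>E4. card (\<kappa> ` (cls e \<inter> I)))"
  proof (rule card_UN_disjoint[OF finite_E4])
    show "\<forall>e\<in>E4. finite (\<kappa> ` (cls e \<inter> I))" by (rule ballI) (rule finite_\<kappa>_sub, rule Int_lower1)
    show "\<forall>e\<in>E4. \<forall>e'\<in>E4. e \<noteq> e' \<longrightarrow> \<kappa> ` (cls e \<inter> I) \<inter> \<kappa> ` (cls e' \<inter> I) = {}"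
    proof (intro ballI impI, rule ccontr)
      fix e e' assume e: "e \<in> E4" "e' \<in> E4" "e \<noteq> e'" and "\<kappa> ` (cls e \<inter> I) \<inter> \<kappa> ` (cls e' \<inter> I) \<noteq> {}"
      then obtain v w where vw: "v \<in> cls e" "w \<in> cls e'" "\<kappa> v = \<kappa> w" by auto
      have "P v = P w" using Q_eq_if_\<kappa>_eq[OF vw(3)] fQ by metis
      then have "v \<in> cls e'" using P_eq_cls[OF E4_gint] e vw by metis
      then show False using cls_disjoint[OF e(1,2) vw(1)] e(3) by blast
    qed
  qed
  ultimately show ?thesis using card_ncrit[OF E4_gint] by simp
qed

text \<open>Two points of I differ by an element of L and all lie in one class modulo 2, so L consists of doubles of Gaussian integers.\<close>

lemma four_dvd_N:
  assumes e: "e \<in> E4" and I: "I \<noteq> {}" "I \<subseteq> cls e"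
  shows "4 dvd N"
proof -
  obtain c0 where c0: "c0 \<in> I" using I by blast
  have L2: "\<exists>c\<in>gint. l = 2 * c" if l: "l \<in> L" for l
  proof -
    have "c0 - l \<in> cls e" "c0 \<in> cls e" using I_L_diff[OF c0 l] c0 I(2) by blast+
    then obtain c c' where c: "c \<in> gint" "c' \<in> gint" "c0 - l = e + 2 * c" "c0 = e + 2 * c'" by (auto simp: cls_def)
    then have "l = 2 * (c' - c)" by (simp add: algebra_simps)
    then show ?thesis using gint_diff[OF c(2,1)] by blast
  qed
  \<comment> \<open>The doubles of Gaussian integers split into four translates of the multiples of
    4. Since 2L consists of such multiples, no class meets two translates, and all four contain
    equally many classes.\<close>
  define D where "D d = (\<lambda>v. 2 * v) ` cls d" for d
  have D_trans: "D d = (\<lambda>v. 2 * d + v) ` D 0" for d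
    unfolding D_def cls_translate[of d] by (auto simp: image_image algebra_simps)
  have D_sub: "D d \<subseteq> cls 0" if "d \<in> E4" for d
    unfolding D_def using cls_gint[OF E4_gint[OF that]] by (auto simp: cls_def)
  have D_un: "cls 0 = (\<Union>d\<in>E4. D d)"
  proof
    show "cls 0 \<subseteq> (\<Union>d\<in>E4. D d)"
    proof
      fix v assume "v \<in> cls 0"
      then obtain c where c: "c \<in> gint" "v = 2 * c" by (auto simp: cls_def)
      obtain d where "d \<in> E4" "c \<in> cls d" by (rule gint_in_cls[OF c(1)])
      then show "v \<in> (\<Union>d\<in>E4. D d)" using c(2) unfolding D_def by blast
    qed
  qed (use D_sub in blast)
  have "card (\<kappa> ` D d) = card (\<kappa> ` D 0)" for d
    unfolding D_trans[of d] by (rule card_\<kappa>_translate(1))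
  moreover have "N = (\<Sum>d\<in>E4. card (\<kappa> ` D d))"
    unfolding N_def D_un image_UN
  proof (rule card_UN_disjoint[OF finite_E4])
    show "\<forall>d\<in>E4. finite (\<kappa> ` D d)" by (rule ballI) (rule finite_\<kappa>_sub, rule D_sub)
    show "\<forall>d\<in>E4. \<forall>d'\<in>E4. d \<noteq> d' \<longrightarrow> \<kappa> ` D d \<inter> \<kappa> ` D d' = {}"
    proof (intro ballI impI, rule ccontr)
      fix d d' assume d: "d \<in> E4" "d' \<in> E4" "d \<noteq> d'" and "\<kappa> ` D d \<inter> \<kappa> ` D d' \<noteq> {}"
      then obtain v w where vw: "v \<in> cls d" "w \<in> cls d'" "\<kappa> (2 * v) = \<kappa> (2 * w)" unfolding D_def by auto
      obtain l where l: "l \<in> L" "2 * w = 2 * v + 2 * l" using vw(3) unfolding \<kappa>_eq_iff by blast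
      obtain c where c: "c \<in> gint" "l = 2 * c" using L2[OF l(1)] by blast
      have "w = 2 * w / 2" by simp
      also have "\<dots> = v + l" unfolding l(2) by (simp add: add_divide_distrib)
      finally have wv: "w = v + l" .
      obtain k where k: "k \<in> gint" "v = d + 2 * k" using vw(1) by (auto simp: cls_def)
      have "w = d + 2 * (k + c)" using wv k(2) c(2) by (simp add: algebra_simps)
      then have "w \<in> cls d" using gint_add[OF k(1) c(1)] unfolding cls_def by blast
      then show False using cls_disjoint[OF d(1,2) _ vw(2)] d(3) by blast
    qed
  qed
  ultimately have "N = (\<Sum>d\<in>E4. card (\<kappa> ` D 0))" by (metis (no_types, lifting) sum.cong)
  then have "N = 4 * card (\<kappa> ` D 0)" by (simp add: card_E4)
  then show ?thesis by simp
qed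

text \<open>N exceeds the number of non-critical points by d over a full corner and by d - 4 over
  the corner e. As there are at most 4 non-critical points altogether, N = d and all of them lie
  over e.\<close>

theorem exceptional_count:
  assumes e: "e \<in> E4" and full: "\<And>e'. e' \<in> E4 \<Longrightarrow> e' \<noteq> e \<Longrightarrow> 2 * card (crit e') = d"
    and def4: "2 * card (crit e) + 4 = d"
  shows "4 dvd d"
proof -
  have "\<not> E4 \<subseteq> {e}"
  proof
    assume "E4 \<subseteq> {e}"
    then have "card E4 \<le> 1" using card_mono[of "{e}" E4] by simp
    then show False by (simp add: card_E4)
  qed
  then obtain e1 where e1: "e1 \<in> E4" "e1 \<noteq> e" by blast
  \<comment> \<open>With I empty every corner would carry N critical points, but e carries two fewer
    than the full corners.\<close>
  have Ine: "I \<noteq> {}"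
  proof
    assume "I = {}"
    then have "card (crit e1) = N" "card (crit e) = N"
      by (auto intro!: card_crit_no_I E4_gint e e1)
    then show False using full[OF e1] def4 by linarith
  qed
  then obtain c0 where c0: "c0 \<in> I" by blast
  have cnt: "N = 2 * card (crit e') + card (ncrit e')" if "e' \<in> E4" for e'
    using card_crit[OF E4_gint[OF that] c0] .
  have "(\<Sum>e'\<in>E4. card (ncrit e')) \<le> 4" using card_\<kappa>_I(2) unfolding sum_card_ncrit .
  moreover have "(\<Sum>e'\<in>E4. card (ncrit e')) = card (ncrit e) + (\<Sum>e'\<in>E4 - {e}. card (ncrit e'))"
    by (rule sum.remove[OF finite_E4 e])
  moreover have ne: "card (ncrit e) = N - d + 4" "d \<le> N" using cnt[OF e] cnt[OF e1(1)] def4 full[OF e1] by linarith+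
  ultimately have zero: "N = d" "(\<Sum>e'\<in>E4 - {e}. card (ncrit e')) = 0" by linarith+
  have "I \<subseteq> cls e"
  proof
    fix c assume c: "c \<in> I"
    obtain e' where e': "e' \<in> E4" "c \<in> cls e'" by (rule gint_in_cls[OF I_gint[OF c]])
    have "e' = e"
    proof (rule ccontr)
      assume "e' \<noteq> e"
      then have "card (ncrit e') = 0" using zero(2) e'(1) by simp
      then have "card (\<kappa> ` (cls e' \<inter> I)) = 0" using card_ncrit[OF E4_gint[OF e'(1)]] by simp
      moreover have "finite (\<kappa> ` (cls e' \<inter> I))" by (rule finite_\<kappa>_sub) blast
      ultimately show False using e'(2) c by auto
    qed
    then show "c \<in> cls e" using e'(2) by simp
  qed
  then show ?thesis using four_dvd_N[OF e Ine] zero(1) by simp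
qed

end

section \<open>The standard pillowcase\<close>

definition pX :: "complex \<Rightarrow> real" where "pX z = cos (pi * Re z)"
definition pY :: "complex \<Rightarrow> real" where "pY z = cos (pi * Im z)"
definition pZ :: "complex \<Rightarrow> real" where "pZ z = sin (pi * Re z) * sin (pi * Im z)"
definition pR :: "complex \<Rightarrow> real" where "pR z = sqrt ((pX z)\<^sup>2 + (pZ z)\<^sup>2 + (pY z)\<^sup>2)"

text \<open>The surface \<open>Z\<^sup>2 = (1 - X\<^sup>2) (1 - Y\<^sup>2)\<close> with \<open>\<bar>X\<bar>, \<bar>Y\<bar> \<le> 1\<close> is a pillowcase; it is
  star-shaped about the origin, so radial projection identifies it with the sphere.  As Z is placed in
  coordinate 1, the reflection in that coordinate fixes the four corners.\<close>

definition P0 :: "complex \<Rightarrow> nat \<Rightarrow> real" where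
  "P0 z i = (if i = 0 then pX z / pR z else if i = 1 then pZ z / pR z else if i = 2 then pY z / pR z else 0)"

lemma pillow_eq: "(pZ z)\<^sup>2 = (1 - (pX z)\<^sup>2) * (1 - (pY z)\<^sup>2)"
  by (simp add: pX_def pY_def pZ_def power_mult_distrib sin_squared_eq)

lemma pX_le: "(pX z)\<^sup>2 \<le> 1" and pY_le: "(pY z)\<^sup>2 \<le> 1"
  by (simp_all add: pX_def pY_def abs_square_le_1)

lemma pR_pos: "0 < pR z"
proof -
  have "(pX z)\<^sup>2 + (pZ z)\<^sup>2 + (pY z)\<^sup>2 \<noteq> 0"
  proof
    assume *: "(pX z)\<^sup>2 + (pZ z)\<^sup>2 + (pY z)\<^sup>2 = 0"
    have "0 \<le> (pX z)\<^sup>2" "0 \<le> (pZ z)\<^sup>2" "0 \<le> (pY z)\<^sup>2" by simp_all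
    then have "(pX z)\<^sup>2 = 0" "(pZ z)\<^sup>2 = 0" "(pY z)\<^sup>2 = 0" using * by linarith+
    then show False using pillow_eq[of z] by simp
  qed
  then have "0 < (pX z)\<^sup>2 + (pZ z)\<^sup>2 + (pY z)\<^sup>2" by (simp add: less_le)
  then show ?thesis unfolding pR_def by simp
qed

lemma pR_sq: "(pR z)\<^sup>2 = (pX z)\<^sup>2 + (pZ z)\<^sup>2 + (pY z)\<^sup>2"
  unfolding pR_def by simp

lemma P0_in_S2: "P0 z \<in> S2"
proof -
  have "(P0 z 0)\<^sup>2 + (P0 z 1)\<^sup>2 + (P0 z 2)\<^sup>2 = ((pX z)\<^sup>2 + (pZ z)\<^sup>2 + (pY z)\<^sup>2) / (pR z)\<^sup>2"
    by (simp add: P0_def power_divide add_divide_distrib)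
  also have "\<dots> = 1" using pR_pos[of z] by (simp flip: pR_sq)
  finally show ?thesis unfolding S2_iff by (simp add: P0_def)
qed

lemma continuous_P0: "continuous_on UNIV P0"
proof (rule continuous_on_coordinatewise_then_product)
  have c: "continuous_on UNIV pX" "continuous_on UNIV pY" "continuous_on UNIV pZ"
    unfolding pX_def pY_def pZ_def by (intro continuous_intros)+
  then have cR: "continuous_on UNIV pR" unfolding pR_def by (intro continuous_intros)
  have nz: "\<forall>z\<in>UNIV. pR z \<noteq> 0" using pR_pos by (metis less_irrefl)
  fix i
  show "continuous_on UNIV (\<lambda>z. P0 z i)"
  proof -
    have q: "continuous_on UNIV (\<lambda>z. pX z / pR z)" "continuous_on UNIV (\<lambda>z. pY z / pR z)" "continuous_on UNIV (\<lambda>z. pZ z / pR z)"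
      by (rule continuous_on_divide[OF c(1) cR nz], rule continuous_on_divide[OF c(2) cR nz], rule continuous_on_divide[OF c(3) cR nz])
    show ?thesis unfolding P0_def
      by (cases "i = 0"; cases "i = 1"; cases "i = 2"; simp add: q)
  qed
qed

text \<open>A ray from the origin meets the surface only once: outwards the left side of the
  equation grows and the right side shrinks, as long as the coordinates stay in range. Equality
  forces Z = 0 and a coordinate of modulus 1, which has no room to grow.\<close>

lemma pillow_radial:
  fixes X Y Z t :: real
  assumes "Z\<^sup>2 = (1 - X\<^sup>2) * (1 - Y\<^sup>2)" "(t * Z)\<^sup>2 = (1 - (t * X)\<^sup>2) * (1 - (t * Y)\<^sup>2)"
    and "(t * X)\<^sup>2 \<le> 1" "(t * Y)\<^sup>2 \<le> 1" "1 \<le> t"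
  shows "t = 1"
proof (rule ccontr)
  assume "t \<noteq> 1"
  then have t: "1 < t\<^sup>2" using assms(5) by (simp add: one_less_power)
  have X: "X\<^sup>2 \<le> (t * X)\<^sup>2" and Y: "Y\<^sup>2 \<le> (t * Y)\<^sup>2"
    using t mult_right_mono[of 1 "t\<^sup>2" "X\<^sup>2"] mult_right_mono[of 1 "t\<^sup>2" "Y\<^sup>2"] by (simp_all add: power_mult_distrib)
  have "(t * Z)\<^sup>2 \<le> Z\<^sup>2"
    unfolding assms(1,2) by (rule mult_mono) (use X Y assms(3,4) in auto)
  then have "(t\<^sup>2 - 1) * Z\<^sup>2 \<le> 0" by (simp add: power_mult_distrib algebra_simps)
  moreover have "0 \<le> (t\<^sup>2 - 1) * Z\<^sup>2" using t by simp
  ultimately have "(t\<^sup>2 - 1) * Z\<^sup>2 = 0" by linarith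
  then have "Z\<^sup>2 = 0" using t by simp
  then have "X\<^sup>2 = 1 \<or> Y\<^sup>2 = 1" using assms(1) by auto
  then show False using assms(3,4) t by (auto simp: power_mult_distrib)
qed

lemma P0_eq_imp:
  assumes "P0 u = P0 v" shows "pX u = pX v" "pY u = pY v" "pZ u = pZ v"
proof -
  \<comment> \<open>By symmetry u may be the point with the smaller radius, so that the ratio t of
    the radii is at least 1.\<close>
  have main: "pX u = pX v \<and> pY u = pY v \<and> pZ u = pZ v" if eq: "P0 u = P0 v" and le: "pR u \<le> pR v" for u v
  proof -
    have c: "pX u / pR u = pX v / pR v" "pZ u / pR u = pZ v / pR v" "pY u / pR u = pY v / pR v"
      using fun_cong[OF eq, of 0] fun_cong[OF eq, of 1] fun_cong[OF eq, of 2] by (simp_all add: P0_def)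
    define t where "t = pR v / pR u"
    have t: "1 \<le> t" using le pR_pos[of u] by (simp add: t_def)
    have s: "pX v = t * pX u" "pZ v = t * pZ u" "pY v = t * pY u"
      using c pR_pos[of u] pR_pos[of v] by (simp_all add: t_def field_simps)
    have "t = 1"
      by (rule pillow_radial[OF pillow_eq[of u] _ _ _ t])
        (use pillow_eq[of v] pX_le[of v] pY_le[of v] s in auto)
    then show ?thesis using s by simp
  qed
  have "pX u = pX v \<and> pY u = pY v \<and> pZ u = pZ v"
    using main[OF assms] main[OF assms[symmetric]] linear[of "pR u" "pR v"] by metis
  then show "pX u = pX v" "pY u = pY v" "pZ u = pZ v" by auto
qed

lemma cos_pi_eq:
  assumes "cos (pi * x) = cos (pi * x')"
  obtains m :: int where "x' = x + 2 * of_int m \<or> x' = 2 * of_int m - x"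
proof -
  obtain n where n: "n \<in> \<int>" "pi * x' = pi * x + 2 * n * pi \<or> pi * x' = - (pi * x) + 2 * n * pi"
    using assms cos_eq[of "pi * x'" "pi * x"] by auto
  then obtain m :: int where m: "n = of_int m" by (auto elim: Ints_cases)
  have "pi * x' = pi * (x + 2 * of_int m) \<or> pi * x' = pi * (2 * of_int m - x)"
    using n(2) unfolding m by (auto simp: algebra_simps)
  then have "x' = x + 2 * of_int m \<or> x' = 2 * of_int m - x" by auto
  then show ?thesis by (rule that)
qed

lemma cos_sin_pi_shift:
  fixes m :: int
  shows "cos (pi * (x + 2 * of_int m)) = cos (pi * x)" "sin (pi * (x + 2 * of_int m)) = sin (pi * x)"
    "cos (pi * (2 * of_int m - x)) = cos (pi * x)" "sin (pi * (2 * of_int m - x)) = - sin (pi * x)"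
proof -
  have a: "pi * (x + 2 * of_int m) = pi * x + 2 * pi * of_int m" "pi * (2 * of_int m - x) = 2 * pi * of_int m - pi * x"
    by (simp_all add: algebra_simps)
  have z: "sin (2 * pi * of_int m) = 0" "cos (2 * pi * of_int m) = 1"
    by (simp_all add: sin_int_2pin cos_int_2pin)
  show "cos (pi * (x + 2 * of_int m)) = cos (pi * x)" "sin (pi * (x + 2 * of_int m)) = sin (pi * x)"
    "cos (pi * (2 * of_int m - x)) = cos (pi * x)" "sin (pi * (2 * of_int m - x)) = - sin (pi * x)"
    unfolding a cos_add sin_add cos_diff sin_diff z by simp_all
qed

lemma P0_cong: "pX u = pX v \<Longrightarrow> pY u = pY v \<Longrightarrow> pZ u = pZ v \<Longrightarrow> P0 u = P0 v"
  by (rule ext) (simp add: P0_def pR_def)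

lemma gint_Complex: "c \<in> gint \<longleftrightarrow> (\<exists>a b :: int. c = Complex (of_int a) (of_int b))"
  by (auto simp: gint_def complex_eq_iff elim!: Ints_cases)

text \<open>The cosines determine each coordinate up to sign and modulo 2, and \<open>pZ\<close>
  forbids changing just one sign unless a sine vanishes. In that case the coordinate is an integer,
  and changing its sign is the same as adding an even integer.\<close>

lemma P0_eq_iff: "P0 u = P0 v \<longleftrightarrow> (\<exists>c\<in>gint. v = u + 2 * c \<or> v = 2 * c - u)" (is "_ \<longleftrightarrow> ?R")
proof
  assume "P0 u = P0 v"
  note e = P0_eq_imp[OF this]
  obtain m :: int where m: "Re v = Re u + 2 * of_int m \<or> Re v = 2 * of_int m - Re u"
    using e(1) unfolding pX_def by (rule cos_pi_eq)
  obtain n :: int where n: "Im v = Im u + 2 * of_int n \<or> Im v = 2 * of_int n - Im u"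
    using e(2) unfolding pY_def by (rule cos_pi_eq)
  have shift: ?R if "Re v = Re u + 2 * of_int a" "Im v = Im u + 2 * of_int b" for a b :: int
    by (rule bexI[of _ "Complex (of_int a) (of_int b)"]) (use that in \<open>auto simp: complex_eq_iff gint_def\<close>)
  have flip: ?R if "Re v = 2 * of_int a - Re u" "Im v = 2 * of_int b - Im u" for a b :: int
    by (rule bexI[of _ "Complex (of_int a) (of_int b)"]) (use that in \<open>auto simp: complex_eq_iff gint_def\<close>)
  have sinz: "\<exists>k :: int. x = of_int k" if sx: "sin (pi * x) = 0" for x
  proof -
    obtain k :: int where "pi * x = of_int k * pi" using iffD1[OF sin_zero_iff_int2 sx] by blast
    then have "x = of_int k" by simp
    then show ?thesis by blast
  qed
  consider (pp) "Re v = Re u + 2 * of_int m" "Im v = Im u + 2 * of_int n"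
    | (mm) "Re v = 2 * of_int m - Re u" "Im v = 2 * of_int n - Im u"
    | (pm) "Re v = Re u + 2 * of_int m" "Im v = 2 * of_int n - Im u"
    | (mp) "Re v = 2 * of_int m - Re u" "Im v = Im u + 2 * of_int n"
    using m n by blast
  then show ?R
  proof cases
    case pp then show ?thesis by (rule shift)
  next
    case mm then show ?thesis by (rule flip)
  next
    case pm
    have "pZ v = - pZ u" unfolding pZ_def pm cos_sin_pi_shift by simp
    then have "sin (pi * Re u) = 0 \<or> sin (pi * Im u) = 0" using e(3) by (simp add: pZ_def)
    then consider k :: int where "Re u = of_int k" | k :: int where "Im u = of_int k" using sinz by blast
    then show ?thesis
    proof cases
      \<comment> \<open>As Re u = k is an integer, adding 2m to it is the same as subtracting it
        from 2(m + k).\<close>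
      case (1 k) show ?thesis by (rule flip[of "m + k" n]) (use pm 1 in auto)
    next
      case (2 k) show ?thesis by (rule shift[of m "n - k"]) (use pm 2 in auto)
    qed
  next
    case mp
    have "pZ v = - pZ u" unfolding pZ_def mp cos_sin_pi_shift by simp
    then have "sin (pi * Re u) = 0 \<or> sin (pi * Im u) = 0" using e(3) by (simp add: pZ_def)
    then consider k :: int where "Re u = of_int k" | k :: int where "Im u = of_int k" using sinz by blast
    then show ?thesis
    proof cases
      case (1 k) show ?thesis by (rule shift[of "m - k" n]) (use mp 1 in auto)
    next
      case (2 k) show ?thesis by (rule flip[of m "n + k"]) (use mp 2 in auto)
    qed
  qed
next
  assume "\<exists>c\<in>gint. v = u + 2 * c \<or> v = 2 * c - u"
  then obtain c where c: "c \<in> gint" "v = u + 2 * c \<or> v = 2 * c - u" by blast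
  obtain a b :: int where "c = Complex (of_int a) (of_int b)" using c(1) unfolding gint_Complex by blast
  with c(2) have "v = u + 2 * Complex (of_int a) (of_int b) \<or> v = 2 * Complex (of_int a) (of_int b) - u" by simp
  then show "P0 u = P0 v"
  proof
    assume v: "v = u + 2 * Complex (of_int a) (of_int b)"
    have r: "Re v = Re u + 2 * of_int a" "Im v = Im u + 2 * of_int b" by (simp_all add: v)
    show ?thesis by (rule P0_cong) (simp_all only: pX_def pY_def pZ_def r cos_sin_pi_shift)
  next
    assume v: "v = 2 * Complex (of_int a) (of_int b) - u"
    have r: "Re v = 2 * of_int a - Re u" "Im v = 2 * of_int b - Im u" by (simp_all add: v)
    show ?thesis by (rule P0_cong) (simp_all add: pX_def pY_def pZ_def r cos_sin_pi_shift)
  qed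
qed

text \<open>Intermediate value theorem in s = t^2: at s = 0 the right side of the equation is the
  larger one, and it vanishes at s = 1 / \<mu>, where a coordinate first reaches modulus 1.\<close>

lemma pillow_scale_exists:
  fixes a b c :: real
  assumes "a\<^sup>2 + c\<^sup>2 + b\<^sup>2 = 1"
  obtains t where "0 < t" "(t * c)\<^sup>2 = (1 - (t * a)\<^sup>2) * (1 - (t * b)\<^sup>2)" "(t * a)\<^sup>2 \<le> 1" "(t * b)\<^sup>2 \<le> 1"
proof -
  define \<mu> where "\<mu> = max (a\<^sup>2) (b\<^sup>2)"
  have "\<exists>s>0. c\<^sup>2 * s = (1 - s * a\<^sup>2) * (1 - s * b\<^sup>2) \<and> s * a\<^sup>2 \<le> 1 \<and> s * b\<^sup>2 \<le> 1"
  proof (cases "\<mu> = 0")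
    case True
    then have "a\<^sup>2 \<le> 0" "b\<^sup>2 \<le> 0" unfolding \<mu>_def by (metis max.cobounded1, metis max.cobounded2)
    then have "a = 0" "b = 0" by auto
    then show ?thesis using assms by (intro exI[of _ 1]) auto
  next
    case False
    have \<mu>: "0 < \<mu>" "a\<^sup>2 \<le> \<mu>" "b\<^sup>2 \<le> \<mu>" using False by (auto simp: \<mu>_def max_def split: if_splits)
    define g where "g s = c\<^sup>2 * s - (1 - s * a\<^sup>2) * (1 - s * b\<^sup>2)" for s
    have "\<mu> = a\<^sup>2 \<or> \<mu> = b\<^sup>2" by (auto simp: \<mu>_def max_def)
    then have "g (1 / \<mu>) = c\<^sup>2 / \<mu>" using \<mu>(1) by (auto simp: g_def)
    then have "0 \<le> g (1 / \<mu>)" using \<mu>(1) by simp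
    moreover have "g 0 \<le> 0" by (simp add: g_def)
    moreover have "continuous_on {0..1 / \<mu>} g" unfolding g_def by (intro continuous_intros)
    ultimately obtain s where s: "0 \<le> s" "s \<le> 1 / \<mu>" "g s = 0"
      using IVT'[of g 0 0 "1 / \<mu>"] \<mu>(1) by auto
    have "s \<noteq> 0" using s(3) by (auto simp: g_def)
    have sm: "s * \<mu> \<le> 1" using s(2) \<mu>(1) by (simp add: field_simps)
    have "s * a\<^sup>2 \<le> 1" "s * b\<^sup>2 \<le> 1"
      using mult_left_mono[OF \<mu>(2) s(1)] mult_left_mono[OF \<mu>(3) s(1)] sm by linarith+
    then show ?thesis using s \<open>s \<noteq> 0\<close> by (intro exI[of _ s]) (auto simp: g_def)
  qed
  then obtain s where s: "0 < s" "c\<^sup>2 * s = (1 - s * a\<^sup>2) * (1 - s * b\<^sup>2)" "s * a\<^sup>2 \<le> 1" "s * b\<^sup>2 \<le> 1" by blast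
  show ?thesis
    by (rule that[of "sqrt s"]) (use s in \<open>simp_all add: power_mult_distrib mult.commute\<close>)
qed

lemma range_P0: "range P0 = S2"
proof
  show "range P0 \<subseteq> S2" using P0_in_S2 by blast
  show "S2 \<subseteq> range P0"
  proof
    fix p assume p: "p \<in> S2"
    obtain t where t: "0 < t" "(t * p 1)\<^sup>2 = (1 - (t * p 0)\<^sup>2) * (1 - (t * p 2)\<^sup>2)" "(t * p 0)\<^sup>2 \<le> 1" "(t * p 2)\<^sup>2 \<le> 1"
      by (rule pillow_scale_exists[of "p 0" "p 1" "p 2"]) (use p in \<open>auto simp: S2_iff\<close>)
    have b: "- 1 \<le> t * p 0" "t * p 0 \<le> 1" "- 1 \<le> t * p 2" "t * p 2 \<le> 1"
      using t(3,4) by (auto simp: abs_square_le_1 abs_le_iff)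
    \<comment> \<open>The cosine ignores the sign of the imaginary part, so this sign is free to
      encode the sign of \<open>p 1\<close>.\<close>
    define s where "s = (if 0 \<le> p 1 then 1 else - 1 :: real)"
    define z where "z = Complex (arccos (t * p 0) / pi) (s * arccos (t * p 2) / pi)"
    have X: "pX z = t * p 0" using b by (simp add: pX_def z_def)
    have Y: "pY z = t * p 2" using b by (auto simp: pY_def z_def s_def)
    have "pZ z = sqrt (1 - (t * p 0)\<^sup>2) * (s * sqrt (1 - (t * p 2)\<^sup>2))"
      using b by (auto simp: pZ_def z_def s_def sin_arccos)
    also have "\<dots> = s * sqrt ((t * p 1)\<^sup>2)" unfolding t(2) real_sqrt_mult by simp
    also have "\<dots> = t * p 1" using t(1) by (auto simp: s_def abs_mult)
    finally have Z: "pZ z = t * p 1" .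
    have "(pR z)\<^sup>2 = t\<^sup>2 * ((p 0)\<^sup>2 + (p 1)\<^sup>2 + (p 2)\<^sup>2)"
      unfolding pR_sq X Y Z by (simp add: power_mult_distrib algebra_simps)
    then have "(pR z)\<^sup>2 = t\<^sup>2" using p by (simp add: S2_iff)
    then have R: "pR z = t" using pR_pos[of z] t(1) by (simp add: power2_eq_iff_nonneg)
    have "P0 z = p"
    proof
      fix i :: nat
      consider "i = 0" | "i = 1" | "i = 2" | "2 < i" by linarith
      then show "P0 z i = p i"
        using p t(1) by cases (auto simp: P0_def X Y Z R S2_iff)
    qed
    then show "p \<in> range P0" by blast
  qed
qed

text \<open>T is the saturation of D under the group. As the square \<open>?K\<close> meets every
  orbit, the complement of the image of D is the image of the compact set
  \<open>?K - T\<close>.\<close>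

lemma openin_P0_image:
  assumes D: "open D" shows "openin (top_of_set S2) (P0 ` D)"
proof -
  define T where "T = (\<Union>c\<in>gint. (\<lambda>z. z + 2 * c) -` D \<union> (\<lambda>z. 2 * c - z) -` D)"
  have "open T"
    unfolding T_def by (intro open_UN ballI open_Un open_vimage[OF D] continuous_intros)
  have T_iff: "z \<in> T \<longleftrightarrow> P0 z \<in> P0 ` D" for z
  proof
    assume "z \<in> T"
    then obtain c where c: "c \<in> gint" "z + 2 * c \<in> D \<or> 2 * c - z \<in> D" unfolding T_def by blast
    have "P0 z = P0 (z + 2 * c)" "P0 z = P0 (2 * c - z)" using P0_eq_iff c(1) by blast+
    then show "P0 z \<in> P0 ` D" using c(2) by (metis imageI)
  next
    assume "P0 z \<in> P0 ` D"
    then obtain w where w: "w \<in> D" "P0 z = P0 w" by blast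
    obtain c where c: "c \<in> gint" "w = z + 2 * c \<or> w = 2 * c - z" using iffD1[OF P0_eq_iff w(2)] by blast
    then show "z \<in> T" using w(1) unfolding T_def by auto
  qed
  let ?K = "cbox 0 (Complex 2 2)"
  have "compact (?K - T)" using \<open>open T\<close> compact_diff[OF compact_cbox] by blast
  then have "compact (P0 ` (?K - T))"
    by (rule compact_continuous_image[OF continuous_on_subset[OF continuous_P0 subset_UNIV]])
  then have "closed (P0 ` (?K - T))" by (rule compact_imp_closed)
  moreover have "P0 ` D = S2 \<inter> (- P0 ` (?K - T))"
  proof
    show "P0 ` D \<subseteq> S2 \<inter> (- P0 ` (?K - T))"
    proof
      fix x assume x: "x \<in> P0 ` D"
      have "x \<notin> P0 ` (?K - T)"
      proof
        assume "x \<in> P0 ` (?K - T)"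
        then obtain z where "z \<notin> T" "x = P0 z" by blast
        then show False using x T_iff by blast
      qed
      then show "x \<in> S2 \<inter> (- P0 ` (?K - T))" using x P0_in_S2 by blast
    qed
    show "S2 \<inter> (- P0 ` (?K - T)) \<subseteq> P0 ` D"
    proof
      fix x assume x: "x \<in> S2 \<inter> (- P0 ` (?K - T))"
      then have "x \<in> range P0" using range_P0 by blast
      then obtain u where u: "x = P0 u" by blast
      define c where "c = Complex (of_int (- \<lfloor>Re u / 2\<rfloor>)) (of_int (- \<lfloor>Im u / 2\<rfloor>))"
      have "c \<in> gint" by (simp add: c_def gint_def)
      then have Pc: "P0 u = P0 (u + 2 * c)" using P0_eq_iff by blast
      have "u + 2 * c \<in> ?K"
        unfolding c_def in_cbox_complex_iff by (simp; linarith)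
      then have "u + 2 * c \<in> T" using x u Pc by auto
      then show "x \<in> P0 ` D" using T_iff u Pc by simp
    qed
  qed
  ultimately show ?thesis by (simp add: openin_open_Int open_Compl)
qed

interpretation P0: pillow P0
  by (unfold_locales, rule continuous_P0, rule range_P0, erule openin_P0_image, rule P0_eq_iff)

lemma pillow_homeomorphic_image:
  assumes "homeomorphism S2 S2 k k'" shows "pillow (k \<circ> P0)"
proof
  show "continuous_on UNIV (k \<circ> P0)"
    by (rule continuous_on_compose[OF continuous_P0]) (use homeomorphism_cont1[OF assms] range_P0 in simp)
  show "range (k \<circ> P0) = S2"
    using homeomorphism_image1[OF assms] range_P0 by (metis image_comp)
  show "openin (top_of_set S2) ((k \<circ> P0) ` D)" if "open D" for D
    using homeomorphism_imp_open_map[OF assms openin_P0_image[OF that]] by (simp add: image_comp)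
  show "(k \<circ> P0) u = (k \<circ> P0) v \<longleftrightarrow> (\<exists>c\<in>gint. v = u + 2 * c \<or> v = 2 * c - u)" for u v
    using homeomorphism_apply1[OF assms P0_in_S2] P0_eq_iff by (metis o_apply)
qed

section \<open>NET maps with three full critical values\<close>

lemma infinite_S2: "infinite S2"
proof
  assume "finite S2"
  obtain p where p: "p \<in> S2" using range_P0 by blast
  then obtain \<sigma> \<sigma>' where "homeomorphism (S2 - {p}) (UNIV :: complex set) \<sigma> \<sigma>'"
    using homeomorphic_punctured_S2 unfolding homeomorphic_def by blast
  then have "(UNIV :: complex set) = \<sigma> ` (S2 - {p})" using homeomorphism_image1 by blast
  then show False using \<open>finite S2\<close> infinite_UNIV_char_0[where ?'a = complex] by (metis finite_Diff finite_imageI)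
qed

text \<open>Outside a compact set f is the identity, so the extension is the identity near the added
  point p.\<close>

lemma S2_extend_homeomorphism:
  fixes \<sigma> :: "(nat \<Rightarrow> real) \<Rightarrow> complex"
  assumes \<sigma>: "homeomorphism (S2 - {p}) UNIV \<sigma> \<sigma>'" and p: "p \<in> S2"
    and f: "continuous_on UNIV f" and bd: "bounded {x. f x \<noteq> x}"
  shows "continuous_on S2 (\<lambda>q. if q = p then p else \<sigma>' (f (\<sigma> q)))"
proof -
  let ?h = "\<lambda>q. if q = p then p else \<sigma>' (f (\<sigma> q))"
  obtain B where "\<forall>x\<in>{x. f x \<noteq> x}. norm x \<le> B" using bd unfolding bounded_iff by blast
  then have B: "{x. f x \<noteq> x} \<subseteq> cball 0 B" by auto
  let ?T = "\<sigma>' ` cball 0 B"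
  have c1: "continuous_on (S2 - {p}) \<sigma>" and c2: "continuous_on UNIV \<sigma>'"
    by (rule homeomorphism_cont1[OF \<sigma>], rule homeomorphism_cont2[OF \<sigma>])
  have "compact ?T" by (rule compact_continuous_image[OF continuous_on_subset[OF c2 subset_UNIV] compact_cball])
  then have "closed ?T" by (rule compact_imp_closed)
  have pT: "p \<notin> ?T" using homeomorphism_image2[OF \<sigma>] by blast
  have U: "S2 = (S2 - {p}) \<union> (S2 - ?T)" using pT p by blast
  have o1: "openin (top_of_set S2) (S2 - {p})" by (simp add: openin_delete)
  have o2: "openin (top_of_set S2) (S2 - ?T)"
    using openin_open_Int[of "- ?T" S2] \<open>closed ?T\<close> by (simp add: Diff_eq open_Compl)
  have h1: "continuous_on (S2 - {p}) ?h"
  proof -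
    have "continuous_on (S2 - {p}) (\<lambda>q. f (\<sigma> q))" by (rule continuous_on_compose2[OF f c1]) simp
    then have "continuous_on (S2 - {p}) (\<lambda>q. \<sigma>' (f (\<sigma> q)))" by (rule continuous_on_compose2[OF c2]) simp
    then show ?thesis by (rule continuous_on_eq) simp
  qed
  have h2: "continuous_on (S2 - ?T) ?h"
  proof (rule continuous_on_eq[OF continuous_on_id])
    fix q assume q: "q \<in> S2 - ?T"
    show "q = ?h q"
    proof (cases "q = p")
      case False
      then have inv: "\<sigma>' (\<sigma> q) = q" using homeomorphism_apply1[OF \<sigma>] q by blast
      then have "\<sigma> q \<notin> cball 0 B" using q by (metis DiffD2 imageI)
      then have "f (\<sigma> q) = \<sigma> q" using B by blast
      then show ?thesis using False inv by simp
    qed simp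
  qed
  have "continuous_on ((S2 - {p}) \<union> (S2 - ?T)) ?h"
    by (rule continuous_on_Un_local_open[OF _ _ h1 h2]) (use o1 o2 U in metis)+
  then show ?thesis using U by metis
qed

text \<open>Removing an auxiliary point reduces the problem to the plane, where points can be moved
  by a homeomorphism of bounded support; such a homeomorphism extends over the removed
  point.\<close>

theorem S2_moving_points:
  assumes K: "finite K" and x: "inj_on x K" "x ` K \<subseteq> S2" and y: "inj_on y K" "y ` K \<subseteq> S2"
  obtains h h' where "homeomorphism S2 S2 h h'" "\<And>i. i \<in> K \<Longrightarrow> h (x i) = y i"
proof -
  have "infinite (S2 - (x ` K \<union> y ` K))" using infinite_S2 K by simp
  then obtain p where p: "p \<in> S2" "p \<notin> x ` K" "p \<notin> y ` K" by (metis DiffE UnCI finite.emptyI ex_in_conv)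
  obtain \<sigma> \<sigma>' where \<sigma>: "homeomorphism (S2 - {p}) (UNIV :: complex set) \<sigma> \<sigma>'"
    using homeomorphic_punctured_S2[OF p(1)] unfolding homeomorphic_def by blast
  have inj: "inj_on \<sigma> (S2 - {p})" by (rule inj_on_inverseI, rule homeomorphism_apply1[OF \<sigma>])
  have sub: "x i \<in> S2 - {p}" "y i \<in> S2 - {p}" if "i \<in> K" for i using that x(2) y(2) p by auto
  have pw: "pairwise (\<lambda>i j. \<sigma> (x i) \<noteq> \<sigma> (x j) \<and> \<sigma> (y i) \<noteq> \<sigma> (y j)) K"
    unfolding pairwise_def
  proof (intro ballI impI conjI notI)
    fix i j assume ij: "i \<in> K" "j \<in> K" "i \<noteq> j"
    { assume "\<sigma> (x i) = \<sigma> (x j)"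
      then have "x i = x j" using inj sub ij by (meson inj_onD)
      then show False using x(1) ij by (meson inj_onD) }
    { assume "\<sigma> (y i) = \<sigma> (y j)"
      then have "y i = y j" using inj sub ij by (meson inj_onD)
      then show False using y(1) ij by (meson inj_onD) }
  qed
  obtain f g where fg: "homeomorphism UNIV UNIV f g" "\<And>i. i \<in> K \<Longrightarrow> f (\<sigma> (x i)) = \<sigma> (y i)"
    "{x. \<not> (f x = x \<and> g x = x)} \<subseteq> UNIV" "bounded {x. \<not> (f x = x \<and> g x = x)}"
    by (rule homeomorphism_moving_points_exists[of "UNIV :: complex set" UNIV K "\<lambda>i. \<sigma> (x i)" "\<lambda>i. \<sigma> (y i)"])
      (use K pw in auto)
  define h where "h q = (if q = p then p else \<sigma>' (f (\<sigma> q)))" for q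
  define h' where "h' q = (if q = p then p else \<sigma>' (g (\<sigma> q)))" for q
  have bf: "bounded {x. f x \<noteq> x}" "bounded {x. g x \<noteq> x}"
    by (rule bounded_subset[OF fg(4)]; blast)+
  have ch: "continuous_on S2 h"
    unfolding h_def by (rule S2_extend_homeomorphism[OF \<sigma> p(1) homeomorphism_cont1[OF fg(1)] bf(1)])
  have ch': "continuous_on S2 h'"
    unfolding h'_def by (rule S2_extend_homeomorphism[OF \<sigma> p(1) homeomorphism_cont2[OF fg(1)] bf(2)])
  have s': "\<sigma>' z \<in> S2 - {p}" "\<sigma> (\<sigma>' z) = z" for z
    using homeomorphism_image2[OF \<sigma>] homeomorphism_apply2[OF \<sigma>] by blast+
  have ss: "\<sigma>' (\<sigma> q) = q" if "q \<in> S2 - {p}" for q using homeomorphism_apply1[OF \<sigma> that] .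
  have gf: "g (f z) = z" "f (g z) = z" for z
    using homeomorphism_apply1[OF fg(1)] homeomorphism_apply2[OF fg(1)] by simp_all
  have into: "h q \<in> S2" "h' q \<in> S2" if "q \<in> S2" for q
    unfolding h_def h'_def using s'(1) p(1) by auto
  have inv: "h' (h q) = q" "h (h' q) = q" if "q \<in> S2" for q
    using s' ss that gf unfolding h_def h'_def by auto
  have "homeomorphism S2 S2 h h'"
    by (rule homeomorphismI[OF ch ch']) (use into inv in auto)
  moreover have "h (x i) = y i" if "i \<in> K" for i
    using sub[OF that] fg(2)[OF that] ss unfolding h_def by auto
  ultimately show ?thesis using that by blast
qed

lemma continuous_map_S2_iff:
  "continuous_map (nsphere 2) (nsphere 2) f \<longleftrightarrow> continuous_on S2 f \<and> f ` S2 \<subseteq> S2"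
proof -
  have "continuous_map (top_of_set S2) (top_of_set S2) f \<longleftrightarrow> continuous_on S2 f \<and> f ` S2 \<subseteq> S2"
    by (auto simp: continuous_map_in_subtopology)
  then show ?thesis unfolding top_of_set_S2 .
qed

lemma P_gint_E4:
  assumes "pillow P" shows "P ` gint = P ` E4"
proof
  interpret pillow P by (rule assms)
  show "P ` gint \<subseteq> P ` E4"
  proof
    fix y assume "y \<in> P ` gint"
    then obtain v where v: "v \<in> gint" "y = P v" by blast
    obtain e where e: "e \<in> E4" "v \<in> cls e" by (rule gint_in_cls[OF v(1)])
    then have "P v = P e" using P_eq_cls[OF E4_gint] by blast
    then show "y \<in> P ` E4" using v e by simp
  qed
qed (use E4_gint in blast)

lemma inj_on_E4:
  assumes "pillow P" shows "inj_on P E4"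
proof (rule inj_onI)
  interpret pillow P by (rule assms)
  fix a b assume ab: "a \<in> E4" "b \<in> E4" "P a = P b"
  then have "a \<in> cls b" using P_eq_cls[OF E4_gint[OF ab(2)]] by blast
  moreover have "a \<in> cls a" unfolding cls_def by (rule CollectI, rule bexI[of _ 0]) auto
  ultimately show "a = b" using cls_disjoint ab by blast
qed

theorem NET_map_full_fibres:
  assumes net: "NET_map f" and y4: "y4 \<in> postcritical_set f"
    and full: "\<And>y. y \<in> postcritical_set f \<Longrightarrow> y \<noteq> y4 \<Longrightarrow> 2 * card {x \<in> critical_points f. f x = y} = d"
    and def4: "2 * card {x \<in> critical_points f. f x = y4} + 4 = d"
  shows "4 dvd d"
proof -
  have bc: "branched_covering f" and crit2: "\<And>x. x \<in> critical_points f \<Longrightarrow> local_degree f x = 2"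
    and card4: "card (postcritical_set f) = 4"
    using net by (auto simp: NET_map_def Thurston_map_def)
  have contf: "continuous_on S2 f" and fS: "f ` S2 \<subseteq> S2"
    using bc continuous_map_S2_iff by (auto simp: branched_covering_def)
  have ld: "\<exists>d. has_local_degree f x d" if "x \<in> S2" for x using bc that by (auto simp: branched_covering_def)
  have deg12: "has_local_degree f x 1 \<or> has_local_degree f x 2" if x: "x \<in> S2" for x
  proof -
    obtain d where d: "has_local_degree f x d" using ld[OF x] by blast
    have "1 \<le> d" using d by (simp add: has_local_degree_def)
    show ?thesis
    proof (cases "d = 1")
      case False
      then have "x \<in> critical_points f" using local_degree_eq[OF d] x \<open>1 \<le> d\<close> by (simp add: critical_points_def)
      then have "d = 2" using crit2 local_degree_eq[OF d] by simp
      then show ?thesis using d by simp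
    qed (use d in simp)
  qed
  have crit_iff: "x \<in> critical_points f \<longleftrightarrow> x \<in> S2 \<and> has_local_degree f x 2" for x
  proof
    assume "x \<in> S2 \<and> has_local_degree f x 2"
    then show "x \<in> critical_points f" using local_degree_eq[of f x 2] by (simp add: critical_points_def)
  next
    assume c: "x \<in> critical_points f"
    then have "x \<in> S2" by (simp add: critical_points_def)
    moreover have "\<not> has_local_degree f x 1" using crit2[OF c] local_degree_eq[of f x 1] by auto
    ultimately show "x \<in> S2 \<and> has_local_degree f x 2" using deg12 by blast
  qed
  have cv: "f x \<in> postcritical_set f" if "x \<in> critical_points f" for x
    unfolding postcritical_set_def by (rule UN_I[of 1]) (use that in auto)
  have postS: "postcritical_set f \<subseteq> S2"
  proof -
    have "(f ^^ k) ` S2 \<subseteq> S2" for k by (induction k) (use fS in auto)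
    moreover have "critical_points f \<subseteq> S2" by (auto simp: critical_points_def)
    ultimately show ?thesis unfolding postcritical_set_def by blast
  qed
  have finp: "finite (postcritical_set f)" using card4 card_ge_0_finite by force
  \<comment> \<open>Any bijection of the corners with the postcritical points will do, since
    \<open>S2_moving_points\<close> realizes it by a homeomorphism.\<close>
  then obtain y where y: "bij_betw y E4 (postcritical_set f)"
    using finite_same_card_bij[OF finite_E4] card_E4 card4 by metis
  (* The reflection fixes the corners, so it can be used to make the degree positive. *)
  obtain k k' where k: "homeomorphism S2 S2 k k'" "\<And>e. e \<in> E4 \<Longrightarrow> k (P0 e) = y e"
  proof (rule S2_moving_points[OF finite_E4, of P0 y])
    show "inj_on P0 E4" by (rule inj_on_E4) (rule P0.pillow_axioms)
    show "P0 ` E4 \<subseteq> S2" using P0_in_S2 by blast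
    show "inj_on y E4" "y ` E4 \<subseteq> S2" using y postS by (auto simp: bij_betw_def)
  qed blast
  define P where "P = k \<circ> P0"
  interpret pillow P unfolding P_def by (rule pillow_homeomorphic_image[OF k(1)])
  have Py: "P e = y e" if "e \<in> E4" for e using k(2)[OF that] by (simp add: P_def)
  have PG: "P ` gint = postcritical_set f"
    using P_gint_E4[OF pillow_axioms] Py y by (simp add: bij_betw_def)
  interpret pillow_lift P f
  proof
    show "continuous_on S2 f" by (rule contf)
    show "f x \<in> S2" if "x \<in> S2" for x using fS that by blast
    show "has_local_degree f x 1 \<or> has_local_degree f x 2" if "x \<in> S2" for x by (rule deg12[OF that])
    \<comment> \<open>Critical values are postcritical, and the corners are exactly the postcritical
      points.\<close>
    show "has_local_degree f x 1" if "x \<in> S2" "f x \<notin> P ` gint" for x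
      using deg12[OF that(1)] cv[of x] crit_iff[of x] that PG by blast
  qed
  \<comment> \<open>A base point away from the finitely many points over the corners supplies a
    generic u0 at which the lift can start.\<close>
  have "finite {x \<in> S2. f x \<in> postcritical_set f}"
  proof -
    have "{x \<in> S2. f x \<in> postcritical_set f} = (\<Union>y\<in>postcritical_set f. {x \<in> S2. f x = y})" by blast
    then show ?thesis using finp finite_fibre postS by (auto intro!: finite_UN_I)
  qed
  then have "infinite (S2 - {x \<in> S2. f x \<in> postcritical_set f})" using infinite_S2 by simp
  then obtain x0 where x0: "x0 \<in> S2" "f x0 \<notin> postcritical_set f"
    by (metis (no_types, lifting) DiffE ex_in_conv finite.emptyI mem_Collect_eq)
  then have "f x0 \<in> range P" using f_in rangeP by blast
  then obtain u0 where u0: "f x0 = P u0" by blast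
  have "u0 \<notin> gint" using x0(2) u0 PG by auto
  then obtain Q where Q: "lift UNIV Q" using global_lift[OF _ x0(1) u0] by blast
  interpret pillow_cover P f Q by unfold_locales (rule Q)
  have crit_set: "crit e = {x \<in> critical_points f. f x = P e}" for e
    using crit_iff by (auto simp: crit_def)
  have "y4 \<in> y ` E4" using y4 y by (simp add: bij_betw_def)
  then obtain e where e: "e \<in> E4" "P e = y4" using Py by (metis imageE)
  show ?thesis
  proof (rule exceptional_count[OF e(1)])
    fix e' assume e': "e' \<in> E4" "e' \<noteq> e"
    have "P e' \<noteq> y4" using e e' inj_on_E4[OF pillow_axioms] by (auto dest: inj_onD)
    moreover have "P e' \<in> postcritical_set f" using PG E4_gint[OF e'(1)] by blast
    ultimately show "2 * card (crit e') = d" unfolding crit_set by (intro full)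
  next
    show "2 * card (crit e) + 4 = d" unfolding crit_set e(2) by (rule def4)
  qed
qed

section \<open>Diagonal Lattes maps\<close>

lemma power_surj_ball:
  assumes e: "e = 1 \<or> e = 2" and r: "0 < r"
  shows "(\<lambda>z::complex. (z / of_real r) ^ e) ` ball 0 r = ball 0 1"
proof
  show "(\<lambda>z::complex. (z / of_real r) ^ e) ` ball 0 r \<subseteq> ball 0 1"
  proof
    fix y :: complex assume "y \<in> (\<lambda>z::complex. (z / of_real r) ^ e) ` ball 0 r"
    then obtain z :: complex where z: "norm z < r" "y = (z / of_real r) ^ e" by auto
    have "norm (z / of_real r) < 1" using z(1) r by (simp add: norm_divide)
    then have "norm ((z / of_real r) ^ e) < 1"
      using e by (auto simp: norm_power abs_square_less_1)
    then show "y \<in> ball 0 1" using z(2) by simp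
  qed
  show "ball 0 1 \<subseteq> (\<lambda>z::complex. (z / of_real r) ^ e) ` ball 0 r"
  proof
    fix y :: complex assume y: "y \<in> ball 0 1"
    define w where "w = (if e = 1 then y else csqrt y)"
    have w: "w ^ e = y" using e by (auto simp: w_def)
    have "norm w < 1"
      using y e real_sqrt_lt_1_iff[of "cmod y"] by (auto simp: w_def norm_csqrt)
    then have "norm (w * of_real r) < r" using r by (simp add: norm_mult)
    then show "y \<in> (\<lambda>z::complex. (z / of_real r) ^ e) ` ball 0 r"
      using w r by (intro image_eqI[of _ _ "w * of_real r"]) auto
  qed
qed

lemma open_power_image:
  assumes e: "e = 1 \<or> e = 2" and r: "0 < r" and D: "open D"
  shows "open ((\<lambda>z::complex. (z / of_real r) ^ e) ` D)"
proof -
  define q where "q = (\<lambda>z::complex. (z / of_real r) ^ e)"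
  have hq: "q holomorphic_on UNIV" unfolding q_def using r by (intro holomorphic_intros) simp
  have q01: "q 0 = 0" "q (of_real r) = 1" unfolding q_def using e r by auto
  have nc: "\<not> q constant_on UNIV"
  proof
    assume "q constant_on UNIV"
    then obtain y where "\<forall>x\<in>UNIV. q x = y" unfolding constant_on_def by blast
    then have "q 0 = q (of_real r)" by (metis UNIV_I)
    then show False using q01 by simp
  qed
  have "open (q ` D)"
    using open_mapping_thm[OF hq open_UNIV connected_UNIV D subset_UNIV nc] .
  then show ?thesis unfolding q_def .
qed

text \<open>On the disc, g and the e-th power identify the same points, so the rescaled power
  descends to an injective open map on the image of g.\<close>

lemma power_chart_exists:
  fixes g :: "complex \<Rightarrow> (nat \<Rightarrow> real)"
  assumes e: "e = 1 \<or> e = 2" and r: "0 < r"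
    and g: "continuous_on UNIV g"
    and op: "\<And>D. open D \<Longrightarrow> openin (top_of_set S2) (g ` D)"
    and ker: "\<And>z w. norm z < r \<Longrightarrow> norm w < r \<Longrightarrow> g z = g w \<longleftrightarrow> z ^ e = w ^ e"
  obtains \<phi> \<phi>' where "homeomorphism (g ` ball 0 r) (ball 0 1) \<phi> \<phi>'"
    "\<And>z. norm z < r \<Longrightarrow> \<phi> (g z) = (z / of_real r) ^ e"
proof -
  let ?q = "\<lambda>z::complex. (z / of_real r) ^ e" and ?U = "g ` ball 0 r"
  \<comment> \<open>By \<open>ker\<close> all preimages of x have the same e-th power, so the value
    does not depend on the choice.\<close>
  define \<phi> where "\<phi> x = ?q (SOME z. norm z < r \<and> g z = x)" for x
  have \<phi>: "\<phi> (g z) = ?q z" if z: "norm z < r" for z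
  proof -
    have "\<exists>z'. norm z' < r \<and> g z' = g z" using z by blast
    from someI_ex[OF this] have "(SOME z'. norm z' < r \<and> g z' = g z) ^ e = z ^ e" using ker z by blast
    then show ?thesis unfolding \<phi>_def by (simp add: power_divide)
  qed
  have cq: "continuous_on UNIV ?q" using r by (intro continuous_intros) simp
  have im: "\<phi> ` ?U = ball 0 1"
  proof -
    have "\<phi> ` ?U = ?q ` ball 0 r" unfolding image_image by (rule image_cong) (use \<phi> in auto)
    then show ?thesis using power_surj_ball[OF e r] by simp
  qed
  have inj: "inj_on \<phi> ?U"
  proof (rule inj_onI)
    fix x y assume "x \<in> ?U" "y \<in> ?U" and eq: "\<phi> x = \<phi> y"
    then obtain z w where z: "norm z < r" "x = g z" and w: "norm w < r" "y = g w" by auto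
    have "z ^ e = w ^ e" using eq r unfolding z w \<phi>[OF z(1)] \<phi>[OF w(1)] by (simp add: power_divide)
    then show "x = y" using ker z w by simp
  qed
  have opU: "openin (top_of_set ?U) (g ` D)" if "open D" "D \<subseteq> ball 0 r" for D
  proof (rule openin_subset_trans[OF op[OF that(1)]])
    show "g ` D \<subseteq> g ` ball 0 r" using that(2) by blast
    show "g ` ball 0 r \<subseteq> S2" using openin_imp_subset[OF op[OF open_ball]] .
  qed
  have cont: "continuous_on ?U \<phi>"
    unfolding continuous_on_open
  proof (intro allI impI)
    fix V assume V: "openin (top_of_set (\<phi> ` ?U)) V"
    then have oV: "open V" using im openin_open_eq[of "ball 0 1"] by auto
    let ?D = "ball 0 r \<inter> ?q -` V"
    have "open ?D" by (intro open_Int open_ball open_vimage oV cq)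
    moreover have "?U \<inter> \<phi> -` V = g ` ?D" using \<phi> by auto
    ultimately show "openin (top_of_set ?U) (?U \<inter> \<phi> -` V)" using opU[of ?D] by simp
  qed
  have om: "openin (top_of_set (ball 0 1)) (\<phi> ` W)" if W: "openin (top_of_set ?U) W" for W
  proof -
    let ?D = "ball 0 r \<inter> g -` W"
    have WU: "W \<subseteq> ?U" using W openin_imp_subset by blast
    have "open ?D"
    proof -
      obtain T where T: "open T" "W = ?U \<inter> T" using W unfolding openin_open by blast
      have "?D = ball 0 r \<inter> g -` T" using T(2) by auto
      then show ?thesis using open_vimage[OF T(1) g] by auto
    qed
    have "open (?q ` ?D)" by (rule open_power_image[OF e r \<open>open ?D\<close>])
    moreover have "\<phi> ` W = ?q ` ?D"
    proof -
      have "W = g ` ?D"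
      proof
        show "W \<subseteq> g ` ?D"
        proof
          fix x assume x: "x \<in> W"
          then have "x \<in> g ` ball 0 r" using WU by (rule subsetD[rotated])
          then obtain z where "z \<in> ball 0 r" "x = g z" by (rule imageE)
          then show "x \<in> g ` ?D" using x by blast
        qed
      qed blast
      then have "\<phi> ` W = (\<lambda>z. \<phi> (g z)) ` ?D" by (metis image_image)
      also have "\<dots> = ?q ` ?D" by (rule image_cong) (use \<phi> in auto)
      finally show ?thesis .
    qed
    moreover have "\<phi> ` W \<subseteq> ball 0 1" using im WU by blast
    ultimately show ?thesis by (simp add: openin_open_eq)
  qed
  obtain \<phi>' where "homeomorphism ?U (ball 0 1) \<phi> \<phi>'"
    using homeomorphism_injective_open_map[OF cont im inj om] by blast
  then show ?thesis using that \<phi> by blast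
qed

text \<open>Being open, continuous and surjective, \<open>P0\<close> is a quotient map onto
  \<open>S2\<close>.\<close>

lemma continuous_on_S2_if_P0:
  fixes g :: "(nat \<Rightarrow> real) \<Rightarrow> (nat \<Rightarrow> real)"
  assumes c: "continuous_on UNIV (\<lambda>u. g (P0 u))"
  shows "continuous_on S2 g"
  unfolding continuous_on_open
proof (intro allI impI)
  fix V assume V: "openin (top_of_set (g ` S2)) V"
  then obtain T where T: "open T" "V = g ` S2 \<inter> T" unfolding openin_open by blast
  have "S2 \<inter> g -` V = P0 ` ((\<lambda>u. g (P0 u)) -` T)"
  proof
    show "S2 \<inter> g -` V \<subseteq> P0 ` ((\<lambda>u. g (P0 u)) -` T)"
    proof
      fix x assume x: "x \<in> S2 \<inter> g -` V"
      then obtain u where "x = P0 u" using range_P0 by blast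
      then show "x \<in> P0 ` ((\<lambda>u. g (P0 u)) -` T)" using x T(2) by auto
    qed
    show "P0 ` ((\<lambda>u. g (P0 u)) -` T) \<subseteq> S2 \<inter> g -` V"
    proof
      fix x assume "x \<in> P0 ` ((\<lambda>u. g (P0 u)) -` T)"
      then have "g x \<in> T" "x \<in> S2" using P0_in_S2 by auto
      then show "x \<in> S2 \<inter> g -` V" unfolding T(2) by blast
    qed
  qed
  then show "openin (top_of_set S2) (S2 \<inter> g -` V)"
    using openin_P0_image[OF open_vimage[OF T(1) c]] by simp
qed

locale lattes =
  fixes a b :: nat
  assumes ab: "1 \<le> a" "1 \<le> b"
begin

definition A :: "complex \<Rightarrow> complex" where
  "A z = Complex (real a * Re z) (real b * Im z)"

definition B :: "complex \<Rightarrow> complex" where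
  "B z = Complex (Re z / real a) (Im z / real b)"

lemma AB [simp]: "A (B z) = z" and BA [simp]: "B (A z) = z"
  using ab by (simp_all add: A_def B_def)

lemma A_add: "A (z + w) = A z + A w" and A_diff: "A (z - w) = A z - A w"
  and A_double: "A (2 * z) = 2 * A z" and A_minus: "A (- z) = - A z"
  and A_0 [simp]: "A 0 = 0"
  by (simp_all add: A_def complex_eq_iff algebra_simps)

lemma A_eq_iff [simp]: "A z = A w \<longleftrightarrow> z = w"
  by (metis BA)

lemma A_eq_0_iff [simp]: "A z = 0 \<longleftrightarrow> z = 0"
  by (metis A_0 A_eq_iff)

lemma A_gint: "c \<in> gint \<Longrightarrow> A c \<in> gint"
  by (auto simp: gint_def A_def)

lemma continuous_A: "continuous_on UNIV A" and continuous_B: "continuous_on UNIV B"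
  unfolding A_def B_def Complex_eq using ab by (auto intro!: continuous_intros)

lemma norm_A: "norm (A z) \<le> real (a + b) * norm z"
proof -
  have "norm (A z) \<le> \<bar>real a * Re z\<bar> + \<bar>real b * Im z\<bar>"
    using cmod_le[of "A z"] by (simp add: A_def)
  also have "\<dots> \<le> real a * norm z + real b * norm z"
    unfolding abs_mult by (intro add_mono mult_mono) (auto simp: abs_Re_le_cmod abs_Im_le_cmod)
  finally show ?thesis by (simp add: algebra_simps)
qed

lemma open_A: "open D \<Longrightarrow> open (A ` D)"
proof -
  assume "open D"
  moreover have "A ` D = B -` D" by (auto intro!: image_eqI[of _ A "B _"])
  ultimately show ?thesis using open_vimage continuous_B by metis
qed

definition F :: "(nat \<Rightarrow> real) \<Rightarrow> (nat \<Rightarrow> real)" where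
  "F x = P0 (A (SOME u. P0 u = x))"

text \<open>A is linear and preserves the Gaussian integers, so it carries equivalent points to
  equivalent points and the chosen preimage is immaterial.\<close>

lemma F_P0: "F (P0 u) = P0 (A u)"
proof -
  have "P0 (SOME v. P0 v = P0 u) = P0 u" by (rule someI_ex) blast
  then obtain c where c: "c \<in> gint" "u = (SOME v. P0 v = P0 u) + 2 * c \<or> u = 2 * c - (SOME v. P0 v = P0 u)"
    using P0_eq_iff by metis
  then have "A u = A (SOME v. P0 v = P0 u) + 2 * A c \<or> A u = 2 * A c - A (SOME v. P0 v = P0 u)"
    by (metis A_add A_diff A_double)
  then show ?thesis unfolding F_def using A_gint[OF c(1)] P0_eq_iff by metis
qed

lemma F_in: "x \<in> S2 \<Longrightarrow> F x \<in> S2"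
  unfolding F_def using P0_in_S2 by blast

lemma continuous_F: "continuous_on S2 F"
  by (rule continuous_on_S2_if_P0, unfold F_P0)
    (rule continuous_on_compose2[OF continuous_P0 continuous_A subset_UNIV])

end

lemma P0_local_kernel:
  obtains r where "0 < r"
    "\<And>z w. norm z < r \<Longrightarrow> norm w < r \<Longrightarrow>
      P0 (c + z) = P0 (c + w) \<longleftrightarrow> z ^ (if c \<in> gint then 2 else 1) = w ^ (if c \<in> gint then 2 else 1)"
proof (cases "c \<in> gint")
  case True
  show ?thesis
  proof (rule that[of "1/2"])
    fix z w :: complex assume "norm z < 1/2" "norm w < 1/2"
    then have "P0 (c + z) = P0 (c + w) \<longleftrightarrow> w = z \<or> w = - z" by (rule P0.P_eq_near_gint[OF True])
    then show "P0 (c + z) = P0 (c + w) \<longleftrightarrow> z ^ (if c \<in> gint then 2 else 1) = w ^ (if c \<in> gint then 2 else 1)"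
      using True by (auto simp: power2_eq_iff)
  qed simp
next
  case False
  obtain r where r: "0 < r" "\<And>z w. norm z < r \<Longrightarrow> norm w < r \<Longrightarrow> P0 (c + z) = P0 (c + w) \<Longrightarrow> z = w"
    by (rule P0.P_inj_near_nongint[OF False]) blast
  show ?thesis by (rule that[OF r(1)]) (use False r(2) in auto)
qed

context lattes
begin

text \<open>\<open>P0\<close> behaves like a power with exponent 2 at Gaussian integers and 1
  elsewhere. In the coordinate z it has exponent e1 at u and e2 at A u, and F is the power with
  exponent e2 / e1.\<close>

lemma F_local_degree:
  "has_local_degree F (P0 u) (if u \<notin> gint \<and> A u \<in> gint then 2 else 1)"
proof -
  define e1 e2 :: nat where "e1 = (if u \<in> gint then 2 else 1)" and "e2 = (if A u \<in> gint then 2 else 1)"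
  define d where "d = (if u \<notin> gint \<and> A u \<in> gint then 2 else 1 :: nat)"
  have e: "e2 = e1 * d" using A_gint by (auto simp: e1_def e2_def d_def)
  obtain r1 where r1: "0 < r1" "\<And>z w. norm z < r1 \<Longrightarrow> norm w < r1 \<Longrightarrow> P0 (u + z) = P0 (u + w) \<longleftrightarrow> z ^ e1 = w ^ e1"
    unfolding e1_def by (rule P0_local_kernel[of u]) blast
  obtain r2 where r2: "0 < r2" "\<And>z w. norm z < r2 \<Longrightarrow> norm w < r2 \<Longrightarrow> P0 (A u + z) = P0 (A u + w) \<longleftrightarrow> z ^ e2 = w ^ e2"
    unfolding e2_def by (rule P0_local_kernel[of "A u"]) blast
  define r where "r = min r1 (r2 / real (a + b))"
  have ab0: "0 < real (a + b)" using ab by simp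
  have r: "0 < r" using r1(1) r2(1) ab0 unfolding r_def by simp
  have ra: "norm (A z) < r2" if "norm z < r" for z
  proof -
    have "norm z < r2 / real (a + b)" using that unfolding r_def by simp
    then have "real (a + b) * norm z < r2" using ab0 by (simp add: pos_less_divide_eq mult.commute)
    then show ?thesis using norm_A[of z] by linarith
  qed
  have E: "e1 = 1 \<or> e1 = 2" "e2 = 1 \<or> e2 = 2" by (auto simp: e1_def e2_def)
  have Apow: "(A z) ^ e2 = (A w) ^ e2 \<longleftrightarrow> z ^ e2 = w ^ e2" for z w
  proof -
    have "A z = - A w \<longleftrightarrow> z = - w" by (metis A_minus A_eq_iff)
    then show ?thesis using E(2) by (auto simp: power2_eq_iff)
  qed
  have c1: "continuous_on UNIV (\<lambda>z. P0 (u + z))"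
    by (rule continuous_on_compose2[OF continuous_P0]) (auto intro: continuous_intros)
  have c2: "continuous_on UNIV (\<lambda>z. P0 (A u + A z))"
    by (rule continuous_on_compose2[OF continuous_P0]) (auto intro!: continuous_intros continuous_A)
  have o1: "openin (top_of_set S2) ((\<lambda>z. P0 (u + z)) ` D)" if "open D" for D
    using openin_P0_image[OF open_translation[OF that, of u]] by (simp add: image_image)
  have o2: "openin (top_of_set S2) ((\<lambda>z. P0 (A u + A z)) ` D)" if "open D" for D
    using openin_P0_image[OF open_translation[OF open_A[OF that], of "A u"]] by (simp add: image_image)
  obtain \<phi> \<phi>' where \<phi>: "homeomorphism ((\<lambda>z. P0 (u + z)) ` ball 0 r) (ball 0 1) \<phi> \<phi>'"
    "\<And>z. norm z < r \<Longrightarrow> \<phi> (P0 (u + z)) = (z / of_real r) ^ e1"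
    by (rule power_chart_exists[OF E(1) r c1 o1]) (use r1(2) in \<open>auto simp: r_def\<close>)
  \<comment> \<open>A is only real-linear, so \<open>(A z) ^ e2\<close> would be a bad coordinate.
    Parametrizing the target by A z lets both charts use the same z, and \<open>Apow\<close> shows
    that the kernel is still that of \<open>z ^ e2\<close>.\<close>
  obtain \<psi> \<psi>' where \<psi>: "homeomorphism ((\<lambda>z. P0 (A u + A z)) ` ball 0 r) (ball 0 1) \<psi> \<psi>'"
    "\<And>z. norm z < r \<Longrightarrow> \<psi> (P0 (A u + A z)) = (z / of_real r) ^ e2"
    by (rule power_chart_exists[OF E(2) r c2 o2]) (use r2(2)[OF ra ra] Apow in auto)
  have "power_charts F (P0 u) d ((\<lambda>z. P0 (u + z)) ` ball 0 r) ((\<lambda>z. P0 (A u + A z)) ` ball 0 r) \<phi> \<phi>' \<psi> \<psi>'"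
    unfolding power_charts_def
  proof (intro conjI ballI)
    show "openin (top_of_set S2) ((\<lambda>z. P0 (u + z)) ` ball 0 r)" by (rule o1) simp
    show "openin (top_of_set S2) ((\<lambda>z. P0 (A u + A z)) ` ball 0 r)" by (rule o2) simp
    show "P0 u \<in> (\<lambda>z. P0 (u + z)) ` ball 0 r" by (rule image_eqI[of _ _ 0]) (use r in auto)
    show "F (P0 u) \<in> (\<lambda>z. P0 (A u + A z)) ` ball 0 r" by (rule image_eqI[of _ _ 0]) (use r F_P0 in auto)
    show "\<phi> (P0 u) = 0" using \<phi>(2)[of 0] r E by auto
    show "\<psi> (F (P0 u)) = 0" using \<psi>(2)[of 0] r E F_P0 by auto
    show "1 \<le> d" by (simp add: d_def)
    fix x assume "x \<in> (\<lambda>z. P0 (u + z)) ` ball 0 r"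
    then obtain z where z: "norm z < r" "x = P0 (u + z)" by auto
    have Fx: "F x = P0 (A u + A z)" unfolding z F_P0 A_add ..
    show "F x \<in> (\<lambda>z. P0 (A u + A z)) ` ball 0 r" unfolding Fx using z(1) by auto
    show "\<psi> (F x) = \<phi> x ^ d" unfolding Fx \<psi>(2)[OF z(1)] unfolding z(2) \<phi>(2)[OF z(1)] e power_mult ..
  qed (rule \<phi> \<psi>)+
  then have "has_local_degree F (P0 u) d" unfolding has_local_degree_iff by blast
  then show ?thesis unfolding d_def .
qed

lemma F_pillow_lift: "pillow_lift P0 F"
proof
  show "continuous_on S2 F" by (rule continuous_F)
  show "F x \<in> S2" if "x \<in> S2" for x using that by (rule F_in)
  show "has_local_degree F x 1 \<or> has_local_degree F x 2" if x: "x \<in> S2" for x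
  proof -
    obtain u where u: "x = P0 u" using x range_P0 by blast
    show ?thesis unfolding u using F_local_degree[of u] by (auto split: if_splits)
  qed
  show "has_local_degree F x 1" if x: "x \<in> S2" "F x \<notin> P0 ` gint" for x
  proof -
    obtain u where u: "x = P0 u" using x(1) range_P0 by blast
    have "A u \<notin> gint" using x(2) unfolding u F_P0 by blast
    then show ?thesis unfolding u using F_local_degree[of u] by simp
  qed
qed

text \<open>F carries \<open>P0 (B z)\<close> to \<open>P0 (A (B z))\<close>, which is
  \<open>P0 z\<close>. This gives an explicit lift, so the counts by lattice classes apply to
  F.\<close>

sublocale cov: pillow_cover P0 F "\<lambda>z. P0 (B z)"
proof -
  interpret pillow_lift P0 F by (rule F_pillow_lift)
  show "pillow_cover P0 F (\<lambda>z. P0 (B z))"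
  proof
    show "lift UNIV (\<lambda>z. P0 (B z))" unfolding lift_def
      using F_P0 P0_in_S2 continuous_on_compose2[OF continuous_P0 continuous_B] by simp
  qed
qed

lemma L_eq: "cov.L = A ` gint" and I_eq: "cov.I = A ` gint"
proof -
  have B: "B (u + 2 * A c) = B u + 2 * c" "B (2 * A c - u) = 2 * c - B u" for u c
    by (metis A_add A_double AB BA, metis A_diff A_double AB BA)
  have h: "(1 / 2 :: complex) \<notin> gint" using gint_norm_ge_1[of "1 / 2"] by auto
  show "cov.L = A ` gint"
  proof
    show "A ` gint \<subseteq> cov.L" unfolding cov.L_def using A_gint P0.P_shift B(1) by auto
    show "cov.L \<subseteq> A ` gint"
    proof
      fix c assume c: "c \<in> cov.L"
      \<comment> \<open>Chosen so that the half-turn alternative below would force k = 1/2.\<close>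
      define u where "u = 1 / 2 - B c"
      have "P0 (B (A u + 2 * c)) = P0 (B (A u))" using c cov.L_shift by blast
      then have "P0 u = P0 (u + 2 * B c)" using B(1)[of "A u" "B c"] by simp
      then obtain k where k: "k \<in> gint" "u + 2 * B c = u + 2 * k \<or> u + 2 * B c = 2 * k - u"
        using P0_eq_iff by metis
      have "k = 1 / 2" if "u + 2 * B c = 2 * k - u" using that by (simp add: u_def field_simps)
      then have "u + 2 * B c = u + 2 * k" using k h by metis
      then have "B c = k" by simp
      then show "c \<in> A ` gint" using k(1) AB by (metis imageI)
    qed
  qed
  show "cov.I = A ` gint"
  proof
    show "A ` gint \<subseteq> cov.I" unfolding cov.I_def using A_gint P0.P_flip B(2) by auto
    show "cov.I \<subseteq> A ` gint"
    proof
      fix c assume c: "c \<in> cov.I"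
      \<comment> \<open>Here it is the translation alternative that would force k = -1/2.\<close>
      define u where "u = 1 / 2 + B c"
      have "P0 (B (2 * c - A u)) = P0 (B (A u))" using c cov.I_flip by blast
      then have "P0 u = P0 (2 * B c - u)" using B(2)[of "B c" "A u"] by simp
      then obtain k where k: "k \<in> gint" "2 * B c - u = u + 2 * k \<or> 2 * B c - u = 2 * k - u"
        using P0_eq_iff by metis
      have "1 / 2 = - k" if e: "2 * B c - u = u + 2 * k"
      proof -
        have "2 * (1 / 2 + k) = 0" using e by (simp add: u_def algebra_simps)
        then show ?thesis by (metis add_eq_0_iff2 mult_eq_0_iff zero_neq_numeral)
      qed
      moreover have "- k \<in> gint" using k(1) by (auto simp: gint_def)
      ultimately have "2 * B c - u = 2 * k - u" using k h by metis
      then have "B c = k" by simp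
      then show "c \<in> A ` gint" using k(1) AB by (metis imageI)
    qed
  qed
qed

text \<open>The integer points of an a by b rectangle represent the Gaussian integers modulo the
  image of A.\<close>

lemma N_eq: "cov.N = a * b"
proof -
  define t where "t p = Complex (of_nat (fst p)) (of_nat (snd p))" for p :: "nat \<times> nat"
  let ?R = "{..<a} \<times> {..<b}"
  have k: "cov.\<kappa> (2 * v) = cov.\<kappa> (2 * w) \<longleftrightarrow> w - v \<in> A ` gint" for v w
  proof -
    have "(\<exists>l\<in>A ` gint. 2 * w = 2 * v + 2 * l) \<longleftrightarrow> w - v \<in> A ` gint"
    proof
      assume "\<exists>l\<in>A ` gint. 2 * w = 2 * v + 2 * l"
      then obtain l where l: "l \<in> A ` gint" "2 * w = 2 * (v + l)" by (metis distrib_left)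
      then have "w = v + l" by (metis mult_cancel_left zero_neq_numeral)
      then show "w - v \<in> A ` gint" using l(1) by simp
    qed (rule bexI[of _ "w - v"], auto simp: algebra_simps)
    then show ?thesis unfolding cov.\<kappa>_eq_iff L_eq .
  qed
  have inj: "inj_on (\<lambda>p. cov.\<kappa> (2 * t p)) ?R"
  proof (rule inj_onI)
    fix p p' assume p: "p \<in> ?R" "p' \<in> ?R" and eq: "cov.\<kappa> (2 * t p) = cov.\<kappa> (2 * t p')"
    obtain g where g: "g \<in> gint" "t p' - t p = A g" using iffD1[OF k eq] by blast
    obtain m n :: int where mn: "g = Complex (of_int m) (of_int n)" using g(1) gint_Complex by blast
    have "real (fst p') - real (fst p) = real a * of_int m" "real (snd p') - real (snd p) = real b * of_int n"
      using g(2) by (simp_all add: t_def A_def mn complex_eq_iff)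
    then have "of_int (int (fst p') - int (fst p)) = (of_int (int a * m) :: real)"
        "of_int (int (snd p') - int (snd p)) = (of_int (int b * n) :: real)"
      by simp_all
    then have "int (fst p') - int (fst p) = int a * m" "int (snd p') - int (snd p) = int b * n"
      unfolding of_int_eq_iff by blast+
    then have *: "int a dvd int (fst p') - int (fst p)" "int b dvd int (snd p') - int (snd p)" by auto
    have "int (fst p') - int (fst p) = 0"
    proof (rule ccontr)
      assume "int (fst p') - int (fst p) \<noteq> 0"
      from dvd_imp_le_int[OF this *(1)] show False using p by auto
    qed
    moreover have "int (snd p') - int (snd p) = 0"
    proof (rule ccontr)
      assume "int (snd p') - int (snd p) \<noteq> 0"
      from dvd_imp_le_int[OF this *(2)] show False using p by auto
    qed
    ultimately    show "p = p'" by (auto intro: prod_eqI)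
  qed
  have im: "(\<lambda>p. cov.\<kappa> (2 * t p)) ` ?R = cov.\<kappa> ` cls 0"
  proof
    show "(\<lambda>p. cov.\<kappa> (2 * t p)) ` ?R \<subseteq> cov.\<kappa> ` cls 0"
      by (auto simp: cls_def gint_def t_def intro!: imageI)
    show "cov.\<kappa> ` cls 0 \<subseteq> (\<lambda>p. cov.\<kappa> (2 * t p)) ` ?R"
    proof
      fix y assume "y \<in> cov.\<kappa> ` cls 0"
      then obtain g where g: "g \<in> gint" "y = cov.\<kappa> (2 * g)" by (auto simp: cls_def)
      obtain m n :: int where mn: "g = Complex (of_int m) (of_int n)" using g(1) gint_Complex by blast
      define p where "p = (nat (m mod int a), nat (n mod int b))"
      have p: "p \<in> ?R" using ab by (auto simp: p_def nat_less_iff)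
      have "t p = Complex (of_int (m mod int a)) (of_int (n mod int b))"
        using ab by (simp add: t_def p_def)
      moreover have "A (Complex (of_int (m div int a)) (of_int (n div int b))) =
          Complex (of_int (int a * (m div int a))) (of_int (int b * (n div int b)))"
        by (simp add: A_def)
      moreover have "of_int m = of_int (m mod int a) + (of_int (int a * (m div int a)) :: real)"
          "of_int n = of_int (n mod int b) + (of_int (int b * (n div int b)) :: real)"
        by (simp_all only: flip: of_int_add) simp_all
      ultimately have "g - t p = A (Complex (of_int (m div int a)) (of_int (n div int b)))"
        unfolding mn by (simp add: complex_eq_iff)
      then have "cov.\<kappa> (2 * t p) = cov.\<kappa> (2 * g)" unfolding k using gint_Complex by blast
      then show "y \<in> (\<lambda>p. cov.\<kappa> (2 * t p)) ` ?R" using p g(2) by auto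
    qed
  qed
  show ?thesis unfolding cov.N_def im[symmetric] card_image[OF inj] by (simp add: card_cartesian_product)
qed

text \<open>The non-critical points over a corner are themselves corners: if A u is a Gaussian
  integer and u is not, then the local degree at \<open>P0 u\<close> is 2.\<close>

lemma card_ncrit_F:
  assumes e: "e \<in> E4" shows "card (cov.ncrit e) = card {v \<in> E4. A v \<in> cls e}"
proof -
  have "cov.ncrit e = P0 ` {v \<in> E4. A v \<in> cls e}"
  proof
    show "cov.ncrit e \<subseteq> P0 ` {v \<in> E4. A v \<in> cls e}"
    proof
      fix x assume "x \<in> cov.ncrit e"
      then have x: "x \<in> S2" "F x = P0 e" "has_local_degree F x 1" by (auto simp: cov.ncrit_def)
      obtain u where u: "x = P0 u" using x(1) range_P0 by blast
      have "P0 (A u) = P0 e" using x(2) F_P0 u by simp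
      then have "A u \<in> cls e" using P0.P_eq_cls E4_gint[OF e] by blast
      then have "A u \<in> gint" using cls_gint E4_gint[OF e] by blast
      then have "u \<in> gint"
        using F_local_degree[of u] x(3) has_local_degree_unique[of F x 1 2] unfolding u
        by (metis one_eq_numeral_iff semiring_norm(85))
      then obtain v where v: "v \<in> E4" "u \<in> cls v" by (rule gint_in_cls)
      have Pv: "P0 u = P0 v" using v P0.P_eq_cls E4_gint by blast
      then have "P0 (A v) = P0 e" using x(2) F_P0 u by metis
      then have "A v \<in> cls e" using P0.P_eq_cls E4_gint[OF e] by blast
      then show "x \<in> P0 ` {v \<in> E4. A v \<in> cls e}" using v(1) u Pv by blast
    qed
    show "P0 ` {v \<in> E4. A v \<in> cls e} \<subseteq> cov.ncrit e"
    proof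
      fix x assume "x \<in> P0 ` {v \<in> E4. A v \<in> cls e}"
      then obtain v where v: "v \<in> E4" "A v \<in> cls e" "x = P0 v" by blast
      have "F x = P0 e" using v F_P0 P0.P_eq_cls E4_gint[OF e] by simp
      moreover have "has_local_degree F x 1" using F_local_degree[of v] E4_gint[OF v(1)] v(3) by simp
      ultimately show "x \<in> cov.ncrit e" using P0_in_S2 v(3) by (simp add: cov.ncrit_def)
    qed
  qed
  moreover have "inj_on P0 {v \<in> E4. A v \<in> cls e}"
    by (rule inj_on_subset[OF inj_on_E4[OF P0.pillow_axioms]]) auto
  ultimately show ?thesis by (simp add: card_image)
qed

lemma card_crit_F:
  assumes e: "e \<in> E4" shows "2 * card (cov.crit e) + card {v \<in> E4. A v \<in> cls e} = a * b"
proof -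
  have "0 \<in> cov.I" unfolding I_eq by (rule image_eqI[of _ _ 0]) auto
  from cov.card_crit[OF E4_gint[OF e] this] show ?thesis using card_ncrit_F[OF e] N_eq by simp
qed

lemma fibre_count:
  assumes g: "\<And>v. v \<in> E4 \<Longrightarrow> g v \<in> E4 \<and> A v \<in> cls (g v)" and e: "e \<in> E4"
  shows "{v \<in> E4. A v \<in> cls e} = {v \<in> E4. g v = e}"
  using g e cls_disjoint by blast

end

section \<open>Brouwer degree of power maps of the sphere\<close>

lemma prod_topology_Icc_nsphere: "prod_topology (top_of_set {0..1::real}) (nsphere 2) = top_of_set ({0..1} \<times> S2)"
  by (metis top_of_set_S2 prod_topology_subtopology_eu)

lemma homotopic_S2I:
  fixes h :: "real \<times> (nat \<Rightarrow> real) \<Rightarrow> nat \<Rightarrow> real"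
  assumes h: "continuous_on ({0..1} \<times> S2) h"
    "\<And>t x. 0 \<le> t \<Longrightarrow> t \<le> 1 \<Longrightarrow> x \<in> S2 \<Longrightarrow> h (t, x) \<in> S2"
    and e: "\<And>x. x \<in> S2 \<Longrightarrow> h (0, x) = f x" "\<And>x. x \<in> S2 \<Longrightarrow> h (1, x) = g x"
  shows "homotopic_with (\<lambda>_. True) (nsphere 2) (nsphere 2) f g"
proof -
  have "continuous_map (top_of_set ({0..1} \<times> S2)) (top_of_set S2) h"
    using h by (auto simp: continuous_map_in_subtopology)
  then have "continuous_map (prod_topology (top_of_set {0..1}) (nsphere 2)) (nsphere 2) h"
    unfolding top_of_set_S2 prod_topology_Icc_nsphere .
  then show ?thesis by (subst homotopic_with) (use e in auto)
qed

text \<open>The straight segment from f x to g x misses the origin and can therefore be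
  normalized.\<close>

lemma homotopic_S2_if_inner_pos:
  fixes f g :: "(nat \<Rightarrow> real) \<Rightarrow> nat \<Rightarrow> real"
  assumes c: "continuous_on S2 f" "continuous_on S2 g"
    and S: "\<And>x. x \<in> S2 \<Longrightarrow> f x \<in> S2" "\<And>x. x \<in> S2 \<Longrightarrow> g x \<in> S2"
    and pos: "\<And>x. x \<in> S2 \<Longrightarrow> 0 < f x 0 * g x 0 + f x 1 * g x 1 + f x 2 * g x 2"
  shows "homotopic_with (\<lambda>_. True) (nsphere 2) (nsphere 2) f g"
proof -
  define n where "n t x i = (1 - t) * f x i + t * g x i" for t x and i :: nat
  define r where "r t x = (n t x 0)\<^sup>2 + (n t x 1)\<^sup>2 + (n t x 2)\<^sup>2" for t x
  have r: "r t x = (1 - t)\<^sup>2 + t\<^sup>2 + 2 * ((1 - t) * t) * (f x 0 * g x 0 + f x 1 * g x 1 + f x 2 * g x 2)" if x: "x \<in> S2" for t x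
  proof -
    have "r t x = (1 - t)\<^sup>2 * ((f x 0)\<^sup>2 + (f x 1)\<^sup>2 + (f x 2)\<^sup>2) + t\<^sup>2 * ((g x 0)\<^sup>2 + (g x 1)\<^sup>2 + (g x 2)\<^sup>2)
        + 2 * ((1 - t) * t) * (f x 0 * g x 0 + f x 1 * g x 1 + f x 2 * g x 2)"
      unfolding r_def n_def by (simp add: power2_eq_square algebra_simps)
    then show ?thesis using S[OF x] by (simp add: S2_iff)
  qed
  have rpos: "0 < r t x" if t: "0 \<le> t" "t \<le> 1" and x: "x \<in> S2" for t x
  proof -
    have "0 \<le> 2 * ((1 - t) * t) * (f x 0 * g x 0 + f x 1 * g x 1 + f x 2 * g x 2)"
      using t pos[OF x] by simp
    moreover have "0 < (1 - t)\<^sup>2 + t\<^sup>2" using sum_power2_gt_zero_iff[of "1 - t" t] by auto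
    ultimately show ?thesis unfolding r[OF x] by linarith
  qed
  define h where "h p i = n (fst p) (snd p) i / sqrt (r (fst p) (snd p))" for p and i :: nat
  let ?D = "{0..1::real} \<times> S2"
  have ci: "continuous_on ?D (\<lambda>p. f (snd p) i)" "continuous_on ?D (\<lambda>p. g (snd p) i)" for i
    by (rule continuous_on_compose2[OF continuous_on_product_then_coordinatewise[OF c(1)]], auto intro: continuous_intros,
        rule continuous_on_compose2[OF continuous_on_product_then_coordinatewise[OF c(2)]], auto intro: continuous_intros)
  have cn: "continuous_on ?D (\<lambda>p. n (fst p) (snd p) i)" for i
    unfolding n_def by (intro continuous_intros ci)
  show ?thesis
  proof (rule homotopic_S2I[of h])
    show "continuous_on ?D h"
      unfolding h_def
    proof (rule continuous_on_coordinatewise_then_product)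
      fix i
      have cr: "continuous_on ?D (\<lambda>p. sqrt (r (fst p) (snd p)))"
        unfolding r_def by (intro continuous_intros cn)
      have nz: "\<forall>p\<in>?D. sqrt (r (fst p) (snd p)) \<noteq> 0" using rpos by force
      show "continuous_on ?D (\<lambda>p. n (fst p) (snd p) i / sqrt (r (fst p) (snd p)))"
        by (rule continuous_on_divide[OF cn cr nz])
    qed
    show "h (t, x) \<in> S2" if t: "0 \<le> t" "t \<le> 1" and x: "x \<in> S2" for t x
    proof -
      have "(h (t, x) 0)\<^sup>2 + (h (t, x) 1)\<^sup>2 + (h (t, x) 2)\<^sup>2 = r t x / (sqrt (r t x))\<^sup>2"
        unfolding h_def power_divide fst_conv snd_conv add_divide_distrib[symmetric] r_def[symmetric] ..
      then have "(h (t, x) 0)\<^sup>2 + (h (t, x) 1)\<^sup>2 + (h (t, x) 2)\<^sup>2 = 1" using rpos[OF t x] by simp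
      moreover have "\<forall>i>2. h (t, x) i = 0" using S[OF x] by (simp add: S2_iff h_def n_def)
      ultimately show ?thesis unfolding S2_iff by blast
    qed
    show "h (0, x) = f x" "h (1, x) = g x" if x: "x \<in> S2" for x
      unfolding h_def using r[OF x] by (auto simp: n_def)
  qed
qed

section \<open>Cylindrical coordinates, power maps and rotations\<close>

definition S2pt :: "complex \<Rightarrow> real \<Rightarrow> nat \<Rightarrow> real" where
  "S2pt z t i = (if i = 0 then Re z else if i = 1 then Im z else if i = 2 then t else 0)"

definition S2z :: "(nat \<Rightarrow> real) \<Rightarrow> complex" where
  "S2z x = Complex (x 0) (x 1)"

lemma S2pt_in_S2: "S2pt z t \<in> S2 \<longleftrightarrow> (norm z)\<^sup>2 + t\<^sup>2 = 1"
  unfolding S2_iff by (simp add: S2pt_def cmod_power2)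

lemma S2pt_S2z: "x \<in> S2 \<Longrightarrow> S2pt (S2z x) (x 2) = x"
proof
  fix i :: nat
  assume "x \<in> S2"
  then have z: "x i = 0" if "2 < i" using that unfolding S2_iff by blast
  consider "i = 0" | "i = 1" | "i = 2" | "2 < i" by linarith
  then show "S2pt (S2z x) (x 2) i = x i" by cases (use z in \<open>auto simp: S2pt_def S2z_def\<close>)
qed

lemma norm_S2z: "x \<in> S2 \<Longrightarrow> (norm (S2z x))\<^sup>2 + (x 2)\<^sup>2 = 1"
  unfolding S2_iff by (simp add: S2z_def cmod_power2)

lemma S2z_S2pt [simp]: "S2z (S2pt z t) = z" and S2pt_2 [simp]: "S2pt z t 2 = t"
  by (simp_all add: S2pt_def S2z_def)

lemma S2pt_eq_iff: "S2pt z t = S2pt z' t' \<longleftrightarrow> z = z' \<and> t = t'"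
  by (metis S2z_S2pt S2pt_2)

lemma continuous_on_S2pt:
  assumes "continuous_on S z" "continuous_on S t" shows "continuous_on S (\<lambda>x. S2pt (z x) (t x))"
proof (rule continuous_on_coordinatewise_then_product)
  fix i
  show "continuous_on S (\<lambda>x. S2pt (z x) (t x) i)"
    unfolding S2pt_def using assms by (cases "i = 0"; cases "i = 1"; cases "i = 2"; simp add: continuous_intros)
qed

lemma continuous_on_coord: "continuous_on S (\<lambda>x :: nat \<Rightarrow> real. x i)"
  by (rule continuous_on_subset[OF continuous_on_product_coordinates]) simp

lemma continuous_on_S2z: "continuous_on S S2z"
  unfolding S2z_def Complex_eq by (intro continuous_intros continuous_on_coord)

text \<open>Multiplies the argument by m and keeps the modulus, so that it acts on the sphere at
  constant height.\<close>

definition polar_power :: "nat \<Rightarrow> complex \<Rightarrow> complex" where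
  "polar_power m z = z ^ m / of_real (norm z ^ (m - 1))"

lemma polar_power_polar: "0 < m \<Longrightarrow> 0 \<le> r \<Longrightarrow> polar_power m (of_real r * cis \<theta>) = of_real r * cis (real m * \<theta>)"
proof (cases "r = 0")
  case False
  assume "0 < m" "0 \<le> r"
  then have "(of_real r :: complex) ^ m = of_real r * of_real (r ^ (m - 1))"
    by (metis Suc_diff_1 of_real_power power_Suc)
  then show ?thesis
    using False \<open>0 \<le> r\<close> by (simp add: polar_power_def norm_mult power_mult_distrib Complex.DeMoivre)
qed (simp add: polar_power_def)

lemma norm_polar_power: "0 < m \<Longrightarrow> norm (polar_power m z) = norm z"
  using polar_power_polar[of m "norm z" "Arg z"] rcis_cmod_Arg[of z] by (simp add: rcis_def norm_mult)

lemma continuous_polar_power: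
  assumes m: "0 < m" shows "continuous_on UNIV (polar_power m)"
proof -
  have "isCont (polar_power m) z" for z
  proof (cases "z = 0")
    case True
    have "((\<lambda>w. norm (polar_power m w)) \<longlongrightarrow> 0) (at 0)"
      unfolding norm_polar_power[OF m] using tendsto_norm[OF tendsto_ident_at, of "0 :: complex" UNIV] by simp
    then have "(polar_power m \<longlongrightarrow> 0) (at 0)" by (rule tendsto_norm_zero_cancel)
    moreover have "polar_power m 0 = 0" using m by (simp add: polar_power_def zero_power)
    ultimately show ?thesis using True by (simp add: isCont_def)
  next
    case False
    then show ?thesis unfolding polar_power_def by (intro continuous_intros) auto
  qed
  then show ?thesis by (simp add: continuous_at_imp_continuous_on)
qed

definition S2_power :: "nat \<Rightarrow> (nat \<Rightarrow> real) \<Rightarrow> nat \<Rightarrow> real" where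
  "S2_power m x = S2pt (polar_power m (S2z x)) (x 2)"

lemma S2_power_in: "0 < m \<Longrightarrow> x \<in> S2 \<Longrightarrow> S2_power m x \<in> S2"
  unfolding S2_power_def S2pt_in_S2 by (simp add: norm_polar_power norm_S2z)

lemma continuous_S2_power:
  assumes "0 < m" shows "continuous_on S2 (S2_power m)"
  unfolding S2_power_def
  by (intro continuous_on_S2pt continuous_on_coord continuous_on_compose2[OF continuous_polar_power[OF assms] continuous_on_S2z]) simp

text \<open>The case distinction makes the rotation by 0 the identity off the sphere, too.\<close>

definition S2_rot :: "real \<Rightarrow> (nat \<Rightarrow> real) \<Rightarrow> nat \<Rightarrow> real" where
  "S2_rot \<theta> x = (if \<theta> = 0 then x else S2pt (cis \<theta> * S2z x) (x 2))"

lemma S2_rot_eq: "x \<in> S2 \<Longrightarrow> S2_rot \<theta> x = S2pt (cis \<theta> * S2z x) (x 2)"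
  by (simp add: S2_rot_def S2pt_S2z)

lemma S2_rot_in: "x \<in> S2 \<Longrightarrow> S2_rot \<theta> x \<in> S2"
  by (simp add: S2_rot_eq S2pt_in_S2 norm_mult norm_S2z)

lemma S2_rot_add: "x \<in> S2 \<Longrightarrow> S2_rot \<theta> (S2_rot \<eta> x) = S2_rot (\<theta> + \<eta>) x"
  using S2_rot_in[of x \<eta>] by (simp add: S2_rot_eq cis_mult[symmetric] mult.assoc)

lemma homotopic_S2_rot: "homotopic_with (\<lambda>_. True) (nsphere 2) (nsphere 2) (S2_rot \<theta>) id"
proof (rule homotopic_S2I[where h = "\<lambda>p. S2pt (cis ((1 - fst p) * \<theta>) * S2z (snd p)) (snd p 2)"])
  have "continuous_on ({0..1} \<times> S2) (\<lambda>p. S2z (snd p))" "continuous_on ({0..1} \<times> S2) (\<lambda>p. snd p 2)"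
    by (rule continuous_on_compose2[OF continuous_on_S2z[of UNIV]], auto intro: continuous_intros,
        rule continuous_on_compose2[OF continuous_on_coord[of UNIV]], auto intro: continuous_intros)
  then show "continuous_on ({0..1} \<times> S2) (\<lambda>p. S2pt (cis ((1 - fst p) * \<theta>) * S2z (snd p)) (snd p 2))"
    unfolding cis_conv_exp by (intro continuous_on_S2pt continuous_intros)
qed (auto simp: S2_rot_eq S2pt_in_S2 norm_mult norm_S2z S2pt_S2z)

lemma homeomorphism_S2_rot: "homeomorphism S2 S2 (S2_rot \<theta>) (S2_rot (- \<theta>))"
proof
  have "continuous_on S2 (S2_rot \<theta>)" for \<theta>
    using homotopic_with_imp_continuous_maps[OF homotopic_S2_rot] continuous_map_S2_iff by blast
  then show "continuous_on S2 (S2_rot \<theta>)" "continuous_on S2 (S2_rot (- \<theta>))" by blast+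
  show "S2_rot \<theta> ` S2 \<subseteq> S2" "S2_rot (- \<theta>) ` S2 \<subseteq> S2" using S2_rot_in by blast+
  show "S2_rot (- \<theta>) (S2_rot \<theta> x) = x" "S2_rot \<theta> (S2_rot (- \<theta>) x) = x" if "x \<in> S2" for x
    using that by (simp_all add: S2_rot_add) (simp_all add: S2_rot_def)
qed

text \<open>Deleting the closed negative axis removes both 0 and the discontinuity of
  \<open>Arg\<close>; the sector with s = pi is the slit plane.\<close>

definition sector :: "real \<Rightarrow> complex set" where
  "sector s = {z. z \<notin> \<real>\<^sub>\<le>\<^sub>0 \<and> \<bar>Arg z\<bar> < s}"

lemma open_sector: "open (sector s)"
proof -
  have "continuous_on (- \<real>\<^sub>\<le>\<^sub>0) Arg"
    by (intro continuous_at_imp_continuous_on ballI) (auto intro: continuous_at_Arg)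
  then have "open ((- \<real>\<^sub>\<le>\<^sub>0) \<inter> Arg -` {- s<..<s})"
    by (rule continuous_open_preimage) (auto intro: closed_nonpos_Reals_complex)
  moreover have "(- \<real>\<^sub>\<le>\<^sub>0) \<inter> Arg -` {- s<..<s} = sector s" by (auto simp: sector_def)
  ultimately show ?thesis by simp
qed

lemma Arg_polar:
  assumes "0 < r" "\<bar>\<theta>\<bar> < pi" shows "Arg (of_real r * cis \<theta>) = \<theta>"
proof -
  have "Arg (cis \<theta>) = \<theta>" by (rule cis_Arg_unique) (use assms in \<open>auto simp: sgn_eq\<close>)
  then show ?thesis using assms by simp
qed

lemma polar_in_sector:
  assumes r: "0 < r" and "\<bar>\<theta>\<bar> < s" "s \<le> pi" shows "of_real r * cis \<theta> \<in> sector s"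
proof -
  have A: "Arg (of_real r * cis \<theta>) = \<theta>" using Arg_polar assms by simp
  have "of_real r * cis \<theta> \<notin> \<real>\<^sub>\<le>\<^sub>0"
  proof
    assume "of_real r * cis \<theta> \<in> \<real>\<^sub>\<le>\<^sub>0"
    then obtain t where t: "of_real r * cis \<theta> = of_real t" "t \<le> 0" by (auto elim: nonpos_Reals_cases)
    then have "t \<noteq> 0" using r by auto
    then have "Arg (of_real r * cis \<theta>) = pi" unfolding t(1) using t(2) by simp
    then show False using A assms by simp
  qed
  then show ?thesis using A assms(2) by (simp add: sector_def)
qed

lemma sector_polar:
  assumes "z \<in> sector s"
  obtains r \<theta> where "z = of_real r * cis \<theta>" "0 < r" "\<bar>\<theta>\<bar> < s" "r = norm z" "\<theta> = Arg z"
proof (rule that[of "norm z" "Arg z"])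
  show "z = of_real (norm z) * cis (Arg z)" using rcis_cmod_Arg[of z] by (simp add: rcis_def)
  show "0 < norm z" using assms by (auto simp: sector_def)
  show "\<bar>Arg z\<bar> < s" using assms by (simp add: sector_def)
qed simp_all

lemma S2_power_rot:
  assumes m: "0 < m" and x: "x \<in> S2"
  shows "S2_power m (S2_rot (2 * pi * real k / real m) x) = S2_power m x"
proof -
  have "(cis (2 * pi * real k / real m)) ^ m = 1"
    using m by (simp add: Complex.DeMoivre)
  then have "polar_power m (cis (2 * pi * real k / real m) * z) = polar_power m z" for z
    by (simp add: polar_power_def norm_mult power_mult_distrib)
  then show ?thesis using x by (simp add: S2_power_def S2_rot_eq)
qed

text \<open>The sector of longitudes below pi/m in absolute value is mapped homeomorphically onto
  the sphere minus a closed half meridian. Its m rotations are disjoint, and they form the cyclic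
  symmetry of the map.\<close>

theorem Brouwer_degree2_S2_power:
  assumes m: "0 < m"
  shows "\<exists>e. e \<noteq> 0 \<and> Brouwer_degree2 2 (S2_power m) = int m * e"
proof -
  define \<rho> where "\<rho> k = S2_rot (2 * pi * real k / real m)" for k :: nat
  define sub where "sub s = {x \<in> S2. S2z x \<in> sector s}" for s
  define U0 where "U0 = sub (pi / real m)"
  define V where "V = sub pi"
  define root where "root w = of_real (norm w) * cis (Arg w / real m)" for w
  define g' where "g' x = S2pt (root (S2z x)) (x 2)" for x
  define x0 where "x0 = S2pt 1 0"
  have pm: "pi / real m \<le> pi" using m by (simp add: field_simps)
  have op: "openin (top_of_set S2) (sub s)" for s
  proof -
    have "sub s = S2 \<inter> S2z -` sector s" by (auto simp: sub_def)
    then show ?thesis using continuous_openin_preimage[OF continuous_on_S2z[of S2], of UNIV "sector s"] open_sector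
      by simp
  qed
  have root1: "root w \<in> sector (pi / real m)" "polar_power m (root w) = w" "norm (root w) = norm w"
    if "w \<in> sector pi" for w
  proof -
    obtain r \<theta> where w: "w = of_real r * cis \<theta>" "0 < r" "\<bar>\<theta>\<bar> < pi" "r = norm w" "\<theta> = Arg w"
      using \<open>w \<in> sector pi\<close> by (rule sector_polar)
    have rw: "root w = of_real r * cis (\<theta> / real m)" unfolding root_def w(4,5) ..
    show "root w \<in> sector (pi / real m)" unfolding rw
      by (rule polar_in_sector) (use w m pm in \<open>auto simp: abs_divide divide_strict_right_mono\<close>)
    have "polar_power m (root w) = of_real r * cis (real m * (\<theta> / real m))"
      unfolding rw by (rule polar_power_polar[OF m]) (use w in simp)
    then show "polar_power m (root w) = w" using m w(1) by simp
    show "norm (root w) = norm w" by (simp add: root_def norm_mult)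
  qed
  have root2: "polar_power m z \<in> sector pi" "root (polar_power m z) = z" if "z \<in> sector (pi / real m)" for z
  proof -
    obtain r \<theta> where z: "z = of_real r * cis \<theta>" "0 < r" "\<bar>\<theta>\<bar> < pi / real m"
      using \<open>z \<in> sector (pi / real m)\<close> by (rule sector_polar)
    have pz: "polar_power m z = of_real r * cis (real m * \<theta>)" unfolding z(1) by (rule polar_power_polar[OF m]) (use z in simp)
    have mt: "\<bar>real m * \<theta>\<bar> < pi" using z(3) m by (simp add: abs_mult pos_less_divide_eq mult.commute)
    show "polar_power m z \<in> sector pi" unfolding pz by (rule polar_in_sector) (use z mt in auto)
    have "Arg (polar_power m z) = real m * \<theta>" unfolding pz by (rule Arg_polar[OF z(2) mt])
    moreover have "norm (polar_power m z) = r" unfolding pz using z(2) by (simp add: norm_mult)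
    ultimately show "root (polar_power m z) = z" using m z(1) by (simp add: root_def)
  qed
  have hom: "homeomorphism U0 V (S2_power m) g'"
  proof
    show "continuous_on U0 (S2_power m)"
      by (rule continuous_on_subset[OF continuous_S2_power[OF m]]) (auto simp: U0_def sub_def)
    have "continuous_on V (\<lambda>x. Arg (S2z x))"
    proof (rule continuous_on_compose2[of "sector pi" Arg V S2z])
      show "continuous_on (sector pi) Arg"
        by (intro continuous_at_imp_continuous_on ballI continuous_at_Arg) (auto simp: sector_def)
      show "continuous_on V S2z" by (rule continuous_on_S2z)
      show "S2z ` V \<subseteq> sector pi" by (auto simp: V_def sub_def)
    qed
    then show "continuous_on V g'" unfolding g'_def root_def cis_conv_exp using m
      by (intro continuous_on_S2pt continuous_intros continuous_on_coord continuous_on_S2z)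
        (auto simp: V_def sub_def sector_def)
    show "S2_power m ` U0 \<subseteq> V"
      using S2_power_in[OF m] root2(1) by (auto simp: U0_def V_def sub_def S2_power_def)
    show "g' ` V \<subseteq> U0"
      using root1 norm_S2z by (auto simp: U0_def V_def sub_def g'_def S2pt_in_S2)
    show "g' (S2_power m x) = x" if "x \<in> U0" for x
      using that root2(2) by (simp add: U0_def sub_def g'_def S2_power_def S2pt_S2z)
    show "S2_power m (g' x) = x" if "x \<in> V" for x
      using that root1(2) by (simp add: V_def sub_def g'_def S2_power_def S2pt_S2z)
  qed
  show ?thesis
  proof (rule Brouwer_degree2_cyclic[where \<rho> = \<rho> and ?U0.0 = U0 and V = V and ?x0.0 = x0])
    show "continuous_map (nsphere 2) (nsphere 2) (S2_power m)"
      unfolding continuous_map_S2_iff using continuous_S2_power[OF m] S2_power_in[OF m] by blast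
    show "homotopic_with (\<lambda>_. True) (nsphere 2) (nsphere 2) (\<rho> k) id" for k
      unfolding \<rho>_def by (rule homotopic_S2_rot)
    show "inj_on (\<rho> k) S2" for k
      unfolding \<rho>_def by (rule inj_on_inverseI[of _ "S2_rot (- (2 * pi * real k / real m))"]) (rule homeomorphism_apply1[OF homeomorphism_S2_rot])
    show "S2_power m (\<rho> k x) = S2_power m x" if "x \<in> S2" for k x
      unfolding \<rho>_def by (rule S2_power_rot[OF m that])
    show "\<rho> 0 x = x" for x by (simp add: \<rho>_def S2_rot_def)
    have s1: "1 \<in> sector s" if "0 < s" "s \<le> pi" for s using polar_in_sector[of 1 0 s] that by simp
    show "x0 \<in> U0" using s1[of "pi / real m"] pm m by (simp add: x0_def U0_def sub_def S2pt_in_S2)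
    show "openin (nsphere 2) (\<rho> k ` U0)" for k
      using homeomorphism_imp_open_map[OF homeomorphism_S2_rot op] unfolding \<rho>_def U0_def top_of_set_S2 by blast
    show "disjoint_family_on (\<lambda>k. \<rho> k ` U0) {..<m}"
      unfolding disjoint_family_on_def
    proof (intro ballI impI)
      fix k l assume kl: "k \<in> {..<m}" "l \<in> {..<m}" "k \<noteq> l"
      have False if ab: "a \<in> U0" "b \<in> U0" "\<rho> k a = \<rho> l b" for a b
      proof -
        obtain r \<alpha> where a: "S2z a = of_real r * cis \<alpha>" "0 < r" "\<bar>\<alpha>\<bar> < pi / real m"
          by (rule sector_polar[of "S2z a" "pi / real m"]) (use ab(1) in \<open>simp add: U0_def sub_def\<close>, rule that)
        obtain t \<beta> where b: "S2z b = of_real t * cis \<beta>" "0 < t" "\<bar>\<beta>\<bar> < pi / real m"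
          by (rule sector_polar[of "S2z b" "pi / real m"]) (use ab(2) in \<open>simp add: U0_def sub_def\<close>, rule that)
        have "cis (2 * pi * real k / real m) * S2z a = cis (2 * pi * real l / real m) * S2z b"
          using ab by (simp add: \<rho>_def U0_def sub_def S2_rot_eq S2pt_eq_iff)
        then have e: "of_real r * cis (2 * pi * real k / real m + \<alpha>) = of_real t * cis (2 * pi * real l / real m + \<beta>)"
          unfolding a b cis_mult[symmetric] by (simp add: mult_ac)
        then have "norm (of_real r * cis (2 * pi * real k / real m + \<alpha>)) = norm (of_real t * cis (2 * pi * real l / real m + \<beta>))"
          by simp
        then have "r = t" using a(2) b(2) by (simp add: norm_mult)
        then have "cis (2 * pi * real k / real m + \<alpha>) = cis (2 * pi * real l / real m + \<beta>)"
          using e a(2) by simp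
        then have "sin (2 * pi * real k / real m + \<alpha>) = sin (2 * pi * real l / real m + \<beta>) \<and>
            cos (2 * pi * real k / real m + \<alpha>) = cos (2 * pi * real l / real m + \<beta>)"
          by (simp add: complex_eq_iff)
        then obtain n :: int where n: "2 * pi * real k / real m + \<alpha> = 2 * pi * real l / real m + \<beta> + 2 * pi * of_int n"
          using sin_cos_eq_iff by blast
        \<comment> \<open>Comparing arguments leaves an integer j with 2 pi j / m of modulus less
          than 2 pi / m. Hence j = 0, and k and l agree modulo m.\<close>
        define j where "j = int k - int l - n * int m"
        have "2 * pi * of_int j / real m = \<beta> - \<alpha>"
          using n m by (simp add: j_def field_simps)
        then have "\<bar>2 * pi * of_int j / real m\<bar> < 2 * pi / real m" using a(3) b(3) by linarith
        then have "\<bar>of_int j :: real\<bar> < 1" using m by (simp add: abs_mult abs_divide divide_less_cancel)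
        then have "j = 0" by linarith
        then have "int m dvd int k - int l" by (simp add: j_def)
        moreover have "\<bar>int k - int l\<bar> < int m" using kl by auto
        ultimately have "int k - int l = 0" using dvd_imp_le_int[of "int k - int l" "int m"] by linarith
        then show False using kl by simp
      qed
      then show "\<rho> k ` U0 \<inter> \<rho> l ` U0 = {}" by blast
    qed
    show "\<exists>k<m. x = \<rho> k x0" if x: "x \<in> S2" "S2_power m x = S2_power m x0" for x
    proof -
      have *: "polar_power m (S2z x) = polar_power m 1" "x 2 = 0" using x(2) by (simp_all add: S2_power_def x0_def S2pt_eq_iff)
      have "norm (S2z x) = 1" using norm_S2z[OF x(1)] *(2) norm_ge_zero[of "S2z x"] by (simp add: power2_eq_1_iff del: norm_ge_zero)
      then have "S2z x ^ m = 1" using *(1) by (simp add: polar_power_def)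
      then obtain k where k: "k < m" "S2z x = cis (2 * pi * real k / real m)"
        using bij_betw_imp_surj_on[OF Complex.bij_betw_roots_unity[OF m]] by (metis (mono_tags, lifting) imageE lessThan_iff mem_Collect_eq)
      have "x0 \<in> S2" by (simp add: x0_def S2pt_in_S2)
      then have "\<rho> k x0 = x" using S2pt_S2z[OF x(1)] k(2) *(2) by (simp add: \<rho>_def S2_rot_eq) (simp add: x0_def)
      then show ?thesis using k(1) by blast
    qed
    show "openin (nsphere 2) V" using op unfolding V_def top_of_set_S2 by blast
    have sub: "subtopology (nsphere 2) (sub s) = top_of_set (sub s)" for s
    proof -
      have "S2 \<inter> sub s = sub s" by (auto simp: sub_def)
      then show ?thesis by (metis subtopology_subtopology top_of_set_S2)
    qed
    show "homeomorphic_map (subtopology (nsphere 2) U0) (subtopology (nsphere 2) V) (S2_power m)"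
      unfolding U0_def V_def sub homeomorphic_map_maps
      using hom unfolding U0_def V_def by (auto simp: homeomorphic_maps_iff_homeomorphism)
  qed (rule m)
qed

section \<open>Brouwer degree of diagonal Lattes maps\<close>

text \<open>
  The deformed pillowcase: each meridian of constant real part is mapped to a great semicircle, so that multiplying the real part by m
  multiplies the longitude by m.  Every point stays within a right angle of its image.
\<close>

definition q_pt :: "complex \<Rightarrow> nat \<Rightarrow> real" where
  "q_pt u = S2pt (Complex (\<bar>sin (pi * Im u)\<bar> * cos (pi * Re u)) (sin (pi * Re u) * sin (pi * Im u))) (cos (pi * Im u))"

definition q_map :: "(nat \<Rightarrow> real) \<Rightarrow> nat \<Rightarrow> real" where
  "q_map x = q_pt (SOME u. P0 u = x)"

lemma q_pt_eq: "q_pt u = S2pt (Complex (sqrt (1 - (pY u)\<^sup>2) * pX u) (pZ u)) (pY u)"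
  unfolding q_pt_def pX_def pY_def pZ_def by (simp add: sin_squared_eq[symmetric])

lemma q_pt_in_S2: "q_pt u \<in> S2"
proof -
  have "(\<bar>sin (pi * Im u)\<bar> * cos (pi * Re u))\<^sup>2 + (sin (pi * Re u) * sin (pi * Im u))\<^sup>2 + (cos (pi * Im u))\<^sup>2
      = (sin (pi * Im u))\<^sup>2 * ((sin (pi * Re u))\<^sup>2 + (cos (pi * Re u))\<^sup>2) + (cos (pi * Im u))\<^sup>2"
    by (simp only: power_mult_distrib power2_abs) (simp only: algebra_simps)
  then show ?thesis unfolding q_pt_def S2pt_in_S2 by (simp add: cmod_power2)
qed

lemma q_map_P0: "q_map (P0 u) = q_pt u"
proof -
  have "P0 (SOME v. P0 v = P0 u) = P0 u" by (rule someI_ex) blast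
  from P0_eq_imp[OF this] show ?thesis unfolding q_map_def q_pt_eq by simp
qed

lemma continuous_q_map: "continuous_on S2 q_map"
  by (rule continuous_on_S2_if_P0, unfold q_map_P0, unfold q_pt_def Complex_eq)
    (intro continuous_on_S2pt continuous_intros)

lemma q_map_in_S2: "x \<in> S2 \<Longrightarrow> q_map x \<in> S2"
  unfolding q_map_def by (rule q_pt_in_S2)

lemma homotopic_q_map: "homotopic_with (\<lambda>_. True) (nsphere 2) (nsphere 2) q_map id"
proof (rule homotopic_S2_if_inner_pos[OF continuous_q_map])
  show "continuous_on S2 (id :: (nat \<Rightarrow> real) \<Rightarrow> _)" by (simp add: continuous_on_id id_def)
  show "q_map x \<in> S2" if "x \<in> S2" for x using that by (rule q_map_in_S2)
  show "id x \<in> S2" if "x \<in> S2" for x using that by simp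
  fix x assume "x \<in> S2"
  then obtain u where u: "x = P0 u" using range_P0 by blast
  define s where "s = sqrt (1 - (pY u)\<^sup>2)"
  have s0: "0 \<le> s" using pY_le[of u] by (simp add: s_def)
  have "0 < s * (pX u)\<^sup>2 + (pZ u)\<^sup>2 + (pY u)\<^sup>2"
  proof (rule ccontr)
    assume *: "\<not> 0 < s * (pX u)\<^sup>2 + (pZ u)\<^sup>2 + (pY u)\<^sup>2"
    have nn: "0 \<le> s * (pX u)\<^sup>2" "0 \<le> (pZ u)\<^sup>2" "0 \<le> (pY u)\<^sup>2" using s0 by simp_all
    then have "(pY u)\<^sup>2 = 0" "(pZ u)\<^sup>2 = 0" "s * (pX u)\<^sup>2 = 0" using * by linarith+
    then have "pY u = 0" "pZ u = 0" "pX u = 0" by (auto simp: s_def)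
    then show False using pillow_eq[of u] by simp
  qed
  moreover have "q_map x 0 * id x 0 + q_map x 1 * id x 1 + q_map x 2 * id x 2 =
      (s * (pX u)\<^sup>2 + (pZ u)\<^sup>2 + (pY u)\<^sup>2) / pR u"
    unfolding u q_map_P0 q_pt_eq s_def[symmetric]
    by (simp add: S2pt_def P0_def power2_eq_square add_divide_distrib)
  ultimately show "0 < q_map x 0 * id x 0 + q_map x 1 * id x 1 + q_map x 2 * id x 2"
    using pR_pos[of u] by simp
qed

text \<open>The sine of the imaginary part enters one coordinate with its absolute value and another
  with its sign. Moving the sign \<epsilon> into the angle makes the longitude \<epsilon> times pi
  times the real part, which the power map multiplies by m.\<close>

lemma S2_power_q_pt:
  assumes m: "0 < m" shows "S2_power m (q_pt u) = q_pt (Complex (real m * Re u) (Im u))"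
proof -
  define \<epsilon> :: real where "\<epsilon> = (if 0 \<le> sin (pi * Im u) then 1 else - 1)"
  have z: "Complex (\<bar>sin (pi * Im u)\<bar> * cos t) (sin t * sin (pi * Im u)) = of_real \<bar>sin (pi * Im u)\<bar> * cis (\<epsilon> * t)" for t
    by (auto simp: complex_eq_iff \<epsilon>_def)
  have "polar_power m (of_real \<bar>sin (pi * Im u)\<bar> * cis (\<epsilon> * (pi * Re u))) =
      of_real \<bar>sin (pi * Im u)\<bar> * cis (real m * (\<epsilon> * (pi * Re u)))"
    by (rule polar_power_polar[OF m]) simp
  moreover have "real m * (\<epsilon> * (pi * Re u)) = \<epsilon> * (pi * (real m * Re u))" by simp
  ultimately show ?thesis unfolding S2_power_def q_pt_def S2z_S2pt S2pt_2 complex.sel z by (simp only:)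
qed

text \<open>\<open>q_map\<close> has degree 1 and semiconjugates F to \<open>S2_power m\<close>, so
  the two maps have the same degree by multiplicativity.\<close>

lemma Brouwer_degree2_lattes_1:
  assumes m: "1 \<le> m" shows "\<exists>e. e \<noteq> 0 \<and> Brouwer_degree2 2 (lattes.F m 1) = int m * e"
proof -
  interpret lattes m 1 by unfold_locales (use m in auto)
  have cF: "continuous_map (nsphere 2) (nsphere 2) F"
    unfolding continuous_map_S2_iff using continuous_F F_in by blast
  have cq: "continuous_map (nsphere 2) (nsphere 2) q_map"
    unfolding continuous_map_S2_iff using continuous_q_map q_map_in_S2 by blast
  have cp: "continuous_map (nsphere 2) (nsphere 2) (S2_power m)"
    unfolding continuous_map_S2_iff using continuous_S2_power S2_power_in m by auto
  have "Brouwer_degree2 2 (q_map \<circ> F) = Brouwer_degree2 2 (S2_power m \<circ> q_map)"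
  proof (rule Brouwer_degree2_eq)
    fix x assume "x \<in> S2"
    then obtain u where u: "x = P0 u" using range_P0 by blast
    have "A u = Complex (real m * Re u) (Im u)" by (simp add: A_def del: One_nat_def)
    then show "(q_map \<circ> F) x = (S2_power m \<circ> q_map) x"
      unfolding u o_apply F_P0 q_map_P0 using S2_power_q_pt[of m u] m by simp
  qed
  moreover have "Brouwer_degree2 2 q_map = 1"
    using Brouwer_degree2_homotopic[OF homotopic_q_map] by simp
  ultimately have "Brouwer_degree2 2 F = Brouwer_degree2 2 (S2_power m)"
    by (simp add: Brouwer_degree2_compose cF cq cp del: One_nat_def)
  then show ?thesis using Brouwer_degree2_S2_power[of m] m by (simp del: One_nat_def)
qed

section \<open>Exchanges of coordinates and the reflection\<close>

definition S2_swap :: "nat \<Rightarrow> (nat \<Rightarrow> real) \<Rightarrow> nat \<Rightarrow> real" where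
  "S2_swap j x i = x (if i = 0 then j else if i = j then 0 else i)"

lemma S2_swap_swap: "S2_swap j (S2_swap j x) = x"
  by (rule ext) (simp add: S2_swap_def)

lemma S2_swap_in: "j = 1 \<or> j = 2 \<Longrightarrow> x \<in> S2 \<Longrightarrow> S2_swap j x \<in> S2"
  unfolding S2_iff by (auto simp: S2_swap_def)

lemma continuous_S2_swap: "continuous_on S (S2_swap j)"
  unfolding S2_swap_def by (rule continuous_on_coordinatewise_then_product) (rule continuous_on_coord)

lemma continuous_map_S2_swap: "j = 1 \<or> j = 2 \<Longrightarrow> continuous_map (nsphere 2) (nsphere 2) (S2_swap j)"
  unfolding continuous_map_S2_iff using continuous_S2_swap S2_swap_in by blast

text \<open>The exchange is an involution, so its degree has square 1 and cancels in a conjugation,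
  whatever its sign.\<close>

lemma Brouwer_degree2_conj_swap:
  assumes j: "j = 1 \<or> j = 2" and f: "continuous_map (nsphere 2) (nsphere 2) f"
  shows "Brouwer_degree2 2 (S2_swap j \<circ> f \<circ> S2_swap j) = Brouwer_degree2 2 f"
proof -
  note c = continuous_map_S2_swap[OF j]
  have "S2_swap j \<circ> S2_swap j = id" by (rule ext) (simp add: S2_swap_swap)
  then have ss: "Brouwer_degree2 2 (S2_swap j) * Brouwer_degree2 2 (S2_swap j) = 1"
    using Brouwer_degree2_compose[OF c c] by simp
  have "Brouwer_degree2 2 (S2_swap j \<circ> f \<circ> S2_swap j) =
      Brouwer_degree2 2 f * (Brouwer_degree2 2 (S2_swap j) * Brouwer_degree2 2 (S2_swap j))"
    unfolding Brouwer_degree2_compose[OF c continuous_map_compose[OF f c]] Brouwer_degree2_compose[OF f c]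
    by (simp only: mult_ac)
  then show ?thesis unfolding ss by simp
qed

definition S2_refl :: "(nat \<Rightarrow> real) \<Rightarrow> nat \<Rightarrow> real" where
  "S2_refl x i = (if i = 1 then - x i else x i)"

lemma homeomorphism_S2_refl: "homeomorphism S2 S2 S2_refl S2_refl"
proof
  have c: "continuous_on S2 S2_refl"
    unfolding S2_refl_def
  proof (rule continuous_on_coordinatewise_then_product)
    fix i :: nat
    show "continuous_on S2 (\<lambda>x. if i = 1 then - x i else x i)"
      by (cases "i = 1") (simp_all add: continuous_on_minus continuous_on_coord)
  qed
  show "continuous_on S2 S2_refl" "continuous_on S2 S2_refl" by (rule c)+
  have "S2_refl ` S2 \<subseteq> S2" by (auto simp: S2_iff S2_refl_def)
  then show "S2_refl ` S2 \<subseteq> S2" "S2_refl ` S2 \<subseteq> S2" by blast+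
  have "S2_refl (S2_refl x) = x" for x by (rule ext) (simp add: S2_refl_def)
  then show "S2_refl (S2_refl x) = x" "S2_refl (S2_refl x) = x" for x by blast+
qed

text \<open>The exchange of coordinates 0 and 1 conjugates this reflection to the one in coordinate
  0.\<close>

lemma Brouwer_degree2_S2_refl: "Brouwer_degree2 2 S2_refl = - 1"
proof -
  let ?r = "\<lambda>x i. if i = 0 then - x i else x i :: real"
  have "continuous_map (nsphere 2) (nsphere 2) ?r"
  proof -
    have "continuous_on S2 ?r"
    proof (rule continuous_on_coordinatewise_then_product)
      fix i :: nat
      show "continuous_on S2 (\<lambda>x. if i = 0 then - x i else x i)"
        by (cases "i = 0") (simp_all add: continuous_on_minus continuous_on_coord)
    qed
    moreover have "?r ` S2 \<subseteq> S2" by (auto simp: S2_iff)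
    ultimately show ?thesis unfolding continuous_map_S2_iff by blast
  qed
  from Brouwer_degree2_conj_swap[OF _ this, of 1] have "Brouwer_degree2 2 (S2_swap 1 \<circ> ?r \<circ> S2_swap 1) = - 1"
    using Brouwer_degree2_reflection[of 2] by simp
  moreover have "S2_swap 1 \<circ> ?r \<circ> S2_swap 1 = S2_refl"
    by (rule ext)+ (simp add: S2_swap_def S2_refl_def)
  ultimately show ?thesis by simp
qed

lemma S2_refl_P0_gint:
  assumes "e \<in> gint" shows "S2_refl (P0 e) = P0 e"
proof -
  obtain m n :: int where "e = Complex (of_int m) (of_int n)" using assms gint_Complex by blast
  then have "pZ e = 0" by (simp add: pZ_def)
  then show ?thesis by (intro ext) (simp add: S2_refl_def P0_def)
qed

lemma S2_swap_P0: "S2_swap 2 (P0 u) = P0 (Complex (Im u) (Re u))"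
proof
  fix i :: nat
  consider "i = 0" | "i = 1" | "i = 2" | "2 < i" by linarith
  moreover have "pR (Complex (Im u) (Re u)) = pR u"
    by (simp add: pR_def pX_def pY_def pZ_def mult.commute add_ac)
  ultimately show "S2_swap 2 (P0 u) i = P0 (Complex (Im u) (Re u)) i"
    by cases (auto simp: S2_swap_def P0_def pX_def pY_def pZ_def)
qed

text \<open>diag(m, 2) is diag(m, 1) after diag(1, 2), and exchanging coordinates 0 and 2 of the
  sphere exchanges real and imaginary parts, which turns diag(1, 2) into diag(2, 1). The degree is
  thus an even nonzero number.\<close>

lemma Brouwer_degree2_lattes_2:
  assumes m: "1 \<le> m" shows "2 \<le> \<bar>Brouwer_degree2 2 (lattes.F m 2)\<bar>"
proof -
  interpret M: lattes m 1 by unfold_locales (use m in auto)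
  interpret T: lattes 2 1 by unfold_locales auto
  interpret MT: lattes m 2 by unfold_locales (use m in auto)
  have cM: "continuous_map (nsphere 2) (nsphere 2) M.F"
    unfolding continuous_map_S2_iff using M.continuous_F M.F_in by blast
  have cT: "continuous_map (nsphere 2) (nsphere 2) T.F"
    unfolding continuous_map_S2_iff using T.continuous_F T.F_in by blast
  let ?T = "S2_swap 2 \<circ> T.F \<circ> S2_swap 2"
  have cT': "continuous_map (nsphere 2) (nsphere 2) ?T"
    by (rule continuous_map_compose[OF continuous_map_S2_swap continuous_map_compose[OF cT continuous_map_S2_swap]]) simp_all
  have "Brouwer_degree2 2 MT.F = Brouwer_degree2 2 (M.F \<circ> ?T)"
  proof (rule Brouwer_degree2_eq)
    fix x assume "x \<in> S2"
    then obtain u where u: "x = P0 u" using range_P0 by blast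
    have "M.A (Complex (Im (T.A (Complex (Im u) (Re u)))) (Re (T.A (Complex (Im u) (Re u))))) = MT.A u"
      by (simp add: M.A_def T.A_def MT.A_def del: One_nat_def)
    then show "MT.F x = (M.F \<circ> ?T) x"
      unfolding u o_apply S2_swap_P0 T.F_P0 M.F_P0 MT.F_P0 by (simp only:)
  qed
  also have "\<dots> = Brouwer_degree2 2 M.F * Brouwer_degree2 2 T.F"
    unfolding Brouwer_degree2_compose[OF cT' cM] using Brouwer_degree2_conj_swap[OF _ cT, of 2] by simp
  finally have deg: "Brouwer_degree2 2 MT.F = Brouwer_degree2 2 M.F * Brouwer_degree2 2 T.F" .
  obtain e e' where e: "e \<noteq> 0" "Brouwer_degree2 2 M.F = int m * e" "e' \<noteq> 0" "Brouwer_degree2 2 T.F = int 2 * e'"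
    using Brouwer_degree2_lattes_1[OF m] Brouwer_degree2_lattes_1[of 2] by auto
  have "Brouwer_degree2 2 MT.F = 2 * (int m * e * e')" unfolding deg e by simp
  moreover have "int m * e * e' \<noteq> 0" using e m by simp
  ultimately show ?thesis by presburger
qed

text \<open>\<open>n\<close> prescribes the numbers of non-critical points over the corners. The
  degree is bounded only in absolute value, because a reflection that fixes the corners can reverse
  its sign later.\<close>

definition pillow_model :: "nat \<Rightarrow> (complex \<Rightarrow> nat) \<Rightarrow> ((nat \<Rightarrow> real) \<Rightarrow> (nat \<Rightarrow> real)) \<Rightarrow> bool" where
  "pillow_model d n f \<longleftrightarrow>
     continuous_on S2 f \<and> f ` S2 \<subseteq> S2 \<and> 2 \<le> \<bar>Brouwer_degree2 2 f\<bar> \<and>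
     (\<forall>x\<in>S2. has_local_degree f x 1 \<or> has_local_degree f x 2) \<and>
     (\<forall>x\<in>S2. has_local_degree f x 2 \<longrightarrow> f x \<in> P0 ` E4) \<and>
     (\<forall>e\<in>E4. finite {x \<in> S2. f x = P0 e}) \<and>
     (\<forall>e\<in>E4. 2 * card {x \<in> S2. f x = P0 e \<and> has_local_degree f x 2} + n e = d \<and>
        card {x \<in> S2. f x = P0 e \<and> has_local_degree f x 1} = n e)"

lemma (in lattes) pillow_model_F:
  assumes g: "\<And>v. v \<in> E4 \<Longrightarrow> g v \<in> E4 \<and> A v \<in> cls (g v)" and deg: "2 \<le> \<bar>Brouwer_degree2 2 F\<bar>"
    and n: "\<And>e. e \<in> E4 \<Longrightarrow> n e = card {v \<in> E4. g v = e}"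
  shows "pillow_model (a * b) n F"
proof -
  have ne: "n e = card {v \<in> E4. A v \<in> cls e}" if "e \<in> E4" for e
    using n[OF that] fibre_count[OF g that] by simp
  have "F x \<in> P0 ` E4" if "x \<in> S2" "has_local_degree F x 2" for x
  proof (rule ccontr)
    assume "F x \<notin> P0 ` E4"
    then have "F x \<notin> P0 ` gint" using P_gint_E4[OF P0.pillow_axioms] by simp
    then have "has_local_degree F x 1" by (rule cov.deg1[OF \<open>x \<in> S2\<close>])
    then show False using has_local_degree_unique[OF _ that(2)] by fastforce
  qed
  then show ?thesis
    unfolding pillow_model_def
    using continuous_F F_in deg cov.deg12 cov.finite_fibre P0_in_S2 card_crit_F card_ncrit_F ne
    by (auto simp: cov.crit_def cov.ncrit_def)
qed

theorem pillow_model_odd: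
  assumes d: "2 \<le> d" "odd d" obtains f where "pillow_model d (\<lambda>_. 1) f"
proof -
  interpret lattes d 1 by unfold_locales (use d in auto)
  obtain k where k: "d = 2 * k + 1" using d(2) by (auto elim: oddE)
  obtain e where e: "e \<noteq> 0" "Brouwer_degree2 2 F = int d * e" using Brouwer_degree2_lattes_1[of d] d by auto
  have "int d * 1 \<le> int d * \<bar>e\<bar>" using e(1) by (intro mult_left_mono) auto
  moreover have "\<bar>Brouwer_degree2 2 F\<bar> = int d * \<bar>e\<bar>" unfolding e(2) abs_mult by simp
  ultimately have "2 \<le> \<bar>Brouwer_degree2 2 F\<bar>" using d(1) by linarith
  then have "pillow_model (d * 1) (\<lambda>_. 1) F"
  proof (rule pillow_model_F[where g = "\<lambda>v. v", rotated])
    fix v assume v: "v \<in> E4"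
    \<comment> \<open>For odd d the map A is the identity modulo 2, so exactly one corner lies over
      each corner.\<close>
    have "A v = v + 2 * Complex (real k * Re v) 0" unfolding A_def by (simp add: k complex_eq_iff algebra_simps)
    moreover have "Complex (real k * Re v) 0 \<in> gint" using E4_gint[OF v] by (simp add: gint_def)
    ultimately show "v \<in> E4 \<and> A v \<in> cls v" using v by (auto simp: cls_def)
    have "{w \<in> E4. w = v} = {v}" using v by auto
    then show "1 = card {w \<in> E4. w = v}" by simp
  qed
  then show ?thesis using that unfolding mult_1_right by blast
qed

theorem pillow_model_even:
  assumes d: "2 \<le> d" "even d" obtains f where "pillow_model d (\<lambda>e. if e = 0 \<or> e = \<i> then 2 else 0) f"
proof -
  interpret lattes d 1 by unfold_locales (use d in auto)
  obtain k where k: "d = 2 * k" using d(2) by (auto elim: evenE)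
  obtain e where e: "e \<noteq> 0" "Brouwer_degree2 2 F = int d * e" using Brouwer_degree2_lattes_1[of d] d by auto
  have "int d * 1 \<le> int d * \<bar>e\<bar>" using e(1) by (intro mult_left_mono) auto
  moreover have "\<bar>Brouwer_degree2 2 F\<bar> = int d * \<bar>e\<bar>" unfolding e(2) abs_mult by simp
  ultimately have "2 \<le> \<bar>Brouwer_degree2 2 F\<bar>" using d(1) by linarith
  then have "pillow_model (d * 1) (\<lambda>e. if e = 0 \<or> e = \<i> then 2 else 0) F"
  proof (rule pillow_model_F[where g = "\<lambda>v. Complex 0 (Im v)", rotated])
    fix v assume v: "v \<in> E4"
    have g: "Complex 0 (Im v) \<in> E4" using v by (auto simp: E4_def complex_eq_iff)
    \<comment> \<open>For even d the real part disappears modulo 2, so two corners lie over each of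
      0 and \<i>.\<close>
    have "A v = Complex 0 (Im v) + 2 * Complex (real k * Re v) 0" unfolding A_def by (simp add: k complex_eq_iff)
    moreover have "Complex (real k * Re v) 0 \<in> gint" using E4_gint[OF v] by (simp add: gint_def)
    ultimately show "Complex 0 (Im v) \<in> E4 \<and> A v \<in> cls (Complex 0 (Im v))" using g by (auto simp: cls_def)
    have "{w \<in> E4. Complex 0 (Im w) = v} = (if v = 0 then {0, 1} else if v = \<i> then {\<i>, 1 + \<i>} else {})"
      using v by (auto simp: E4_def complex_eq_iff)
    then show "(if v = 0 \<or> v = \<i> then 2 else 0) = card {w \<in> E4. Complex 0 (Im w) = v}"
      by (simp add: complex_eq_iff)
  qed
  then show ?thesis using that unfolding mult_1_right by blast
qed

theorem pillow_model_four:
  assumes d: "2 \<le> d" "4 dvd d" obtains f where "pillow_model d (\<lambda>e. if e = 0 then 4 else 0) f"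
proof -
  obtain k where k: "d = 4 * k" using d(2) by (auto elim: dvdE)
  interpret lattes "2 * k" 2 by unfold_locales (use d k in auto)
  have "2 \<le> \<bar>Brouwer_degree2 2 F\<bar>" by (rule Brouwer_degree2_lattes_2[of "2 * k"]) (use d k in auto)
  then have "pillow_model (2 * k * 2) (\<lambda>e. if e = 0 then 4 else 0) F"
  proof (rule pillow_model_F[where g = "\<lambda>v. 0", rotated])
    fix v assume v: "v \<in> E4"
    \<comment> \<open>Both diagonal entries 2k and 2 are even, so all four corners lie over 0; their
      product 4k is the degree.\<close>
    have "A v = 0 + 2 * Complex (real k * Re v) (Im v)" by (simp add: A_def complex_eq_iff)
    moreover have "Complex (real k * Re v) (Im v) \<in> gint" using E4_gint[OF v] by (simp add: gint_def)
    ultimately show "0 \<in> E4 \<and> A v \<in> cls 0" by (auto simp: cls_def E4_def)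
    have "{w \<in> E4. 0 = v} = (if v = 0 then E4 else {})" by auto
    then show "(if v = 0 then 4 else 0) = card {w \<in> E4. 0 = v}" using card_E4 by simp
  qed
  then show ?thesis using that k by simp
qed

section \<open>Realizing portraits\<close>

lemma has_local_degree_comp_homeomorphism:
  assumes h: "homeomorphism S2 S2 h h'" and x: "x \<in> S2" and f: "has_local_degree f (h x) d"
  shows "has_local_degree (f \<circ> h) x d"
proof -
  obtain U V \<phi> \<phi>' \<psi> \<psi>' where pc: "power_charts f (h x) d U V \<phi> \<phi>' \<psi> \<psi>'"
    using f unfolding has_local_degree_iff by blast
  note * = power_chartsD[OF pc]
  have US: "U \<subseteq> S2" using *(1) openin_imp_subset by blast
  have h': "homeomorphism S2 S2 h' h" using h by (rule homeomorphism_symD)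
  have hU: "h (h' u) = u" if "u \<in> U" for u using homeomorphism_apply2[OF h] that US by blast
  have "homeomorphism (h' ` U) U h h'"
    by (rule homeomorphism_of_subsets[OF h]) (use US hU homeomorphism_image2[OF h] in \<open>force simp: image_image\<close>)+
  from homeomorphism_compose[OF this *(7)] have 7: "homeomorphism (h' ` U) (ball 0 1) (\<phi> \<circ> h) (h' \<circ> \<phi>')" .
  have "power_charts (f \<circ> h) x d (h' ` U) V (\<phi> \<circ> h) (h' \<circ> \<phi>') \<psi> \<psi>'"
    unfolding power_charts_def
  proof (intro conjI ballI)
    show "openin (top_of_set S2) (h' ` U)" by (rule homeomorphism_imp_open_map[OF h' *(1)])
    show "x \<in> h' ` U" using *(3) homeomorphism_apply1[OF h x] by force
    show "(f \<circ> h) u \<in> V" "\<psi> ((f \<circ> h) u) = (\<phi> \<circ> h) u ^ d" if "u \<in> h' ` U" for u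
      using that *(9,10) hU by auto
  qed (use * 7 in auto)
  then show ?thesis unfolding has_local_degree_iff by blast
qed

lemma fibrewise_injection:
  assumes fin: "finite A" and card: "\<And>y. y \<in> g ` A \<Longrightarrow> finite (B y) \<and> card {a \<in> A. g a = y} \<le> card (B y)"
    and disj: "\<And>y z b. b \<in> B y \<Longrightarrow> b \<in> B z \<Longrightarrow> y = z"
  obtains \<theta> where "inj_on \<theta> A" "\<And>a. a \<in> A \<Longrightarrow> \<theta> a \<in> B (g a)"
proof -
  have "\<exists>t. inj_on t {a \<in> A. g a = y} \<and> t ` {a \<in> A. g a = y} \<subseteq> B y" if "y \<in> g ` A" for y
    using card_le_inj[of "{a \<in> A. g a = y}" "B y"] card[OF that] fin by auto
  then obtain t where t: "\<And>y. y \<in> g ` A \<Longrightarrow> inj_on (t y) {a \<in> A. g a = y} \<and> t y ` {a \<in> A. g a = y} \<subseteq> B y"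
    by metis
  show ?thesis
  proof (rule that[of "\<lambda>a. t (g a) a"])
    show B: "t (g a) a \<in> B (g a)" if "a \<in> A" for a
      using t[of "g a"] that by blast
    show "inj_on (\<lambda>a. t (g a) a) A"
    proof (rule inj_onI)
      fix a b assume ab: "a \<in> A" "b \<in> A" "t (g a) a = t (g b) b"
      then have g: "g a = g b" using B disj by metis
      then show "a = b" using t[of "g a"] ab by (auto dest: inj_onD)
    qed
  qed
qed

text \<open>\<open>\<theta>\<close> places a vertex at a point of the model fibre over the corner of
  its successor, with the right local degree. A homeomorphism k takes each corner to the place of
  its vertex, f is \<open>f0 \<circ> k\<close>, and \<open>\<eta>\<close> is the inverse of k after
  \<open>\<theta>\<close>. Then \<open>\<eta>\<close> of a postcritical vertex is its corner, and
  the dynamics closes up.\<close>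

theorem portrait_realization:
  assumes model: "pillow_model d n f0"
    and fin: "finite V" and CV: "C \<subseteq> V" and PV: "V = C \<union> Pc" and nxt: "\<And>v. v \<in> V \<Longrightarrow> nxt v \<in> Pc"
    and p: "bij_betw p E4 Pc"
    and a: "\<And>e. e \<in> E4 \<Longrightarrow> 2 * card {v \<in> C. nxt v = p e} + n e = d"
    and b: "\<And>e. e \<in> E4 \<Longrightarrow> card {v \<in> V - C. nxt v = p e} \<le> n e"
    and orbit: "Pc = (\<Union>k\<in>{1..}. (nxt ^^ k) ` C)"
  shows "\<exists>f \<eta>. NET_map f \<and> inj_on \<eta> V \<and> \<eta> ` V = critical_points f \<union> postcritical_set f \<and>
    (\<forall>v\<in>V. f (\<eta> v) = \<eta> (nxt v)) \<and> (\<forall>v\<in>V. local_degree f (\<eta> v) = (if v \<in> C then 2 else 1))"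
proof -
  define c where "c = inv_into E4 p"
  have cE: "c q \<in> E4" "p (c q) = q" if "q \<in> Pc" for q
    using that p unfolding c_def bij_betw_def by (simp_all add: inv_into_into f_inv_into_f)
  define y where "y q = P0 (c q)" for q
  have y_in: "y q \<in> S2" for q unfolding y_def by (rule P0_in_S2)
  have inj_y: "inj_on y Pc"
  proof (rule inj_onI)
    fix q r assume qr: "q \<in> Pc" "r \<in> Pc" "y q = y r"
    then have "c q = c r" using inj_on_E4[OF P0.pillow_axioms] cE(1) unfolding y_def by (auto dest: inj_onD)
    then show "q = r" using cE(2) qr by metis
  qed
  have cont: "continuous_on S2 f0" "f0 ` S2 \<subseteq> S2" and dg: "2 \<le> \<bar>Brouwer_degree2 2 f0\<bar>"
    and d12: "\<And>x. x \<in> S2 \<Longrightarrow> has_local_degree f0 x 1 \<or> has_local_degree f0 x 2"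
    and cv: "\<And>x. x \<in> S2 \<Longrightarrow> has_local_degree f0 x 2 \<Longrightarrow> f0 x \<in> P0 ` E4"
    and fF: "\<And>e. e \<in> E4 \<Longrightarrow> finite {x \<in> S2. f0 x = P0 e}"
    and n2: "\<And>e. e \<in> E4 \<Longrightarrow> 2 * card {x \<in> S2. f0 x = P0 e \<and> has_local_degree f0 x 2} + n e = d"
    and n1: "\<And>e. e \<in> E4 \<Longrightarrow> card {x \<in> S2. f0 x = P0 e \<and> has_local_degree f0 x 1} = n e"
    using model unfolding pillow_model_def by blast+
  define F where "F j q = {x \<in> S2. f0 x = y q \<and> has_local_degree f0 x j}" for j q
  have cF2: "card (F 2 q) = card {v \<in> C. nxt v = q}" and cF1: "card {v \<in> V - C. nxt v = q} \<le> card (F 1 q)" if "q \<in> Pc" for q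
    using n2[OF cE(1)[OF that]] a[OF cE(1)[OF that]] n1[OF cE(1)[OF that]] b[OF cE(1)[OF that]] cE(2)[OF that]
    by (simp_all add: F_def y_def)
  have fC: "finite C" "finite (V - C)" using fin CV finite_subset by auto
  have fF': "finite (F j q)" if "q \<in> Pc" for j q
    by (rule finite_subset[OF _ fF[OF cE(1)[OF that]]]) (auto simp: F_def y_def)
  have dj: "q = r" if "q \<in> Pc" "r \<in> Pc" "x \<in> F j q" "x \<in> F j r" for q r j x
    using that inj_y unfolding F_def by (auto dest: inj_onD)
  have nC: "nxt v \<in> Pc" if "v \<in> C" for v using nxt CV that by blast
  \<comment> \<open>The guard on q empties the target sets outside Pc:
    \<open>fibrewise_injection\<close> wants disjointness for all arguments, while y is injective
    only on Pc.\<close>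
  obtain \<theta>2 where t2: "inj_on \<theta>2 C" "\<And>v. v \<in> C \<Longrightarrow> \<theta>2 v \<in> F 2 (nxt v) \<and> nxt v \<in> Pc"
  proof (rule fibrewise_injection[of C nxt "\<lambda>q. {x \<in> F 2 q. q \<in> Pc}"])
    show "finite C" by (rule fC)
    show "finite {x \<in> F 2 q. q \<in> Pc} \<and> card {v \<in> C. nxt v = q} \<le> card {x \<in> F 2 q. q \<in> Pc}" if "q \<in> nxt ` C" for q
      using that nC cF2 fF' by auto
    show "q = r" if "x \<in> {x \<in> F 2 q. q \<in> Pc}" "x \<in> {x \<in> F 2 r. r \<in> Pc}" for q r x
      using that dj by blast
  qed blast
  obtain \<theta>1 where t1: "inj_on \<theta>1 (V - C)" "\<And>v. v \<in> V - C \<Longrightarrow> \<theta>1 v \<in> F 1 (nxt v) \<and> nxt v \<in> Pc"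
  proof (rule fibrewise_injection[of "V - C" nxt "\<lambda>q. {x \<in> F 1 q. q \<in> Pc}"])
    show "finite (V - C)" by (rule fC)
    show "finite {x \<in> F 1 q. q \<in> Pc} \<and> card {v \<in> V - C. nxt v = q} \<le> card {x \<in> F 1 q. q \<in> Pc}" if "q \<in> nxt ` (V - C)" for q
      using that nxt cF1 fF' by auto
    show "q = r" if "x \<in> {x \<in> F 1 q. q \<in> Pc}" "x \<in> {x \<in> F 1 r. r \<in> Pc}" for q r x
      using that dj by blast
  qed blast
  define \<theta> where "\<theta> v = (if v \<in> C then \<theta>2 v else \<theta>1 v)" for v
  have tF: "\<theta> v \<in> F (if v \<in> C then 2 else 1) (nxt v)" if "v \<in> V" for v
    using t1(2)[of v] t2(2)[of v] that by (simp add: \<theta>_def)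
  have tS: "\<theta> v \<in> S2" and ft: "f0 (\<theta> v) = y (nxt v)" and
    dt: "has_local_degree f0 (\<theta> v) (if v \<in> C then 2 else 1)" if "v \<in> V" for v
    using tF[OF that] by (auto simp: F_def)
  have inj_t: "inj_on \<theta> V"
  proof (rule inj_onI)
    fix u v assume uv: "u \<in> V" "v \<in> V" "\<theta> u = \<theta> v"
    have "(if u \<in> C then 2 else 1 :: nat) = (if v \<in> C then 2 else 1)"
      by (rule has_local_degree_unique[OF dt[OF uv(1)]]) (use dt[OF uv(2)] uv(3) in simp)
    then have "u \<in> C \<longleftrightarrow> v \<in> C" by (simp split: if_splits)
    then show "u = v" using uv inj_onD[OF t1(1), of u v] inj_onD[OF t2(1), of u v] by (cases "u \<in> C") (auto simp: \<theta>_def)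
  qed
  \<comment> \<open>\<open>\<theta>2\<close> injects into each critical fibre of the model a set of
    the same size, so no critical point of the model is left out.\<close>
  have crit: "x \<in> \<theta> ` C" if x: "x \<in> S2" "has_local_degree f0 x 2" for x
  proof -
    obtain e where e: "e \<in> E4" "f0 x = P0 e" using cv[OF x] by blast
    define q where "q = p e"
    have q: "q \<in> Pc" using e(1) p unfolding q_def bij_betw_def by blast
    have "c q = e" using e(1) p unfolding c_def q_def bij_betw_def by (simp add: inv_into_f_f)
    then have xF: "x \<in> F 2 q" using x e by (simp add: F_def y_def)
    have im: "\<theta>2 ` {v \<in> C. nxt v = q} \<subseteq> F 2 q" using t2(2) by auto
    have "inj_on \<theta>2 {v \<in> C. nxt v = q}" by (rule inj_on_subset[OF t2(1)]) auto
    then have "card (\<theta>2 ` {v \<in> C. nxt v = q}) = card (F 2 q)" using cF2[OF q] by (simp add: card_image)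
    then have "\<theta>2 ` {v \<in> C. nxt v = q} = F 2 q" by (rule card_subset_eq[OF fF'[OF q] im])
    then obtain v where "v \<in> C" "x = \<theta>2 v" using xF by blast
    then show ?thesis by (auto simp: \<theta>_def)
  qed
  have finP: "finite Pc" and PsV: "Pc \<subseteq> V" using fin PV by auto
  obtain h h' where h: "homeomorphism S2 S2 h h'" "\<And>q. q \<in> Pc \<Longrightarrow> h (y q) = \<theta> q"
    by (rule S2_moving_points[OF finP inj_y _ inj_on_subset[OF inj_t PsV]]) (use y_in tS PsV in auto)
  have cm: "continuous_map (nsphere 2) (nsphere 2) f0"
    unfolding continuous_map_S2_iff using cont by blast
  have cmh: "continuous_map (nsphere 2) (nsphere 2) k" if "homeomorphism S2 S2 k k'" for k k'
    unfolding continuous_map_S2_iff using homeomorphism_cont1[OF that] homeomorphism_image1[OF that] by simp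
  have adeg: "\<bar>Brouwer_degree2 2 k\<bar> = 1" if "homeomorphism S2 S2 k k'" for k k'
  proof (rule Brouwer_degree2_homeomorphic_map)
    have "homeomorphic_maps (top_of_set S2) (top_of_set S2) k k'"
      using that by (simp only: homeomorphic_maps_iff_homeomorphism)
    then show "homeomorphic_map (nsphere 2) (nsphere 2) k"
      unfolding homeomorphic_map_maps top_of_set_S2 by blast
  qed
  obtain k k' where k: "homeomorphism S2 S2 k k'" "\<And>q. q \<in> Pc \<Longrightarrow> k (y q) = \<theta> q" "2 \<le> Brouwer_degree2 2 (f0 \<circ> k)"
  proof (cases "0 \<le> Brouwer_degree2 2 (f0 \<circ> h)")
    case True
    have "\<bar>Brouwer_degree2 2 (f0 \<circ> h)\<bar> = \<bar>Brouwer_degree2 2 f0\<bar>"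
      unfolding Brouwer_degree2_compose[OF cmh[OF h(1)] cm] abs_mult using adeg[OF h(1)] by simp
    then have "2 \<le> Brouwer_degree2 2 (f0 \<circ> h)" using True dg by linarith
    with h show thesis by (rule that)
  next
    case False
    \<comment> \<open>The reflection fixes all corners, so precomposing h with it reverses the sign
      of the degree while corners still go to the same places.\<close>
    have hr: "homeomorphism S2 S2 (h \<circ> S2_refl) (S2_refl \<circ> h')" by (rule homeomorphism_compose[OF homeomorphism_S2_refl h(1)])
    have cfh: "continuous_map (nsphere 2) (nsphere 2) (f0 \<circ> h)" by (rule continuous_map_compose[OF cmh[OF h(1)] cm])
    have "\<bar>Brouwer_degree2 2 (f0 \<circ> h)\<bar> = \<bar>Brouwer_degree2 2 f0\<bar>"
      unfolding Brouwer_degree2_compose[OF cmh[OF h(1)] cm] abs_mult using adeg[OF h(1)] by simp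
    moreover have "Brouwer_degree2 2 (f0 \<circ> (h \<circ> S2_refl)) = - Brouwer_degree2 2 (f0 \<circ> h)"
      unfolding comp_assoc[symmetric] Brouwer_degree2_compose[OF cmh[OF homeomorphism_S2_refl] cfh] Brouwer_degree2_S2_refl by simp
    ultimately have "2 \<le> Brouwer_degree2 2 (f0 \<circ> (h \<circ> S2_refl))" using False dg by linarith
    moreover have "(h \<circ> S2_refl) (y q) = \<theta> q" if "q \<in> Pc" for q
      using h(2)[OF \<open>q \<in> Pc\<close>] S2_refl_P0_gint[OF E4_gint[OF cE(1)[OF \<open>q \<in> Pc\<close>]]] by (simp add: y_def)
    ultimately show thesis by (intro that[OF hr])
  qed
  define f where "f = f0 \<circ> k"
  define \<eta> where "\<eta> v = k' (\<theta> v)" for v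
  have kS: "k x \<in> S2" "k' x \<in> S2" if "x \<in> S2" for x
    using homeomorphism_image1[OF k(1)] homeomorphism_image2[OF k(1)] that by blast+
  have k_eta: "k (\<eta> v) = \<theta> v" and eS: "\<eta> v \<in> S2" if "v \<in> V" for v
    unfolding \<eta>_def using homeomorphism_apply2[OF k(1) tS[OF that]] kS tS[OF that] by blast+
  have eta_P: "\<eta> q = y q" if "q \<in> Pc" for q
    unfolding \<eta>_def using k(2)[OF that] homeomorphism_apply1[OF k(1) y_in] by metis
  have fe: "f (\<eta> v) = \<eta> (nxt v)" if "v \<in> V" for v
    unfolding f_def o_apply k_eta[OF that] ft[OF that] using eta_P nxt that by simp
  have ldf: "has_local_degree f x j" if "x \<in> S2" "has_local_degree f0 (k x) j" for x j
    unfolding f_def by (rule has_local_degree_comp_homeomorphism[OF k(1) that])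
  have lde: "local_degree f (\<eta> v) = (if v \<in> C then 2 else 1)" if "v \<in> V" for v
    by (rule local_degree_eq, rule ldf[OF eS[OF that]], unfold k_eta[OF that], rule dt[OF that])
  have critf: "critical_points f = \<eta> ` C"
  proof
    show "\<eta> ` C \<subseteq> critical_points f" using lde eS CV by (auto simp: critical_points_def)
    show "critical_points f \<subseteq> \<eta> ` C"
    proof
      fix x assume "x \<in> critical_points f"
      then have x: "x \<in> S2" "1 < local_degree f x" by (auto simp: critical_points_def)
      have "has_local_degree f0 (k x) 2"
      proof (rule ccontr)
        assume "\<not> has_local_degree f0 (k x) 2"
        then have "has_local_degree f x 1" using ldf[OF x(1)] d12 kS x(1) by blast
        then show False using x(2) local_degree_eq by fastforce
      qed
      then have "k x \<in> \<theta> ` C" using crit kS x(1) by blast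
      then show "x \<in> \<eta> ` C" unfolding \<eta>_def using homeomorphism_apply1[OF k(1) x(1)] by force
    qed
  qed
  have iter: "(nxt ^^ j) v \<in> V \<and> (f ^^ j) (\<eta> v) = \<eta> ((nxt ^^ j) v)" if "v \<in> V" for j v
  proof (induction j)
    case (Suc j)
    then show ?case using fe nxt PsV by auto
  qed (use that in simp)
  have pc: "postcritical_set f = \<eta> ` Pc"
  proof -
    have "(f ^^ j) ` \<eta> ` C = \<eta> ` (nxt ^^ j) ` C" for j
      unfolding image_image by (rule image_cong[OF refl]) (use iter CV in blast)
    then show ?thesis unfolding postcritical_set_def critf orbit image_UN by simp
  qed
  have inj_eta: "inj_on \<eta> V"
    by (rule inj_onI) (metis k_eta inj_onD[OF inj_t])
  have "card (postcritical_set f) = 4"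
    unfolding pc card_image[OF inj_on_subset[OF inj_eta PsV]] using bij_betw_same_card[OF p] card_E4 by simp
  moreover have "branched_covering f"
    unfolding branched_covering_def f_def
    using continuous_map_compose[OF cmh[OF k(1)] cm] ldf[unfolded f_def] d12 kS by blast
  moreover have "\<forall>x\<in>critical_points f. local_degree f x = 2"
    unfolding critf using lde CV by auto
  moreover have "2 \<le> Brouwer_degree2 2 f" unfolding f_def by (rule k(3))
  moreover have "finite (postcritical_set f)" unfolding pc using finP by simp
  ultimately have "NET_map f" unfolding NET_map_def Thurston_map_def orientation_preserving_def by simp
  moreover have "\<eta> ` V = critical_points f \<union> postcritical_set f" unfolding critf pc PV by blast
  ultimately show ?thesis using inj_eta fe lde by blast
qed

section \<open>Combinatorics of NET portraits\<close>

locale net_portrait =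
  fixes \<Gamma> :: "('a, 'b) pre_digraph" and w :: "'b \<Rightarrow> nat"
  assumes fwd: "finite_weighted_digraph \<Gamma> w" and obv: "NET_obvious_conditions \<Gamma> w"
begin

abbreviation "C \<equiv> critical_vertices \<Gamma> w"
abbreviation "Pc \<equiv> postcritical_vertices \<Gamma> w"
abbreviation "nxt v \<equiv> head \<Gamma> (out_edge \<Gamma> v)"
abbreviation "d \<equiv> portrait_degree \<Gamma> w"

sublocale fin_digraph \<Gamma> using fwd by (simp add: finite_weighted_digraph_def)

lemma out_edge_unique: "v \<in> verts \<Gamma> \<Longrightarrow> e \<in> arcs \<Gamma> \<Longrightarrow> tail \<Gamma> e = v \<Longrightarrow> out_edge \<Gamma> v = e"
  and out_edge_arc: "v \<in> verts \<Gamma> \<Longrightarrow> out_edge \<Gamma> v \<in> arcs \<Gamma>"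
  and tail_out_edge: "v \<in> verts \<Gamma> \<Longrightarrow> tail \<Gamma> (out_edge \<Gamma> v) = v"
proof -
  have ex1: "\<exists>!e. e \<in> out_arcs \<Gamma> v" if "v \<in> verts \<Gamma>" for v
    using obv that by (auto simp: NET_obvious_conditions_def Thurston_obvious_conditions_def)
  have "out_edge \<Gamma> v \<in> out_arcs \<Gamma> v" if "v \<in> verts \<Gamma>" for v
    unfolding out_edge_def by (rule theI'[OF ex1[OF that]])
  then show "v \<in> verts \<Gamma> \<Longrightarrow> out_edge \<Gamma> v \<in> arcs \<Gamma>" "v \<in> verts \<Gamma> \<Longrightarrow> tail \<Gamma> (out_edge \<Gamma> v) = v" by auto
  show "v \<in> verts \<Gamma> \<Longrightarrow> e \<in> arcs \<Gamma> \<Longrightarrow> tail \<Gamma> e = v \<Longrightarrow> out_edge \<Gamma> v = e"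
    unfolding out_edge_def by (rule the1_equality[OF ex1]) auto
qed

lemma out_edge_tail: "e \<in> arcs \<Gamma> \<Longrightarrow> out_edge \<Gamma> (tail \<Gamma> e) = e"
  by (rule out_edge_unique) auto

lemma weight: "v \<in> verts \<Gamma> \<Longrightarrow> w (out_edge \<Gamma> v) = (if v \<in> C then 2 else 1)"
proof -
  assume v: "v \<in> verts \<Gamma>"
  have "w (out_edge \<Gamma> v) = 1 \<or> w (out_edge \<Gamma> v) = 2"
    using obv out_edge_arc[OF v] by (simp add: NET_obvious_conditions_def)
  then show ?thesis using v by (auto simp: critical_vertices_def)
qed

lemma C_verts: "C \<subseteq> verts \<Gamma>" and finite_C: "finite C"
proof -
  show "C \<subseteq> verts \<Gamma>" by (auto simp: critical_vertices_def)
  then show "finite C" using finite_subset finite_verts by blast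
qed

lemma verts_eq: "verts \<Gamma> = C \<union> Pc" and card_Pc: "card Pc = 4"
  using obv by (simp_all add: NET_obvious_conditions_def Thurston_obvious_conditions_def)

lemma arcs_ends_iff: "(u, v) \<in> arcs_ends \<Gamma> \<longleftrightarrow> u \<in> verts \<Gamma> \<and> v = nxt u"
proof
  assume "(u, v) \<in> arcs_ends \<Gamma>"
  then obtain e where e: "e \<in> arcs \<Gamma>" "tail \<Gamma> e = u" "head \<Gamma> e = v" by (auto simp: arcs_ends_def arc_to_ends_def)
  then show "u \<in> verts \<Gamma> \<and> v = nxt u" using out_edge_tail[OF e(1)] by auto
next
  assume "u \<in> verts \<Gamma> \<and> v = nxt u"
  then show "(u, v) \<in> arcs_ends \<Gamma>"
    using out_edge_arc[of u] tail_out_edge[of u] by (force simp: arcs_ends_def arc_to_ends_def image_iff)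
qed

lemma nxt_verts: "v \<in> verts \<Gamma> \<Longrightarrow> nxt v \<in> verts \<Gamma>"
  using out_edge_arc by simp

lemma nxt_Pc: "v \<in> verts \<Gamma> \<Longrightarrow> nxt v \<in> Pc"
proof -
  assume v: "v \<in> verts \<Gamma>"
  then have e: "(v, nxt v) \<in> arcs_ends \<Gamma>" using arcs_ends_iff by blast
  from v consider "v \<in> C" | "v \<in> Pc" using verts_eq by blast
  then show "nxt v \<in> Pc"
  proof cases
    case 1 then show ?thesis using e nxt_verts[OF v] by (auto simp: postcritical_vertices_def)
  next
    case 2
    then obtain u where "u \<in> C" "(u, v) \<in> (arcs_ends \<Gamma>)\<^sup>+" by (auto simp: postcritical_vertices_def)
    then show ?thesis using trancl_into_trancl[OF _ e] nxt_verts[OF v] by (auto simp: postcritical_vertices_def)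
  qed
qed

lemma funpow_nxt_verts: "v \<in> verts \<Gamma> \<Longrightarrow> ((\<lambda>v. nxt v) ^^ k) v \<in> verts \<Gamma>"
  by (induction k) (auto intro: nxt_verts)

lemma Pc_orbit: "Pc = (\<Union>k\<in>{1..}. ((\<lambda>v. nxt v) ^^ k) ` C)"
proof
  show "Pc \<subseteq> (\<Union>k\<in>{1..}. ((\<lambda>v. nxt v) ^^ k) ` C)"
  proof
    fix v assume "v \<in> Pc"
    then obtain u where u: "u \<in> C" "(u, v) \<in> (arcs_ends \<Gamma>)\<^sup>+" by (auto simp: postcritical_vertices_def)
    from u(2) have "\<exists>k\<ge>1. v = ((\<lambda>v. nxt v) ^^ k) u"
    proof (induction rule: trancl_induct)
      case (base y)
      then show ?case using arcs_ends_iff by (intro exI[of _ 1]) auto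
    next
      case (step y z)
      then obtain k where k: "1 \<le> k" "y = ((\<lambda>v. nxt v) ^^ k) u" by blast
      moreover have "z = nxt y" using step arcs_ends_iff by blast
      ultimately show ?case by (intro exI[of _ "Suc k"]) auto
    qed
    then show "v \<in> (\<Union>k\<in>{1..}. ((\<lambda>v. nxt v) ^^ k) ` C)" using u(1) by blast
  qed
  have "((\<lambda>v. nxt v) ^^ Suc k) u \<in> Pc" if "u \<in> C" for u k
    using nxt_Pc[OF funpow_nxt_verts[of u k]] that C_verts by auto
  moreover have "\<exists>j. k = Suc j" if "1 \<le> k" for k using that by (cases k) auto
  ultimately show "(\<Union>k\<in>{1..}. ((\<lambda>v. nxt v) ^^ k) ` C) \<subseteq> Pc" by fastforce
qed

section \<open>Counting the edges into postcritical vertices\<close>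

definition a :: "'a \<Rightarrow> nat" where "a q = card {v \<in> C. nxt v = q}"
definition b :: "'a \<Rightarrow> nat" where "b q = card {v \<in> verts \<Gamma> - C. nxt v = q}"

lemma incoming_degree_eq: "incoming_degree \<Gamma> w q = 2 * a q + b q"
proof -
  let ?S = "{v \<in> verts \<Gamma>. nxt v = q}"
  have "bij_betw (out_edge \<Gamma>) ?S (in_arcs \<Gamma> q)"
    unfolding bij_betw_def
  proof
    show "inj_on (out_edge \<Gamma>) ?S" by (rule inj_on_inverseI[of _ "tail \<Gamma>"]) (auto simp: tail_out_edge)
    show "out_edge \<Gamma> ` ?S = in_arcs \<Gamma> q"
    proof
      show "out_edge \<Gamma> ` ?S \<subseteq> in_arcs \<Gamma> q" using out_edge_arc by auto
      show "in_arcs \<Gamma> q \<subseteq> out_edge \<Gamma> ` ?S"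
      proof
        fix e assume "e \<in> in_arcs \<Gamma> q"
        then show "e \<in> out_edge \<Gamma> ` ?S" using out_edge_tail[of e] by (intro image_eqI[of _ _ "tail \<Gamma> e"]) auto
      qed
    qed
  qed
  then have "incoming_degree \<Gamma> w q = (\<Sum>v\<in>?S. w (out_edge \<Gamma> v))"
    unfolding incoming_degree_def by (rule sum.reindex_bij_betw[symmetric])
  also have "\<dots> = (\<Sum>v\<in>?S. if v \<in> C then 2 else 1)" by (rule sum.cong) (auto simp: weight)
  also have "\<dots> = (\<Sum>v\<in>{v \<in> C. nxt v = q} \<union> {v \<in> verts \<Gamma> - C. nxt v = q}. if v \<in> C then 2 else 1)"
    by (rule sum.cong) (use C_verts in auto)
  also have "\<dots> = (\<Sum>v\<in>{v \<in> C. nxt v = q}. if v \<in> C then 2 else 1) + (\<Sum>v\<in>{v \<in> verts \<Gamma> - C. nxt v = q}. if v \<in> C then 2 else 1)"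
    by (rule sum.union_disjoint) (use finite_C in auto)
  also have "\<dots> = 2 * a q + b q" by (simp add: a_def b_def)
  finally show ?thesis .
qed

text \<open>All critical weights are 2, so the weight sum counts the critical vertices and
  determines the degree. This gives the \<open>THE\<close> in \<open>portrait_degree\<close> its
  meaning.\<close>

lemma degree_d: "2 \<le> d" "card C = 2 * d - 2" "\<And>v. v \<in> verts \<Gamma> \<Longrightarrow> 2 * a v + b v \<le> d"
proof -
  have s: "(\<Sum>v\<in>C. w (out_edge \<Gamma> v) - 1) = card C"
  proof -
    have "(\<Sum>v\<in>C. w (out_edge \<Gamma> v) - 1) = (\<Sum>v\<in>C. 1)" by (rule sum.cong) (use C_verts weight in auto)
    then show ?thesis by simp
  qed
  have "\<exists>k. has_portrait_degree \<Gamma> w k"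
    using obv by (simp add: NET_obvious_conditions_def Thurston_obvious_conditions_def)
  moreover have "k = j" if "has_portrait_degree \<Gamma> w k" "has_portrait_degree \<Gamma> w j" for k j
    using that unfolding has_portrait_degree_def s by linarith
  ultimately have "has_portrait_degree \<Gamma> w d"
    unfolding portrait_degree_def by (metis theI)
  then show "2 \<le> d" "card C = 2 * d - 2" "\<And>v. v \<in> verts \<Gamma> \<Longrightarrow> 2 * a v + b v \<le> d"
    unfolding has_portrait_degree_def s incoming_degree_eq by auto
qed

text \<open>The number of non-critical points that a realizing map must have over q. The portrait
  contains only \<open>b q\<close> of them, since such points need not be vertices.\<close>

definition \<beta> :: "'a \<Rightarrow> nat" where "\<beta> q = d - 2 * a q"

lemma \<beta>: "q \<in> Pc \<Longrightarrow> 2 * a q + \<beta> q = d" "q \<in> Pc \<Longrightarrow> b q \<le> \<beta> q"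
  using degree_d(3)[of q] verts_eq unfolding \<beta>_def by fastforce+

lemma finite_Pc: "finite Pc"
  using card_Pc by (metis card.infinite zero_neq_numeral)

text \<open>The Riemann-Hurwitz relation: 4d minus twice the 2d - 2 critical edges, all of which end
  in Pc.\<close>

lemma sum_\<beta>: "(\<Sum>q\<in>Pc. \<beta> q) = 4"
proof -
  have "C = (\<Union>q\<in>Pc. {v \<in> C. nxt v = q})" using nxt_Pc C_verts by auto
  moreover have "card (\<Union>q\<in>Pc. {v \<in> C. nxt v = q}) = (\<Sum>q\<in>Pc. a q)"
    unfolding a_def by (rule card_UN_disjoint) (use finite_Pc finite_C in auto)
  ultimately have "(\<Sum>q\<in>Pc. a q) = 2 * d - 2" using degree_d(2) by simp
  moreover have "2 * (\<Sum>q\<in>Pc. a q) + (\<Sum>q\<in>Pc. \<beta> q) = (\<Sum>q\<in>Pc. d)"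
    unfolding sum_distrib_left sum.distrib[symmetric] by (rule sum.cong) (use \<beta>(1) in auto)
  moreover have "(\<Sum>q\<in>Pc. d) = 4 * d" using card_Pc by simp
  ultimately show ?thesis using degree_d(1) by linarith
qed

text \<open>If \<beta> q = 0, the critical edges exhaust the degree and leave no room for an edge of
  weight 1. Conversely, without such edges the incoming degree is twice the number of critical
  edges.\<close>

lemma full_eq: "full_critical_values \<Gamma> w = {q \<in> Pc. \<beta> q = 0}"
proof
  show "full_critical_values \<Gamma> w \<subseteq> {q \<in> Pc. \<beta> q = 0}"
  proof
    fix q assume "q \<in> full_critical_values \<Gamma> w"
    then have q: "q \<in> critical_values \<Gamma> w" "2 * a q + b q = d" "\<forall>e\<in>in_arcs \<Gamma> q. w e \<noteq> 1"
      by (simp_all add: full_critical_values_def incoming_degree_eq)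
    have "q \<in> Pc" using q(1) nxt_Pc C_verts by (auto simp: critical_values_def)
    moreover have "{v \<in> verts \<Gamma> - C. nxt v = q} = {}" using q(3) weight out_edge_arc by fastforce
    then have "b q = 0" unfolding b_def by (metis card.empty)
    ultimately show "q \<in> {q \<in> Pc. \<beta> q = 0}" using q(2) by (simp add: \<beta>_def)
  qed
  show "{q \<in> Pc. \<beta> q = 0} \<subseteq> full_critical_values \<Gamma> w"
  proof
    fix q assume "q \<in> {q \<in> Pc. \<beta> q = 0}"
    then have q: "q \<in> Pc" "2 * a q = d" "b q = 0" using \<beta>[of q] by auto
    have "{v \<in> C. nxt v = q} \<noteq> {}" using q(2) degree_d(1) unfolding a_def by (metis card.empty mult_0_right not_numeral_le_zero)
    then have "q \<in> critical_values \<Gamma> w" by (auto simp: critical_values_def)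
    moreover have "w e \<noteq> 1" if "e \<in> in_arcs \<Gamma> q" for e
    proof -
      have "finite {v \<in> verts \<Gamma> - C. nxt v = q}" using finite_verts by simp
      then have "{v \<in> verts \<Gamma> - C. nxt v = q} = {}" using q(3) unfolding b_def by (metis card_0_eq)
      moreover have "nxt (tail \<Gamma> e) = q" "tail \<Gamma> e \<in> verts \<Gamma>" using that out_edge_tail by auto
      ultimately have "tail \<Gamma> e \<in> C" by blast
      then have "w e = 2" using weight[of "tail \<Gamma> e"] that out_edge_tail by simp
      then show ?thesis by simp
    qed
    ultimately show "q \<in> full_critical_values \<Gamma> w"
      using q by (simp add: full_critical_values_def incoming_degree_eq)
  qed
qed

text \<open>The values add up to 4 and all have the parity of d; sorting them leaves one pattern for
  odd d and two for even d.\<close>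

lemma \<beta>_patterns:
  obtains (odd) p where "odd d" "bij_betw p E4 Pc" "\<And>e. e \<in> E4 \<Longrightarrow> \<beta> (p e) = 1" "card (full_critical_values \<Gamma> w) = 0"
  | (two) p where "even d" "bij_betw p E4 Pc" "\<And>e. e \<in> E4 \<Longrightarrow> \<beta> (p e) = (if e = 0 \<or> e = \<i> then 2 else 0)"
      "card (full_critical_values \<Gamma> w) = 2"
  | (four) p where "even d" "bij_betw p E4 Pc" "\<And>e. e \<in> E4 \<Longrightarrow> \<beta> (p e) = (if e = 0 then 4 else 0)"
      "card (full_critical_values \<Gamma> w) = 3"
proof -
  obtain ys where ys: "set ys = Pc" "distinct ys" using finite_distinct_list[OF finite_Pc] by blast
  define xs where "xs = sort_key \<beta> ys"
  have xs: "set xs = Pc" "distinct xs" "sorted (map \<beta> xs)" using ys by (simp_all add: xs_def)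
  have "length xs = 4" using distinct_card[OF xs(2)] xs(1) card_Pc by simp
  then obtain x1 x2 x3 x4 where x: "xs = [x1, x2, x3, x4]"
    by (auto simp: numeral_eq_Suc length_Suc_conv)
  have Pc: "Pc = {x1, x2, x3, x4}" and dist: "distinct [x1, x2, x3, x4]" using xs x by auto
  have mono: "\<beta> x1 \<le> \<beta> x2" "\<beta> x2 \<le> \<beta> x3" "\<beta> x3 \<le> \<beta> x4" using xs(3) x by auto
  have sum: "\<beta> x1 + \<beta> x2 + \<beta> x3 + \<beta> x4 = 4" using sum_\<beta> dist unfolding Pc by simp
  have par: "even (\<beta> x) \<longleftrightarrow> even d" if "x \<in> Pc" for x using \<beta>(1)[OF that] by (metis dvd_add_right_iff dvd_triv_left)
  have pars: "even (\<beta> x1) \<longleftrightarrow> even d" "even (\<beta> x2) \<longleftrightarrow> even d" "even (\<beta> x3) \<longleftrightarrow> even d" "even (\<beta> x4) \<longleftrightarrow> even d"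
    using par Pc by auto
  \<comment> \<open>The largest value goes to the corner 0 and the next one to \<i>, to match the
    counts of the models.\<close>
  define p where "p e = (if e = 0 then x4 else if e = \<i> then x3 else if e = 1 then x2 else x1)" for e :: complex
  have p4: "p 0 = x4" "p \<i> = x3" "p 1 = x2" "p (1 + \<i>) = x1"
    by (simp_all add: p_def complex_eq_iff)
  have p: "bij_betw p E4 Pc"
    unfolding bij_betw_def
  proof
    show "p ` E4 = Pc" unfolding E4_def Pc by (auto simp: p4)
    then show "inj_on p E4" using eq_card_imp_inj_on[OF finite_E4] card_E4 card_Pc by metis
  qed
  have E4: "e = 0 \<or> e = \<i> \<or> e = 1 \<or> e = 1 + \<i>" if "e \<in> E4" for e using that by (auto simp: E4_def)
  show ?thesis
  proof (cases "odd d")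
    case True
    have "\<beta> x1 \<noteq> 0" using pars True by (metis even_zero)
    then have v: "\<beta> x1 = 1" "\<beta> x2 = 1" "\<beta> x3 = 1" "\<beta> x4 = 1" using mono sum by linarith+
    then have "{q \<in> Pc. \<beta> q = 0} = {}" unfolding Pc by auto
    then have "card (full_critical_values \<Gamma> w) = 0" unfolding full_eq by (metis card.empty)
    moreover have "\<beta> (p e) = 1" if "e \<in> E4" for e using E4[OF that] v by (auto simp: p_def)
    ultimately show ?thesis using odd True p by blast
  next
    case False
    have v0: "\<beta> x1 = 0" "\<beta> x2 = 0" "\<beta> x3 = 2 \<and> \<beta> x4 = 2 \<or> \<beta> x3 = 0 \<and> \<beta> x4 = 4"
    proof -
      obtain k1 k2 k3 k4 where k: "\<beta> x1 = 2 * k1" "\<beta> x2 = 2 * k2" "\<beta> x3 = 2 * k3" "\<beta> x4 = 2 * k4"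
        using pars False by (meson evenE)
      have "k1 = 0" "k2 = 0" using mono sum unfolding k by linarith+
      moreover from this have "k3 = 1 \<and> k4 = 1 \<or> k3 = 0 \<and> k4 = 2" using mono sum unfolding k by arith
      ultimately show "\<beta> x1 = 0" "\<beta> x2 = 0" "\<beta> x3 = 2 \<and> \<beta> x4 = 2 \<or> \<beta> x3 = 0 \<and> \<beta> x4 = 4"
        using k by auto
    qed
    from v0(3) show ?thesis
    proof
      assume v: "\<beta> x3 = 2 \<and> \<beta> x4 = 2"
      then have "{q \<in> Pc. \<beta> q = 0} = {x1, x2}" unfolding Pc using v0 by auto
      then have "card (full_critical_values \<Gamma> w) = 2" unfolding full_eq using dist by simp
      moreover have "\<beta> (p e) = (if e = 0 \<or> e = \<i> then 2 else 0)" if "e \<in> E4" for e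
        using E4[OF that] v v0 by (auto simp: p_def)
      ultimately show ?thesis using two False p by blast
    next
      assume v: "\<beta> x3 = 0 \<and> \<beta> x4 = 4"
      then have "{q \<in> Pc. \<beta> q = 0} = {x1, x2, x3}" unfolding Pc using v0 by auto
      then have "card (full_critical_values \<Gamma> w) = 3" unfolding full_eq using dist by simp
      moreover have "\<beta> (p e) = (if e = 0 then 4 else 0)" if "e \<in> E4" for e
        using E4[OF that] v v0 by (auto simp: p_def)
      ultimately show ?thesis using four False p by blast
    qed
  qed
qed

lemma exceptional_condition_iff: "exceptional_condition \<Gamma> w \<longleftrightarrow> (card (full_critical_values \<Gamma> w) = 3 \<longrightarrow> 4 dvd d)"
proof -
  have "card (full_critical_values \<Gamma> w) \<in> {0, 2, 3}" by (rule \<beta>_patterns) auto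
  then show ?thesis by (auto simp: exceptional_condition_def mod2_elementary_divisors_def Let_def)
qed

section \<open>Passing between the graph and a map\<close>

lemma realized_if_model:
  assumes p: "bij_betw p E4 Pc" and model: "pillow_model d n f0" and n: "\<And>e. e \<in> E4 \<Longrightarrow> \<beta> (p e) = n e"
  shows "\<exists>f. NET_map f \<and> weighted_digraph_iso \<Gamma> w (dynamic_portrait f) (local_degree f)"
proof -
  have pE: "p e \<in> Pc" if "e \<in> E4" for e using p that by (auto simp: bij_betw_def)
  have "\<exists>f \<eta>. NET_map f \<and> inj_on \<eta> (verts \<Gamma>) \<and> \<eta> ` verts \<Gamma> = critical_points f \<union> postcritical_set f \<and>
    (\<forall>v\<in>verts \<Gamma>. f (\<eta> v) = \<eta> (nxt v)) \<and> (\<forall>v\<in>verts \<Gamma>. local_degree f (\<eta> v) = (if v \<in> C then 2 else 1))"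
  proof (rule portrait_realization[OF model finite_verts C_verts verts_eq nxt_Pc p _ _ Pc_orbit])
    show "2 * card {v \<in> C. nxt v = p e} + n e = d" if "e \<in> E4" for e
      using \<beta>(1)[OF pE[OF that]] n[OF that] by (simp add: a_def)
    show "card {v \<in> verts \<Gamma> - C. nxt v = p e} \<le> n e" if "e \<in> E4" for e
      using \<beta>(2)[OF pE[OF that]] n[OF that] by (simp add: b_def)
  qed
  then obtain f \<eta> where f: "NET_map f" and inj: "inj_on \<eta> (verts \<Gamma>)"
    and V: "\<eta> ` verts \<Gamma> = critical_points f \<union> postcritical_set f"
    and fe: "\<And>v. v \<in> verts \<Gamma> \<Longrightarrow> f (\<eta> v) = \<eta> (nxt v)"
    and ld: "\<And>v. v \<in> verts \<Gamma> \<Longrightarrow> local_degree f (\<eta> v) = (if v \<in> C then 2 else 1)"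
    by blast
  \<comment> \<open>The arcs of a dynamic portrait are its vertices, so an arc is sent to the image
    of its tail.\<close>
  define h where "h = \<lparr>iso_verts = \<eta>, iso_arcs = (\<lambda>e. \<eta> (tail \<Gamma> e)), iso_head = f, iso_tail = (\<lambda>x. x)\<rparr>"
  have tails: "tail \<Gamma> ` arcs \<Gamma> = verts \<Gamma>"
    using out_edge_arc tail_out_edge by (auto intro!: image_eqI[of _ "tail \<Gamma>" "out_edge \<Gamma> _"])
  have "inj_on (\<lambda>e. \<eta> (tail \<Gamma> e)) (arcs \<Gamma>)"
  proof (rule inj_onI)
    fix e e' assume e: "e \<in> arcs \<Gamma>" "e' \<in> arcs \<Gamma>" "\<eta> (tail \<Gamma> e) = \<eta> (tail \<Gamma> e')"
    then have "tail \<Gamma> e = tail \<Gamma> e'" using inj by (auto dest: inj_onD)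
    then show "e = e'" using out_edge_tail e by metis
  qed
  then have "digraph_isomorphism h"
    unfolding digraph_isomorphism_def h_def using inj fe out_edge_tail wf_digraph_axioms by simp
  moreover have "dynamic_portrait f = app_iso h \<Gamma>"
  proof -
    have "(\<lambda>e. \<eta> (tail \<Gamma> e)) ` arcs \<Gamma> = \<eta> ` verts \<Gamma>" using tails by (metis image_image)
    then show ?thesis unfolding dynamic_portrait_def app_iso_def h_def using V by simp
  qed
  moreover have "local_degree f (iso_arcs h e) = w e" if "e \<in> arcs \<Gamma>" for e
    using ld[of "tail \<Gamma> e"] weight[of "tail \<Gamma> e"] out_edge_tail that by (simp add: h_def)
  ultimately show ?thesis using f unfolding weighted_digraph_iso_def by blast
qed

lemma realized:
  assumes "exceptional_condition \<Gamma> w"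
  shows "\<exists>f. NET_map f \<and> weighted_digraph_iso \<Gamma> w (dynamic_portrait f) (local_degree f)"
proof (rule \<beta>_patterns)
  fix p assume p: "odd d" "bij_betw p E4 Pc" "\<And>e. e \<in> E4 \<Longrightarrow> \<beta> (p e) = 1"
  obtain f0 where "pillow_model d (\<lambda>_. 1) f0" by (rule pillow_model_odd[OF degree_d(1) p(1)])
  then show ?thesis by (rule realized_if_model[OF p(2)]) (rule p(3))
next
  fix p assume p: "even d" "bij_betw p E4 Pc" "\<And>e. e \<in> E4 \<Longrightarrow> \<beta> (p e) = (if e = 0 \<or> e = \<i> then 2 else 0)"
  obtain f0 where "pillow_model d (\<lambda>e. if e = 0 \<or> e = \<i> then 2 else 0) f0" by (rule pillow_model_even[OF degree_d(1) p(1)])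
  then show ?thesis by (rule realized_if_model[OF p(2)]) (rule p(3))
next
  fix p assume p: "bij_betw p E4 Pc" "\<And>e. e \<in> E4 \<Longrightarrow> \<beta> (p e) = (if e = 0 then 4 else 0)"
    and k: "card (full_critical_values \<Gamma> w) = 3"
  have "4 dvd d" using assms k exceptional_condition_iff by blast
  then obtain f0 where "pillow_model d (\<lambda>e. if e = 0 then 4 else 0) f0" by (rule pillow_model_four[OF degree_d(1)])
  then show ?thesis by (rule realized_if_model[OF p(1)]) (rule p(2))
qed

text \<open>The weights single out the critical points, and the orbits then single out the
  postcritical ones. So the counts \<open>a q\<close> are counts of critical points of f, and three
  full critical values give three full fibres.\<close>

lemma exceptional_if_realized:
  assumes net: "NET_map f" and iso: "weighted_digraph_iso \<Gamma> w (dynamic_portrait f) (local_degree f)"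
  shows "exceptional_condition \<Gamma> w"
  unfolding exceptional_condition_iff
proof
  assume k: "card (full_critical_values \<Gamma> w) = 3"
  obtain h where h: "digraph_isomorphism h" "dynamic_portrait f = app_iso h \<Gamma>"
    "\<And>e. e \<in> arcs \<Gamma> \<Longrightarrow> local_degree f (iso_arcs h e) = w e"
    using iso unfolding weighted_digraph_iso_def by blast
  define \<sigma> where "\<sigma> = iso_verts h"
  \<comment> \<open>Equality of the records also fixes the tail and head maps of h, which makes
    \<sigma> a conjugacy from the successor map to f.\<close>
  have eqs: "\<sigma> ` verts \<Gamma> = critical_points f \<union> postcritical_set f" "iso_tail h = (\<lambda>x. x)" "iso_head h = f"
    using arg_cong[OF h(2), of verts] arg_cong[OF h(2), of tail] arg_cong[OF h(2), of head]
    by (simp_all add: dynamic_portrait_def \<sigma>_def)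
  have inj: "inj_on \<sigma> (verts \<Gamma>)" using h(1) by (simp add: digraph_isomorphism_def \<sigma>_def)
  have arc: "iso_arcs h e = \<sigma> (tail \<Gamma> e)" "f (iso_arcs h e) = \<sigma> (head \<Gamma> e)" if "e \<in> arcs \<Gamma>" for e
    using h(1) that by (simp_all add: digraph_isomorphism_def \<sigma>_def eqs)
  have f\<sigma>: "f (\<sigma> v) = \<sigma> (nxt v)" and ld: "local_degree f (\<sigma> v) = (if v \<in> C then 2 else 1)" if v: "v \<in> verts \<Gamma>" for v
    using arc[OF out_edge_arc[OF v]] h(3)[OF out_edge_arc[OF v]] tail_out_edge[OF v] weight[OF v] by simp_all
  have crit: "critical_points f = \<sigma> ` C"
  proof
    show "critical_points f \<subseteq> \<sigma> ` C"
    proof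
      fix x assume x: "x \<in> critical_points f"
      then obtain v where v: "v \<in> verts \<Gamma>" "x = \<sigma> v" using eqs(1) by blast
      have "1 < local_degree f x" using x by (simp add: critical_points_def)
      then show "x \<in> \<sigma> ` C" using ld[OF v(1)] v(2) by (auto split: if_splits)
    qed
    show "\<sigma> ` C \<subseteq> critical_points f"
    proof
      fix x assume "x \<in> \<sigma> ` C"
      then obtain v where v: "v \<in> C" "x = \<sigma> v" by blast
      have vV: "v \<in> verts \<Gamma>" using v(1) C_verts by blast
      have S: "y \<in> S2" if "y \<in> critical_points f \<union> postcritical_set f" for y
      proof -
        have fS: "z \<in> S2 \<Longrightarrow> f z \<in> S2" for z
          using net continuous_map_S2_iff by (auto simp: NET_map_def Thurston_map_def branched_covering_def)
        have "z \<in> S2 \<Longrightarrow> (f ^^ j) z \<in> S2" for z j by (induction j) (auto intro: fS)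
        then show ?thesis using that by (auto simp: critical_points_def postcritical_set_def)
      qed
      have "x \<in> S2" using S eqs(1) vV v(2) by blast
      then show "x \<in> critical_points f" using ld[OF vV] v by (simp add: critical_points_def)
    qed
  qed
  have iter: "(f ^^ j) (\<sigma> v) = \<sigma> (((\<lambda>v. nxt v) ^^ j) v)" if "v \<in> verts \<Gamma>" for v j
    by (induction j) (use f\<sigma> funpow_nxt_verts[OF that] in auto)
  have post: "postcritical_set f = \<sigma> ` Pc"
  proof -
    have "(f ^^ j) ` \<sigma> ` C = \<sigma> ` ((\<lambda>v. nxt v) ^^ j) ` C" for j
      unfolding image_image by (rule image_cong[OF refl]) (use iter C_verts in blast)
    then show ?thesis unfolding postcritical_set_def crit Pc_orbit image_UN by simp
  qed
  have PcV: "Pc \<subseteq> verts \<Gamma>" using verts_eq by blast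
  have card: "card {x \<in> critical_points f. f x = \<sigma> q} = a q" if q: "q \<in> Pc" for q
  proof -
    have "{x \<in> critical_points f. f x = \<sigma> q} = \<sigma> ` {v \<in> C. nxt v = q}"
    proof
      show "{x \<in> critical_points f. f x = \<sigma> q} \<subseteq> \<sigma> ` {v \<in> C. nxt v = q}"
      proof
        fix x assume "x \<in> {x \<in> critical_points f. f x = \<sigma> q}"
        then obtain v where v: "v \<in> C" "x = \<sigma> v" "f x = \<sigma> q" using crit by blast
        then have "\<sigma> (nxt v) = \<sigma> q" using f\<sigma> C_verts by auto
        then have "nxt v = q" using inj_onD[OF inj] nxt_verts C_verts v(1) q PcV by (metis subsetD)
        then show "x \<in> \<sigma> ` {v \<in> C. nxt v = q}" using v(1,2) by (intro image_eqI[of _ \<sigma> v]) auto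
      qed
      show "\<sigma> ` {v \<in> C. nxt v = q} \<subseteq> {x \<in> critical_points f. f x = \<sigma> q}"
        using crit f\<sigma> C_verts by auto
    qed
    moreover have "inj_on \<sigma> {v \<in> C. nxt v = q}" by (rule inj_on_subset[OF inj]) (use C_verts in auto)
    ultimately show ?thesis by (simp add: card_image a_def)
  qed
  show "4 dvd d"
  proof (rule \<beta>_patterns)
    fix p assume p: "bij_betw p E4 Pc" "\<And>e. e \<in> E4 \<Longrightarrow> \<beta> (p e) = (if e = 0 then 4 else 0)"
    have E0: "0 \<in> E4" by (simp add: E4_def)
    have q: "p 0 \<in> Pc" using p(1) E0 by (auto simp: bij_betw_def)
    show "4 dvd d"
    proof (rule NET_map_full_fibres[OF net])
      show "\<sigma> (p 0) \<in> postcritical_set f" using q post by blast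
      show "2 * card {x \<in> critical_points f. f x = \<sigma> (p 0)} + 4 = d"
        using card[OF q] \<beta>(1)[OF q] p(2)[OF E0] by simp
      fix y assume y: "y \<in> postcritical_set f" "y \<noteq> \<sigma> (p 0)"
      then obtain q' where q': "q' \<in> Pc" "y = \<sigma> q'" using post by blast
      then obtain e where e: "e \<in> E4" "q' = p e" using p(1) by (auto simp: bij_betw_def)
      then have "e \<noteq> 0" using y q' by blast
      then show "2 * card {x \<in> critical_points f. f x = y} = d"
        using card[OF q'(1)] \<beta>(1)[OF q'(1)] p(2)[OF e(1)] e(2) q'(2) by simp
    qed
  qed (use k in auto)
qed

end

theorem corollary9p3:
  fixes \<Gamma> :: "('a, 'b) pre_digraph" and w :: "'b \<Rightarrow> nat"
  assumes "finite_weighted_digraph \<Gamma> w"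
    and "NET_obvious_conditions \<Gamma> w"
  shows "(\<exists>f. NET_map f \<and> weighted_digraph_iso \<Gamma> w (dynamic_portrait f) (local_degree f)) \<longleftrightarrow>
    exceptional_condition \<Gamma> w"
proof -
  interpret net_portrait \<Gamma> w using assms by unfold_locales
  show ?thesis using realized exceptional_if_realized by blast
qed

end
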